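(* Let $X$ be a connected simplicial set, let $\gamma:X_2\to\mathbb{Z}_d$ be a normalized $2$-cocycle, and let $(A,b)=(A_X,b_\gamma)$ be the linear system associated to $(X,\gamma)$. Let $G$ be a group with a central element $J_G$ of order $d$. There is a bijective correspondence between the following sets: 1. the set $\mathrm{Sol}(A,b;G)$ of solutions; 2. the set of group homomorphisms $\theta:\Gamma(A,b)\to G$ such that $\theta(J)=J_G$; 3. the set of group homomorphisms $\theta:\pi_1(\mathbb{Z}_d,X_\gamma)\to G$ such that $\theta(e_1)=J_G$; 4. the set of simplicial set maps $f:X\to\bar N(\mathbb{Z}_d,G)$ such that $f^*(\gamma_{G,d})=[\gamma]$.
   Context: Let $d>1$; cohomology is simplicial cohomology with $\mathbb{Z}_d$ coefficients. A $2$-cocycle $\gamma$ is normalized if $\gamma(s_0x)=\gamma(s_1x)=0$ for all $x\in X_1$. $(A_X,b_\gamma)$ has rows indexed by $X_2$, columns by $X_1$, with $(A_X)_{\sigma,x}=\sum_{0\le i\le2,\ d_i\sigma=x}(-1)^i$ and $(b_\gamma)_\sigma=-\gamma(\sigma)$. For a linear system $(A,b)$ with columns indexed by $V$ and rows by $I$ (each row with finitely many nonzero entries), put $\sigma_i=\{v:A_{iv}\ne0\}$. A solution in $G$ is a function $T:V\to G$ with $T(v)^d=1$ for all $v$, $\{T(v):v\in\sigma_i\}$ pairwise commuting for all $i$, and $\prod_{v\in\sigma_i}T(v)^{A_{iv}}=J_G^{b_i}$ for all $i$; the set of these is $\mathrm{Sol}(A,b;G)$. The solution group $\Gamma(A,b)$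 is generated by $J$ and $e_v$ ($v\in V$) with relations: $J^d=e_v^d=1$; $J$ commutes with all $e_v$; $\{e_v:v\in\sigma_i\}$ pairwise commute; $\prod_{v\in\sigma_i}e_v^{A_{iv}}=J^{b_i}$. The twisted product $X_\gamma$ has $n$-simplices $\mathbb{Z}_d^n\times X_n$, with $d_i(\alpha,\tau)=(d_i\alpha,d_i\tau)$ for $i\ge1$, $s_j(\alpha,\tau)=(s_j\alpha,s_j\tau)$, $d_0(\alpha,\tau)=(\eta(\tau)+d_0\alpha,d_0\tau)$, using the nerve structure of $N\mathbb{Z}_d$ on $\alpha$ and $\eta(\tau)_1=\gamma(\tau|_{012})$, $\eta(\tau)_i=\gamma(\tau|_{0,i,i+1})-\gamma(\tau|_{1,i,i+1})$ for $2\le i\le n-1$, where $\tau|_{ijk}$ is the face of $\tau\in X_n$ on vertices $i,j,k$. The group $\pi_1(\mathbb{Z}_d,Y)$ of a simplicial set $Y$ is generated by $e_y$, $y\in Y_1$, with relations $e_y^d=1$, $[e_{d_i\sigma},e_{d_j\sigma}]=1$, $e_{d_2\sigma}e_{d_0\sigma}=e_{d_1\sigma}$ for all $y\in Y_1$, $\sigma\in Y_2$, $i,j\in\{0,1,2\}$. In $\pi_1(\mathbb{Z}_d,X_\gamma)$, $e_{a,x}$ is the generator for $(a,x)\in\mathbb{Z}_d\times X_1$, and $e_1=e_{1,s_0v}$ for any vertex $v$ (independent of $v$ as $X$ is connected). $N(\mathbb{Z}_d,G)\subset NG$ consists of tuples of pairwise commuting elements with $g_i^d=1$. With $\bar G=G/\langle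 J_G\rangle$, $\bar N(\mathbb{Z}_d,G)\subset N\bar G$ consists of the images $(\bar g_1,\dots,\bar g_n)$ of tuples $(g_1,\dots,g_n)\in N(\mathbb{Z}_d,G)_n$; it is the quotient of $N(\mathbb{Z}_d,G)$ by the free action $(a_1,\dots,a_n)\cdot(g_1,\dots,g_n)=(J_G^{a_1}g_1,\dots,J_G^{a_n}g_n)$ of $N\mathbb{Z}_d$. The class $\gamma_{G,d}\in H^2(\bar N(\mathbb{Z}_d,G))$ is the class classifying the resulting principal $N\mathbb{Z}_d$-bundle $N\mathbb{Z}_d\to N(\mathbb{Z}_d,G)\to\bar N(\mathbb{Z}_d,G)$ (isomorphism classes of principal $N\mathbb{Z}_d$-bundles over $X$ correspond bijectively to $H^2(X)$ via $[\gamma]\mapsto X_\gamma$); equivalently $\gamma_{G,d}=d_2(1)$, the image of $1\in\mathbb{Z}_d\cong H^1(N\mathbb{Z}_d)$ under the transgression $d_2:H^1(N\mathbb{Z}_d)\to H^2(\bar N(\mathbb{Z}_d,G))$ in the Serre spectral sequence.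
   Formalization: Set 4 is put in bijection not with the solutions but with solutions modulo T(x) -> J^{c(x)}T(x), c a 1-cocycle of X; the literal claim fails for X=Delta[1], gamma=0, d=2, G=Z_2: two solutions, one map. Sets 1-3 are as stated. *)

theory Defs
  imports "HOL-Algebra.Product_Groups" "HOL-Algebra.Multiplicative_Group"
begin

section \<open>Simplicial sets\<close>

text \<open>\<open>face X n i\<close> is \<open>d_i : X_n \<rightarrow> X_(n-1)\<close> and \<open>degen X n j\<close> is \<open>s_j : X_n \<rightarrow> X_(n+1)\<close>; only
  their values on \<open>cells X n\<close> matter.\<close>

record 'a sset =
  cells :: "nat \<Rightarrow> 'a set"
  face :: "nat \<Rightarrow> nat \<Rightarrow> 'a \<Rightarrow> 'a"
  degen :: "nat \<Rightarrow> nat \<Rightarrow> 'a \<Rightarrow> 'a"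

locale simplicial_set =
  fixes X :: "'a sset"
  assumes face_closed:
      "\<lbrakk>x \<in> cells X (Suc n); i \<le> Suc n\<rbrakk> \<Longrightarrow> face X (Suc n) i x \<in> cells X n"
    and degen_closed:
      "\<lbrakk>x \<in> cells X n; j \<le> n\<rbrakk> \<Longrightarrow> degen X n j x \<in> cells X (Suc n)"
    and face_face:
      "\<lbrakk>x \<in> cells X (n + 2); i < j; j \<le> n + 2\<rbrakk>
        \<Longrightarrow> face X (n + 1) i (face X (n + 2) j x) = face X (n + 1) (j - 1) (face X (n + 2) i x)"
    and degen_degen:
      "\<lbrakk>x \<in> cells X n; i \<le> j; j \<le> n\<rbrakk>
        \<Longrightarrow> degen X (n + 1) i (degen X n j x) = degen X (n + 1) (j + 1) (degen X n i x)"
    and face_degen_less: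
      "\<lbrakk>x \<in> cells X n; i < j; j \<le> n\<rbrakk>
        \<Longrightarrow> face X (n + 1) i (degen X n j x) = degen X (n - 1) (j - 1) (face X n i x)"
    and face_degen_id:
      "\<lbrakk>x \<in> cells X n; j \<le> n; i = j \<or> i = j + 1\<rbrakk> \<Longrightarrow> face X (n + 1) i (degen X n j x) = x"
    and face_degen_greater:
      "\<lbrakk>x \<in> cells X n; j + 1 < i; i \<le> n + 1\<rbrakk>
        \<Longrightarrow> face X (n + 1) i (degen X n j x) = degen X (n - 1) j (face X n (i - 1) x)"

definition simplicial_map :: "'a sset \<Rightarrow> 'b sset \<Rightarrow> (nat \<Rightarrow> 'a \<Rightarrow> 'b) \<Rightarrow> bool" where
  "simplicial_map X Y f \<longleftrightarrow>
     (\<forall>n. f n \<in> cells X n \<rightarrow>\<^sub>E cells Y n) \<and>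
     (\<forall>n. \<forall>x\<in>cells X (Suc n). \<forall>i\<le>Suc n. f n (face X (Suc n) i x) = face Y (Suc n) i (f (Suc n) x)) \<and>
     (\<forall>n. \<forall>x\<in>cells X n. \<forall>j\<le>n. f (Suc n) (degen X n j x) = degen Y n j (f n x))"

definition edge_rel :: "'a sset \<Rightarrow> ('a \<times> 'a) set" where
  "edge_rel X = (\<lambda>x. (face X 1 1 x, face X 1 0 x)) ` cells X 1"

definition sset_connected :: "'a sset \<Rightarrow> bool" where
  "sset_connected X \<longleftrightarrow> cells X 0 \<noteq> {} \<and>
     (\<forall>v\<in>cells X 0. \<forall>w\<in>cells X 0. (v, w) \<in> (edge_rel X \<union> (edge_rel X)\<inverse>)\<^sup>*)"

text \<open>The face of an \<open>n\<close>-simplex on a set \<open>S\<close> of vertices.  The vertices outside \<open>S\<close> are deleted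
  from the top down, so that the smaller vertex numbers do not shift.\<close>

definition face_on :: "'a sset \<Rightarrow> nat \<Rightarrow> nat set \<Rightarrow> 'a \<Rightarrow> 'a" where
  "face_on X n S x =
     snd (fold (\<lambda>m (k, y). (k - 1, face X k m y)) (rev (filter (\<lambda>m. m \<notin> S) [0..<Suc n])) (n, x))"


section \<open>Cohomology with coefficients in \<open>\<int>/d\<close>\<close>

abbreviation Zmod :: "nat \<Rightarrow> int monoid" where
  "Zmod d \<equiv> integer_mod_group d"

definition cochain_group :: "nat \<Rightarrow> 'a sset \<Rightarrow> nat \<Rightarrow> ('a \<Rightarrow> int) monoid" where
  "cochain_group d X n = product_group (cells X n) (\<lambda>_. Zmod d)"

definition coboundary :: "nat \<Rightarrow> 'a sset \<Rightarrow> nat \<Rightarrow> ('a \<Rightarrow> int) \<Rightarrow> ('a \<Rightarrow> int)" where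
  "coboundary d X n c =
     (\<lambda>x\<in>cells X (Suc n). (\<Sum>i\<le>Suc n. (- 1) ^ i * c (face X (Suc n) i x)) mod int d)"

definition cocycles :: "nat \<Rightarrow> 'a sset \<Rightarrow> nat \<Rightarrow> ('a \<Rightarrow> int) set" where
  "cocycles d X n = kernel (cochain_group d X n) (cochain_group d X (Suc n)) (coboundary d X n)"

definition H2 :: "nat \<Rightarrow> 'a sset \<Rightarrow> ('a \<Rightarrow> int) set monoid" where
  "H2 d X = (cochain_group d X 2)\<lparr>carrier := cocycles d X 2\<rparr>
              Mod (coboundary d X 1 ` carrier (cochain_group d X 1))"

definition H2_class :: "nat \<Rightarrow> 'a sset \<Rightarrow> ('a \<Rightarrow> int) \<Rightarrow> ('a \<Rightarrow> int) set" where
  "H2_class d X c =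
     (coboundary d X 1 ` carrier (cochain_group d X 1)) #>\<^bsub>cochain_group d X 2\<^esub> c"

definition H2_pullback ::
    "nat \<Rightarrow> 'a sset \<Rightarrow> (nat \<Rightarrow> 'a \<Rightarrow> 'b) \<Rightarrow> ('b \<Rightarrow> int) set \<Rightarrow> ('a \<Rightarrow> int) set" where
  "H2_pullback d X f C = (\<Union>c\<in>C. H2_class d X (\<lambda>x\<in>cells X 2. c (f 2 x)))"

definition normalized :: "'a sset \<Rightarrow> ('a \<Rightarrow> int) \<Rightarrow> bool" where
  "normalized X \<gamma> \<longleftrightarrow> (\<forall>x\<in>cells X 1. \<gamma> (degen X 1 0 x) = 0 \<and> \<gamma> (degen X 1 1 x) = 0)"


section \<open>Group presentations\<close>

text \<open>The letter \<open>(g, False)\<close> stands for the generator \<open>g\<close> and \<open>(g, True)\<close> for its inverse.\<close>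

type_synonym 'g word = "('g \<times> bool) list"

definition words :: "'g set \<Rightarrow> 'g word set" where
  "words S = lists (S \<times> UNIV)"

definition power_word :: "'g \<Rightarrow> int \<Rightarrow> 'g word" where
  "power_word g k = replicate (nat \<bar>k\<bar>) (g, k < 0)"

inductive pres_eq :: "'g set \<Rightarrow> ('g word \<times> 'g word) set \<Rightarrow> 'g word \<Rightarrow> 'g word \<Rightarrow> bool"
  for S R where
  refl: "w \<in> words S \<Longrightarrow> pres_eq S R w w"
| sym: "pres_eq S R v w \<Longrightarrow> pres_eq S R w v"
| trans: "pres_eq S R u v \<Longrightarrow> pres_eq S R v w \<Longrightarrow> pres_eq S R u w"
| cancel: "\<lbrakk>u \<in> words S; v \<in> words S; g \<in> S\<rbrakk>
    \<Longrightarrow> pres_eq S R (u @ [(g, b), (g, \<not> b)] @ v) (u @ v)"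
| relation: "\<lbrakk>u \<in> words S; v \<in> words S; l \<in> words S; r \<in> words S; (l, r) \<in> R\<rbrakk>
    \<Longrightarrow> pres_eq S R (u @ l @ v) (u @ r @ v)"

definition pres_class :: "'g set \<Rightarrow> ('g word \<times> 'g word) set \<Rightarrow> 'g word \<Rightarrow> 'g word set" where
  "pres_class S R w = {v. pres_eq S R w v}"

definition presented_group :: "'g set \<Rightarrow> ('g word \<times> 'g word) set \<Rightarrow> 'g word set monoid" where
  "presented_group S R =
     \<lparr>carrier = pres_class S R ` words S,
      monoid.mult = (\<lambda>P Q. \<Union>u\<in>P. \<Union>v\<in>Q. pres_class S R (u @ v)),
      one = pres_class S R []\<rparr>"


section \<open>Linear systems over \<open>\<int>/d\<close>\<close>

text \<open>A system is given by its set \<open>V\<close> of columns, its set \<open>I\<close> of rows, the matrix \<open>A\<close> and the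
  right-hand side \<open>b\<close>, whose entries are the representatives in \<open>{0..<d}\<close> of elements of \<open>\<int>/d\<close>.
  The factors of the product over a row commute, so the product does not depend on their order; it is
  required to have the prescribed value for every enumeration \<open>vs\<close> of the support of the row.\<close>

definition row_support :: "'v set \<Rightarrow> ('i \<Rightarrow> 'v \<Rightarrow> int) \<Rightarrow> 'i \<Rightarrow> 'v set" where
  "row_support V A i = {v \<in> V. A i v \<noteq> 0}"

definition Sol ::
    "nat \<Rightarrow> 'v set \<Rightarrow> 'i set \<Rightarrow> ('i \<Rightarrow> 'v \<Rightarrow> int) \<Rightarrow> ('i \<Rightarrow> int) \<Rightarrow> ('g, 'm) monoid_scheme \<Rightarrow> 'g
      \<Rightarrow> ('v \<Rightarrow> 'g) set" where
  "Sol d V I A b G J =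
     {T \<in> V \<rightarrow>\<^sub>E carrier G.
       (\<forall>v\<in>V. T v [^]\<^bsub>G\<^esub> d = \<one>\<^bsub>G\<^esub>) \<and>
       (\<forall>i\<in>I. \<forall>v\<in>row_support V A i. \<forall>w\<in>row_support V A i. T v \<otimes>\<^bsub>G\<^esub> T w = T w \<otimes>\<^bsub>G\<^esub> T v) \<and>
       (\<forall>i\<in>I. \<forall>vs. distinct vs \<and> set vs = row_support V A i \<longrightarrow>
          foldr (\<lambda>v p. T v [^]\<^bsub>G\<^esub> A i v \<otimes>\<^bsub>G\<^esub> p) vs \<one>\<^bsub>G\<^esub> = J [^]\<^bsub>G\<^esub> b i)}"

datatype 'v sol_gen = GenJ | Gen 'v

definition sol_gens :: "'v set \<Rightarrow> 'v sol_gen set" where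
  "sol_gens V = insert GenJ (Gen ` V)"

definition sol_rels ::
    "nat \<Rightarrow> 'v set \<Rightarrow> 'i set \<Rightarrow> ('i \<Rightarrow> 'v \<Rightarrow> int) \<Rightarrow> ('i \<Rightarrow> int)
      \<Rightarrow> ('v sol_gen word \<times> 'v sol_gen word) set" where
  "sol_rels d V I A b =
     {(power_word g (int d), []) | g. g \<in> sol_gens V} \<union>
     {([(GenJ, False), (Gen v, False)], [(Gen v, False), (GenJ, False)]) | v. v \<in> V} \<union>
     {([(Gen v, False), (Gen w, False)], [(Gen w, False), (Gen v, False)]) | v w.
        \<exists>i\<in>I. v \<in> row_support V A i \<and> w \<in> row_support V A i} \<union>
     {(concat (map (\<lambda>v. power_word (Gen v) (A i v)) vs), power_word GenJ (b i)) | i vs.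
        i \<in> I \<and> distinct vs \<and> set vs = row_support V A i}"

definition sol_group ::
    "nat \<Rightarrow> 'v set \<Rightarrow> 'i set \<Rightarrow> ('i \<Rightarrow> 'v \<Rightarrow> int) \<Rightarrow> ('i \<Rightarrow> int) \<Rightarrow> 'v sol_gen word set monoid" where
  "sol_group d V I A b = presented_group (sol_gens V) (sol_rels d V I A b)"

definition sol_el ::
    "nat \<Rightarrow> 'v set \<Rightarrow> 'i set \<Rightarrow> ('i \<Rightarrow> 'v \<Rightarrow> int) \<Rightarrow> ('i \<Rightarrow> int) \<Rightarrow> 'v sol_gen
      \<Rightarrow> 'v sol_gen word set" where
  "sol_el d V I A b g = pres_class (sol_gens V) (sol_rels d V I A b) [(g, False)]"

definition A_mat :: "nat \<Rightarrow> 'a sset \<Rightarrow> 'a \<Rightarrow> 'a \<Rightarrow> int" where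
  "A_mat d X \<sigma> x = (\<Sum>i | i \<le> 2 \<and> face X 2 i \<sigma> = x. (- 1) ^ i) mod int d"

definition b_vec :: "nat \<Rightarrow> ('a \<Rightarrow> int) \<Rightarrow> 'a \<Rightarrow> int" where
  "b_vec d \<gamma> \<sigma> = (- \<gamma> \<sigma>) mod int d"


section \<open>Nerves\<close>

definition nerve_face :: "('g, 'm) monoid_scheme \<Rightarrow> nat \<Rightarrow> nat \<Rightarrow> 'g list \<Rightarrow> 'g list" where
  "nerve_face G n i gs =
     (if i = 0 then tl gs
      else if i = n then butlast gs
      else take (i - 1) gs @ [gs ! (i - 1) \<otimes>\<^bsub>G\<^esub> gs ! i] @ drop (i + 1) gs)"

definition nerve_degen :: "('g, 'm) monoid_scheme \<Rightarrow> nat \<Rightarrow> nat \<Rightarrow> 'g list \<Rightarrow> 'g list" where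
  "nerve_degen G n j gs = take j gs @ [\<one>\<^bsub>G\<^esub>] @ drop j gs"

definition nerve :: "('g, 'm) monoid_scheme \<Rightarrow> 'g list sset" where
  "nerve G = \<lparr>cells = \<lambda>n. {gs. length gs = n \<and> set gs \<subseteq> carrier G},
              face = nerve_face G, degen = nerve_degen G\<rparr>"

definition N_comm :: "nat \<Rightarrow> ('g, 'm) monoid_scheme \<Rightarrow> 'g list sset" where
  "N_comm d G = (nerve G)\<lparr>cells := \<lambda>n. {gs \<in> cells (nerve G) n.
      (\<forall>g\<in>set gs. \<forall>h\<in>set gs. g \<otimes>\<^bsub>G\<^esub> h = h \<otimes>\<^bsub>G\<^esub> g) \<and> (\<forall>g\<in>set gs. g [^]\<^bsub>G\<^esub> d = \<one>\<^bsub>G\<^esub>)}\<rparr>"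

definition J_coset :: "('g, 'm) monoid_scheme \<Rightarrow> 'g \<Rightarrow> 'g \<Rightarrow> 'g set" where
  "J_coset G J g = generate G {J} #>\<^bsub>G\<^esub> g"

definition N_bar :: "nat \<Rightarrow> ('g, 'm) monoid_scheme \<Rightarrow> 'g \<Rightarrow> 'g set list sset" where
  "N_bar d G J = (nerve (G Mod generate G {J}))
     \<lparr>cells := \<lambda>n. map (J_coset G J) ` cells (N_comm d G) n\<rparr>"


section \<open>Principal bundles\<close>

definition twist :: "nat \<Rightarrow> 'a sset \<Rightarrow> ('a \<Rightarrow> int) \<Rightarrow> nat \<Rightarrow> 'a \<Rightarrow> int list" where
  "twist d X \<gamma> n \<tau> =
     map (\<lambda>i. if i = 1 then \<gamma> (face_on X n {0, 1, 2} \<tau>)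
              else (\<gamma> (face_on X n {0, i, i + 1} \<tau>) - \<gamma> (face_on X n {1, i, i + 1} \<tau>)) mod int d)
       [1..<n]"

definition twisted_product :: "nat \<Rightarrow> 'a sset \<Rightarrow> ('a \<Rightarrow> int) \<Rightarrow> (int list \<times> 'a) sset" where
  "twisted_product d X \<gamma> =
     \<lparr>cells = \<lambda>n. cells (nerve (Zmod d)) n \<times> cells X n,
      face = \<lambda>n i (\<alpha>, \<tau>).
        (if i = 0 then map2 (mult (Zmod d)) (twist d X \<gamma> n \<tau>) (face (nerve (Zmod d)) n 0 \<alpha>)
         else face (nerve (Zmod d)) n i \<alpha>,
         face X n i \<tau>),
      degen = \<lambda>n j (\<alpha>, \<tau>). (degen (nerve (Zmod d)) n j \<alpha>, degen X n j \<tau>)\<rparr>"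

text \<open>An isomorphism of principal \<open>N(\<int>/d)\<close>-bundles over a common base.  Each bundle is given by its
  total space, the action of \<open>N(\<int>/d)\<close> on it and the projection; action and projection are the
  same formula in all degrees for the bundles used below.\<close>

definition bundle_iso ::
    "nat \<Rightarrow> 'e sset \<Rightarrow> (int list \<Rightarrow> 'e \<Rightarrow> 'e) \<Rightarrow> ('e \<Rightarrow> 'b)
         \<Rightarrow> 'f sset \<Rightarrow> (int list \<Rightarrow> 'f \<Rightarrow> 'f) \<Rightarrow> ('f \<Rightarrow> 'b) \<Rightarrow> (nat \<Rightarrow> 'e \<Rightarrow> 'f) \<Rightarrow> bool" where
  "bundle_iso d E act p E' act' p' \<phi> \<longleftrightarrow>
     simplicial_map E E' \<phi> \<and>
     (\<forall>n. bij_betw (\<phi> n) (cells E n) (cells E' n)) \<and>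
     (\<forall>n. \<forall>e\<in>cells E n. p' (\<phi> n e) = p e \<and>
        (\<forall>\<beta>\<in>cells (nerve (Zmod d)) n. \<phi> n (act \<beta> e) = act' \<beta> (\<phi> n e)))"

definition twisted_action :: "nat \<Rightarrow> int list \<Rightarrow> int list \<times> 'a \<Rightarrow> int list \<times> 'a" where
  "twisted_action d \<beta> = (\<lambda>(\<alpha>, \<tau>). (map2 (mult (Zmod d)) \<beta> \<alpha>, \<tau>))"

definition J_action :: "('g, 'm) monoid_scheme \<Rightarrow> 'g \<Rightarrow> int list \<Rightarrow> 'g list \<Rightarrow> 'g list" where
  "J_action G J = map2 (\<lambda>a g. J [^]\<^bsub>G\<^esub> a \<otimes>\<^bsub>G\<^esub> g)"

definition gamma_class :: "nat \<Rightarrow> ('g, 'm) monoid_scheme \<Rightarrow> 'g \<Rightarrow> ('g set list \<Rightarrow> int) set" where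
  "gamma_class d G J =
     (THE C. C \<in> carrier (H2 d (N_bar d G J)) \<and>
        (\<exists>c\<in>C. normalized (N_bar d G J) c \<and>
           (\<exists>\<phi>. bundle_iso d
                  (twisted_product d (N_bar d G J) c) (twisted_action d) snd
                  (N_comm d G) (J_action G J) (map (J_coset G J)) \<phi>)))"


section \<open>The groups \<open>\<pi>\<^sub>1(\<int>/d, Y)\<close>\<close>

definition pi1_rels :: "nat \<Rightarrow> 'a sset \<Rightarrow> ('a word \<times> 'a word) set" where
  "pi1_rels d Y =
     {(power_word y (int d), []) | y. y \<in> cells Y 1} \<union>
     {([(face Y 2 i \<sigma>, False), (face Y 2 j \<sigma>, False)],
       [(face Y 2 j \<sigma>, False), (face Y 2 i \<sigma>, False)]) | i j \<sigma>. \<sigma> \<in> cells Y 2 \<and> i \<le> 2 \<and> j \<le> 2} \<union>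
     {([(face Y 2 2 \<sigma>, False), (face Y 2 0 \<sigma>, False)], [(face Y 2 1 \<sigma>, False)]) | \<sigma>.
        \<sigma> \<in> cells Y 2}"

definition pi1 :: "nat \<Rightarrow> 'a sset \<Rightarrow> 'a word set monoid" where
  "pi1 d Y = presented_group (cells Y 1) (pi1_rels d Y)"

definition pi1_el :: "nat \<Rightarrow> 'a sset \<Rightarrow> 'a \<Rightarrow> 'a word set" where
  "pi1_el d Y y = pres_class (cells Y 1) (pi1_rels d Y) [(y, False)]"

definition e_one :: "nat \<Rightarrow> 'a sset \<Rightarrow> ('a \<Rightarrow> int) \<Rightarrow> (int list \<times> 'a) word set" where
  "e_one d X \<gamma> =
     pi1_el d (twisted_product d X \<gamma>) ([1], degen X 0 0 (SOME v. v \<in> cells X 0))"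


section \<open>The four sets\<close>

text \<open>Homomorphisms are taken extensional, so that each one is counted once.\<close>

definition homs :: "('a, 'm) monoid_scheme \<Rightarrow> ('b, 'n) monoid_scheme \<Rightarrow> ('a \<Rightarrow> 'b) set" where
  "homs \<Gamma> G = hom \<Gamma> G \<inter> extensional (carrier \<Gamma>)"

definition Sol_X ::
    "nat \<Rightarrow> 'a sset \<Rightarrow> ('a \<Rightarrow> int) \<Rightarrow> ('g, 'm) monoid_scheme \<Rightarrow> 'g \<Rightarrow> ('a \<Rightarrow> 'g) set" where
  "Sol_X d X \<gamma> G J = Sol d (cells X 1) (cells X 2) (A_mat d X) (b_vec d \<gamma>) G J"

definition sol_group_X :: "nat \<Rightarrow> 'a sset \<Rightarrow> ('a \<Rightarrow> int) \<Rightarrow> 'a sol_gen word set monoid" where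
  "sol_group_X d X \<gamma> = sol_group d (cells X 1) (cells X 2) (A_mat d X) (b_vec d \<gamma>)"

definition sol_el_X ::
    "nat \<Rightarrow> 'a sset \<Rightarrow> ('a \<Rightarrow> int) \<Rightarrow> 'a sol_gen \<Rightarrow> 'a sol_gen word set" where
  "sol_el_X d X \<gamma> = sol_el d (cells X 1) (cells X 2) (A_mat d X) (b_vec d \<gamma>)"

definition Hom_sol ::
    "nat \<Rightarrow> 'a sset \<Rightarrow> ('a \<Rightarrow> int) \<Rightarrow> ('g, 'm) monoid_scheme \<Rightarrow> 'g
      \<Rightarrow> ('a sol_gen word set \<Rightarrow> 'g) set" where
  "Hom_sol d X \<gamma> G J = {\<theta> \<in> homs (sol_group_X d X \<gamma>) G. \<theta> (sol_el_X d X \<gamma> GenJ) = J}"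

definition Hom_pi1 ::
    "nat \<Rightarrow> 'a sset \<Rightarrow> ('a \<Rightarrow> int) \<Rightarrow> ('g, 'm) monoid_scheme \<Rightarrow> 'g
      \<Rightarrow> ((int list \<times> 'a) word set \<Rightarrow> 'g) set" where
  "Hom_pi1 d X \<gamma> G J = {\<theta> \<in> homs (pi1 d (twisted_product d X \<gamma>)) G. \<theta> (e_one d X \<gamma>) = J}"

definition Maps_bar ::
    "nat \<Rightarrow> 'a sset \<Rightarrow> ('a \<Rightarrow> int) \<Rightarrow> ('g, 'm) monoid_scheme \<Rightarrow> 'g
      \<Rightarrow> (nat \<Rightarrow> 'a \<Rightarrow> 'g set list) set" where
  "Maps_bar d X \<gamma> G J =
     {f. simplicial_map X (N_bar d G J) f \<and>
         H2_pullback d X f (gamma_class d G J) = H2_class d X \<gamma>}"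

text \<open>A simplicial map \<open>f : X \<rightarrow> N_bar\<close> with the right class does not determine the solution that
  induces it: \<open>T\<close> and \<open>x \<mapsto> J\<^bsup>c(x)\<^esup> T(x)\<close> have the same image in \<open>N_bar\<close> for every
  1-cocycle \<open>c\<close> (an automorphism of the bundle \<open>X_\<gamma>\<close>).  For instance, for \<open>X = \<Delta>[1]\<close>,
  \<open>\<gamma> = 0\<close> and \<open>G = \<int>/d\<close> there are \<open>d\<close> solutions but only one such map.  Maps therefore
  correspond to solutions up to this free action of the 1-cocycles.\<close>

definition gauge_rel ::
    "nat \<Rightarrow> 'a sset \<Rightarrow> ('a \<Rightarrow> int) \<Rightarrow> ('g, 'm) monoid_scheme \<Rightarrow> 'g
      \<Rightarrow> (('a \<Rightarrow> 'g) \<times> ('a \<Rightarrow> 'g)) set" where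
  "gauge_rel d X \<gamma> G J =
     {(T, T') \<in> Sol_X d X \<gamma> G J \<times> Sol_X d X \<gamma> G J.
        \<exists>c\<in>cocycles d X 1. \<forall>x\<in>cells X 1. T' x = J [^]\<^bsub>G\<^esub> c x \<otimes>\<^bsub>G\<^esub> T x}"

end

theory Submission
  imports Defs
begin

text \<open>Everything is compared with a concrete description of the solutions (\<open>Sol_X_iff\<close>): they are the
  labellings \<open>T\<close> of the edges of \<open>X\<close> by \<open>d\<close>-torsion elements such that the three labels of every
  triangle \<open>\<sigma>\<close> commute and \<open>T(d\<^sub>2\<sigma>) T(d\<^sub>0\<sigma>) = J\<^bsup>-\<gamma>(\<sigma>)\<^esup> T(d\<^sub>1\<sigma>)\<close>.

  Homomorphisms out of a presented group are choices of images of the generators that satisfy the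
  relations.  For the solution group these relations are the system itself.  For
  \<open>\<pi>\<^sub>1(\<int>/d, X\<^sub>\<gamma>)\<close>, the degenerate triangles on the edges of a connected \<open>X\<close> force
  \<open>\<theta>(e\<^bsub>a,x\<^esub>) = J\<^sup>a \<theta>(e\<^bsub>0,x\<^esub>)\<close> once \<open>\<theta>(e\<^sub>1) = J\<close> (\<open>pi1_value_eq\<close>), and then the relation of a
  triangle, whose \<open>0\<close>-th face is shifted by \<open>\<gamma>\<close>, is the displayed equation for
  \<open>T(x) = \<theta>(e\<^bsub>0,x\<^esub>)\<close>.

  For maps into \<open>\<bar>N = \<bar>N(\<int>/d, G)\<close>, the key is that the system can be solved on \<open>\<bar>N\<close> itself by
  representatives of cosets.  Such a universal solution \<open>S\<close>, for a cocycle \<open>c\<close> on \<open>\<bar>N\<close>, can be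
  read off from any trivialisation of the bundle as a twisted product by \<open>c\<close>, as its section in
  degree 1 (\<open>bundle_iso_solution\<close>); here \<open>[c]\<close> is the class of the bundle.  Two solutions, for cocycles \<open>\<gamma>\<close>
  and \<open>\<gamma>'\<close>, have the same image in the quotient precisely if they differ by powers of \<open>J\<close>, that is, by
  a 1-cochain whose coboundary is \<open>\<gamma> - \<gamma>'\<close> (\<open>Sol_X_twist_iff\<close>, \<open>Sol_X_same_image\<close>).  This single
  computation is used three times: it shows that the class of the bundle is well defined, that a map
  \<open>f\<close> pulls it back to \<open>[\<gamma>]\<close> precisely if some solution for \<open>\<gamma>\<close> has image \<open>f\<close> (compare it with the
  pullback \<open>S \<circ> f\<close>), and that the solutions with image \<open>f\<close> form one orbit of the 1-cocycles.

  Two points remain.  The bundle does have a trivialisation: representatives of the edges that leave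
  the initial vertex of a simplex give a lift of the simplex that is compatible with all faces except
  the \<open>0\<close>-th one, and there the failure is the twisting function (\<open>star_lift_twisted_face\<close>).  And the
  labels of the consecutive edges of a simplex of any dimension commute pairwise, although the system
  speaks of triangles only (\<open>first_label_commutes\<close>), so that a solution does define a simplicial map
  into \<open>\<bar>N\<close>.\<close>

section \<open>Homomorphisms out of a presented group\<close>

lemma words_Nil [simp]: "[] \<in> words S"
  and words_Cons [simp]: "a # w \<in> words S \<longleftrightarrow> fst a \<in> S \<and> w \<in> words S"
  and words_append [simp]: "u @ v \<in> words S \<longleftrightarrow> u \<in> words S \<and> v \<in> words S"
  by (cases a; auto simp: words_def)+

lemma power_word_in_words [simp]: "g \<in> S \<Longrightarrow> power_word g k \<in> words S"
  by (auto simp: words_def power_word_def)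

lemma pres_eq_words: "pres_eq S R u v \<Longrightarrow> u \<in> words S \<and> v \<in> words S"
  by (induction rule: pres_eq.induct) auto

lemma pres_eq_append_right:
  "pres_eq S R u v \<Longrightarrow> w \<in> words S \<Longrightarrow> pres_eq S R (u @ w) (v @ w)"
proof (induction rule: pres_eq.induct)
  case (refl w) then show ?case by (simp add: pres_eq.refl)
next
  case (sym v u) then show ?case by (metis pres_eq.sym)
next
  case (trans u v w') then show ?case by (metis pres_eq.trans)
next
  case (cancel u v g b)
  then show ?case using pres_eq.cancel [of u S "v @ w" g R b] by simp
next
  case (relation u v l r)
  then show ?case using pres_eq.relation [of u S "v @ w" l r R] by simp
qed

lemma pres_eq_append_left:
  "pres_eq S R u v \<Longrightarrow> w \<in> words S \<Longrightarrow> pres_eq S R (w @ u) (w @ v)"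
proof (induction rule: pres_eq.induct)
  case (refl w) then show ?case by (simp add: pres_eq.refl)
next
  case (sym v u) then show ?case by (metis pres_eq.sym)
next
  case (trans u v w') then show ?case by (metis pres_eq.trans)
next
  case (cancel u v g b)
  then show ?case using pres_eq.cancel [of "w @ u" S v g R b] by simp
next
  case (relation u v l r)
  then show ?case using pres_eq.relation [of "w @ u" S v l r R] by simp
qed

lemma pres_class_eq: "pres_eq S R u v \<Longrightarrow> pres_class S R u = pres_class S R v"
  unfolding pres_class_def by (rule Collect_cong) (use pres_eq.sym pres_eq.trans in metis)

lemma mult_pres_class:
  assumes "u \<in> words S" "v \<in> words S"
  shows "pres_class S R u \<otimes>\<^bsub>presented_group S R\<^esub> pres_class S R v = pres_class S R (u @ v)"
proof -
  have "pres_class S R (u' @ v') = pres_class S R (u @ v)"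
    if "pres_eq S R u u'" "pres_eq S R v v'" for u' v'
  proof -
    have "pres_eq S R (u @ v) (u' @ v)" "pres_eq S R (u' @ v) (u' @ v')"
      using that assms pres_eq_words pres_eq_append_left pres_eq_append_right by metis+
    then show ?thesis using pres_class_eq by metis
  qed
  then have "(\<Union>u'\<in>pres_class S R u. \<Union>v'\<in>pres_class S R v. pres_class S R (u' @ v'))
    = (\<Union>u'\<in>pres_class S R u. \<Union>v'\<in>pres_class S R v. pres_class S R (u @ v))"
    by (intro SUP_cong HOL.refl) (simp add: pres_class_def)
  moreover have "u \<in> pres_class S R u" "v \<in> pres_class S R v"
    using assms by (simp_all add: pres_class_def pres_eq.refl)
  ultimately show ?thesis
    by (simp add: presented_group_def) blast
qed

lemma pres_class_in_carrier [simp]: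
  "w \<in> words S \<Longrightarrow> pres_class S R w \<in> carrier (presented_group S R)"
  by (simp add: presented_group_def)

lemma carrier_presented_groupE:
  assumes "P \<in> carrier (presented_group S R)"
  obtains w where "w \<in> words S" "P = pres_class S R w"
  using assms by (auto simp: presented_group_def)

definition word_value :: "('h, 'm) monoid_scheme \<Rightarrow> ('g \<Rightarrow> 'h) \<Rightarrow> 'g word \<Rightarrow> 'h" where
  "word_value G f w =
     foldr (\<lambda>(g, neg) p. (if neg then inv\<^bsub>G\<^esub> f g else f g) \<otimes>\<^bsub>G\<^esub> p) w \<one>\<^bsub>G\<^esub>"

lemma word_value_Nil [simp]: "word_value G f [] = \<one>\<^bsub>G\<^esub>"
  and word_value_Cons [simp]:
    "word_value G f ((g, neg) # w) = (if neg then inv\<^bsub>G\<^esub> f g else f g) \<otimes>\<^bsub>G\<^esub> word_value G f w"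
  by (simp_all add: word_value_def)

context group begin

lemma word_value_closed [simp]:
  "w \<in> words S \<Longrightarrow> f \<in> S \<rightarrow> carrier G \<Longrightarrow> word_value G f w \<in> carrier G"
  by (induction w) (auto simp: Pi_iff)

lemma word_value_append:
  assumes "u \<in> words S" "v \<in> words S" "f \<in> S \<rightarrow> carrier G"
  shows "word_value G f (u @ v) = word_value G f u \<otimes> word_value G f v"
  using assms
proof (induction u)
  case (Cons a u)
  obtain g neg where a: "a = (g, neg)" by (cases a)
  have "f g \<in> carrier G" "word_value G f u \<in> carrier G" "word_value G f v \<in> carrier G"
    using Cons.prems a by auto
  then show ?case using Cons a by (auto simp: m_assoc)
qed simp

lemma word_value_power_word:
  assumes "f g \<in> carrier G"
  shows "word_value G f (power_word g k) = f g [^] k"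
proof -
  have pos: "word_value G f (replicate n (g, False)) = f g [^] n" for n :: nat
  proof (induction n)
    case (Suc n)
    then show ?case using nat_pow_Suc2 [OF assms, of n] by simp
  qed simp
  have neg: "word_value G f (replicate n (g, True)) = inv f g [^] n" for n :: nat
  proof (induction n)
    case (Suc n)
    then show ?case using nat_pow_Suc2 [OF inv_closed [OF assms], of n] by simp
  qed simp
  show ?thesis
  proof (cases "k < 0")
    case True
    then have "power_word g k = replicate (nat (- k)) (g, True)"
      by (simp add: power_word_def)
    then show ?thesis
      using True neg [of "nat (- k)"] nat_pow_inv [OF assms] by (simp only: int_pow_def2 if_True)
  next
    case False
    then have "power_word g k = replicate (nat k) (g, False)"
      by (simp add: power_word_def)
    then show ?thesis
      using False pos [of "nat k"] by (simp only: int_pow_def2 if_False)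
  qed
qed

lemma word_value_concat_power_words:
  assumes "\<And>v. v \<in> set vs \<Longrightarrow> f (h v) \<in> carrier G"
  shows "word_value G f (concat (map (\<lambda>v. power_word (h v) (k v)) vs))
    = foldr (\<lambda>v p. f (h v) [^] k v \<otimes> p) vs \<one>"
  using assms
proof (induction vs)
  case (Cons v vs)
  let ?S = "{g. f g \<in> carrier G}"
  have "concat (map (\<lambda>v. power_word (h v) (k v)) vs) \<in> words ?S"
    using Cons.prems by (induction vs) auto
  then have "word_value G f (power_word (h v) (k v) @ concat (map (\<lambda>v. power_word (h v) (k v)) vs))
    = word_value G f (power_word (h v) (k v)) \<otimes>
      word_value G f (concat (map (\<lambda>v. power_word (h v) (k v)) vs))"
    using Cons.prems by (intro word_value_append [where S = ?S]) auto
  then show ?case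
    using Cons by (simp add: word_value_power_word)
qed simp

lemma word_value_pres_eq:
  assumes "pres_eq S R u v" "f \<in> S \<rightarrow> carrier G"
    and "\<And>l r. (l, r) \<in> R \<Longrightarrow> word_value G f l = word_value G f r"
  shows "word_value G f u = word_value G f v"
  using assms(1)
proof (induction rule: pres_eq.induct)
  case (cancel u v g b)
  have "f g \<in> carrier G" using cancel assms(2) by auto
  then have "word_value G f ([(g, b), (g, \<not> b)] @ v) = word_value G f v"
    using word_value_closed [OF cancel(2) assms(2)]
    by (cases b) (auto simp: l_inv r_inv simp flip: m_assoc)
  moreover have "[(g, b), (g, \<not> b)] @ v \<in> words S" using cancel by simp
  ultimately show ?case
    using cancel word_value_append [OF _ _ assms(2)] by simp
next
  case (relation u v l r)
  then show ?case by (simp add: word_value_append [OF _ _ assms(2)] assms(3))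
qed auto

lemma hom_eq_word_value:
  assumes \<theta>: "\<theta> \<in> hom (presented_group S R) G" and w: "w \<in> words S"
  shows "\<theta> (pres_class S R w) = word_value G (\<lambda>g. \<theta> (pres_class S R [(g, False)])) w"
proof -
  have closed: "\<theta> (pres_class S R u) \<in> carrier G" if "u \<in> words S" for u
    using \<theta> that by (auto simp: hom_def)
  have mult: "\<theta> (pres_class S R (u @ v)) = \<theta> (pres_class S R u) \<otimes> \<theta> (pres_class S R v)"
    if "u \<in> words S" "v \<in> words S" for u v
    using hom_mult [OF \<theta>, of "pres_class S R u" "pres_class S R v"] that
    by (simp add: mult_pres_class)
  have one: "\<theta> (pres_class S R []) = \<one>"
    using mult [of "[]" "[]"] closed [of "[]"] by simp
  have neg: "\<theta> (pres_class S R [(g, True)]) = inv \<theta> (pres_class S R [(g, False)])"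
    if "g \<in> S" for g
  proof -
    have "pres_eq S R [(g, True), (g, False)] []"
      using pres_eq.cancel [of "[]" S "[]" g R True] that by simp
    then have "\<theta> (pres_class S R [(g, True)]) \<otimes> \<theta> (pres_class S R [(g, False)]) = \<one>"
      using mult [of "[(g, True)]" "[(g, False)]"] one that pres_class_eq by fastforce
    then show ?thesis using closed that by (intro inv_equality [symmetric]) auto
  qed
  show ?thesis
    using w
  proof (induction w)
    case (Cons a w)
    obtain g b where a: "a = (g, b)" by (cases a)
    then show ?case
      using Cons mult [of "[a]" w] neg by (cases b) auto
  qed (simp add: one)
qed

text \<open>When the relations hold, the value of a choice of images on words is constant on the classes.
  Conversely a homomorphism is such a value, since it has to send inverse letters to inverses.\<close>

lemma bij_betw_homs_presented_group:
  assumes R: "R \<subseteq> words S \<times> words S"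
  shows "bij_betw (\<lambda>\<theta>. \<lambda>g\<in>S. \<theta> (pres_class S R [(g, False)])) (homs (presented_group S R) G)
    {f \<in> S \<rightarrow>\<^sub>E carrier G. \<forall>(l, r)\<in>R. word_value G f l = word_value G f r}"
    (is "bij_betw ?\<Phi> _ ?F")
proof (rule bij_betw_imageI)
  have value_restrict: "word_value G (\<lambda>g\<in>S. f g) w = word_value G f w" if "w \<in> words S" for f w
    using that by (induction w) auto
  show "inj_on ?\<Phi> (homs (presented_group S R) G)"
  proof (rule inj_onI)
    fix \<theta> \<theta>' assume hom: "\<theta> \<in> homs (presented_group S R) G" "\<theta>' \<in> homs (presented_group S R) G"
      and eq: "?\<Phi> \<theta> = ?\<Phi> \<theta>'"
    have "\<theta> P = \<theta>' P" if P: "P \<in> carrier (presented_group S R)" for P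
    proof -
      obtain w where "w \<in> words S" "P = pres_class S R w"
        using carrier_presented_groupE [OF P] .
      then show ?thesis
        using hom eq by (simp add: homs_def hom_eq_word_value) (metis value_restrict)
    qed
    then show "\<theta> = \<theta>'"
      using hom by (auto simp: homs_def intro: extensionalityI)
  qed
  show "?\<Phi> ` homs (presented_group S R) G = ?F"
  proof (intro equalityI subsetI)
    fix f assume "f \<in> ?\<Phi> ` homs (presented_group S R) G"
    then obtain \<theta> where \<theta>: "\<theta> \<in> hom (presented_group S R) G" and f: "f = ?\<Phi> \<theta>"
      by (auto simp: homs_def)
    have "word_value G f l = word_value G f r" if "(l, r) \<in> R" for l r
    proof -
      have lr: "l \<in> words S" "r \<in> words S" using R that by auto
      then have "pres_eq S R l r"
        using pres_eq.relation [of "[]" S "[]" l r R] that by simp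
      then have "\<theta> (pres_class S R l) = \<theta> (pres_class S R r)" using pres_class_eq by metis
      then show ?thesis
        using lr \<theta> by (simp add: f value_restrict hom_eq_word_value)
    qed
    moreover have "f \<in> S \<rightarrow>\<^sub>E carrier G"
      using \<theta> by (auto simp: f hom_def)
    ultimately show "f \<in> ?F" by auto
  next
    fix f assume "f \<in> ?F"
    then have f: "f \<in> S \<rightarrow> carrier G" and fE: "f \<in> extensional S"
      and rel: "\<And>l r. (l, r) \<in> R \<Longrightarrow> word_value G f l = word_value G f r"
      by (auto simp: PiE_def)
    define \<theta> where "\<theta> = (\<lambda>P\<in>carrier (presented_group S R).
      word_value G f (SOME w. w \<in> words S \<and> P = pres_class S R w))"
    have \<theta>: "\<theta> (pres_class S R w) = word_value G f w" if "w \<in> words S" for w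
    proof -
      define v where "v = (SOME v. v \<in> words S \<and> pres_class S R w = pres_class S R v)"
      have v: "v \<in> words S" "pres_class S R w = pres_class S R v"
        using someI [of "\<lambda>v. v \<in> words S \<and> pres_class S R w = pres_class S R v" w] that
        by (auto simp: v_def)
      then have "pres_eq S R w v"
        using pres_eq.refl by (fastforce simp: pres_class_def)
      then have "word_value G f w = word_value G f v"
        using word_value_pres_eq f rel by metis
      then show ?thesis using that by (simp add: \<theta>_def v_def)
    qed
    have "\<theta> \<in> hom (presented_group S R) G"
    proof (rule homI)
      fix P Q assume "P \<in> carrier (presented_group S R)" "Q \<in> carrier (presented_group S R)"
      then obtain u v where "u \<in> words S" "P = pres_class S R u" "v \<in> words S" "Q = pres_class S R v"
        by (metis carrier_presented_groupE)
      then show "\<theta> (P \<otimes>\<^bsub>presented_group S R\<^esub> Q) = \<theta> P \<otimes> \<theta> Q"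
        using word_value_append f by (simp add: mult_pres_class \<theta>)
    qed (use \<theta> f in \<open>auto elim!: carrier_presented_groupE\<close>)
    then have "\<theta> \<in> homs (presented_group S R) G"
      by (simp add: homs_def \<theta>_def)
    moreover have "?\<Phi> \<theta> = f"
    proof (rule extensionalityI [OF _ fE])
      fix g assume "g \<in> S"
      then show "?\<Phi> \<theta> g = f g" using f by (simp add: \<theta> Pi_iff)
    qed simp
    ultimately show "f \<in> ?\<Phi> ` homs (presented_group S R) G" by blast
  qed
qed

end

section \<open>Linear systems and their solution groups\<close>

locale central_cyclic = group G for G (structure) +
  fixes d :: nat and J :: 'a
  assumes d_gt_1: "d > 1"
    and J_closed [simp]: "J \<in> carrier G"
    and J_central: "g \<in> carrier G \<Longrightarrow> J \<otimes> g = g \<otimes> J"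
    and ord_J: "ord J = d"
begin

lemma J_pow_eq_iff: "J [^] (k :: int) = J [^] (l :: int) \<longleftrightarrow> k mod int d = l mod int d"
  by (metis J_closed int_pow_eq mod_eq_dvd_iff ord_J)

lemma J_pow_mod [simp]: "J [^] (k mod int d) = J [^] (k :: int)"
  by (simp add: J_pow_eq_iff)

lemma J_pow_d: "J [^] d = \<one>"
  using ord_J J_closed pow_ord_eq_1 by blast

lemma J_pow_commute:
  assumes "g \<in> carrier G"
  shows "g \<otimes> J [^] (k :: int) = J [^] k \<otimes> g"
proof -
  have "J [^] k = J [^] (k mod int d)" by simp
  also have "\<dots> = J [^] nat (k mod int d)"
    using d_gt_1 by (simp flip: int_pow_int)
  finally show ?thesis
    using group_commutes_pow [OF J_central [OF assms] J_closed assms, of "nat (k mod int d)"] by simp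
qed

lemma J_pow_left_commute:
  assumes "g \<in> carrier G" "h \<in> carrier G"
  shows "g \<otimes> (J [^] (k :: int) \<otimes> h) = J [^] k \<otimes> (g \<otimes> h)"
  using assms by (metis J_closed J_pow_commute int_pow_closed m_assoc)

lemma J_pow_add: "g \<in> carrier G \<Longrightarrow>
    J [^] (k :: int) \<otimes> (J [^] (l :: int) \<otimes> g) = J [^] (k + l) \<otimes> g"
  by (simp add: int_pow_mult flip: m_assoc)

lemma J_pow_mult_commute_iff:
  assumes "g \<in> carrier G" "h \<in> carrier G"
  shows "(J [^] (k :: int) \<otimes> g) \<otimes> h = h \<otimes> (J [^] k \<otimes> g) \<longleftrightarrow> g \<otimes> h = h \<otimes> g"
  using assms by (simp add: J_pow_left_commute m_assoc)

lemma J_pow_mult_pow_d: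
  assumes "g \<in> carrier G"
  shows "(J [^] (k :: int) \<otimes> g) [^] d = g [^] d"
proof -
  have "(J [^] k \<otimes> g) [^] d = (J [^] k) [^] d \<otimes> g [^] d"
    using pow_mult_distrib [of "J [^] k" g d] assms by (simp add: J_pow_commute)
  also have "(J [^] k) [^] d = J [^] (k * int d)"
    by (metis J_closed int_pow_int int_pow_pow)
  also have "\<dots> = \<one>"
    using J_pow_eq_iff [of "k * int d" 0] by simp
  finally show ?thesis using assms by simp
qed

end

lemma bij_betw_Collect:
  assumes "bij_betw f A B" "\<And>a. a \<in> A \<Longrightarrow> P a \<longleftrightarrow> Q (f a)"
  shows "bij_betw f {a \<in> A. P a} {b \<in> B. Q b}"
  using assms by (auto simp: bij_betw_def inj_on_def)

context central_cyclic begin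

text \<open>The word of a row evaluates to the ordered product over the support of the row, and the remaining
  relations are the torsion and commutation conditions; those that involve \<open>J\<close> hold in the
  target because \<open>J\<close> is central of order \<open>d\<close> there.\<close>

lemma bij_betw_sol_group_homs:
  "bij_betw (\<lambda>\<theta>. \<lambda>v\<in>V. \<theta> (sol_el d V I A b (Gen v)))
     {\<theta> \<in> homs (sol_group d V I A b) G. \<theta> (sol_el d V I A b GenJ) = J} (Sol d V I A b G J)"
proof -
  let ?S = "sol_gens V" and ?R = "sol_rels d V I A b"
  let ?\<Phi> = "\<lambda>\<theta>. \<lambda>g\<in>?S. \<theta> (pres_class ?S ?R [(g, False)])"
  let ?F = "{f \<in> ?S \<rightarrow>\<^sub>E carrier G. \<forall>(l, r)\<in>?R. word_value G f l = word_value G f r}"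
  have concat_words: "concat (map (\<lambda>v. power_word (Gen v) (A i v)) vs) \<in> words ?S"
    if "set vs = row_support V A i" for i vs
  proof -
    have "set vs \<subseteq> V" using that by (auto simp: row_support_def)
    then show ?thesis by (induction vs) (auto simp: sol_gens_def)
  qed
  have "?R \<subseteq> words ?S \<times> words ?S"
    unfolding sol_rels_def using concat_words
    by (auto simp: sol_gens_def row_support_def)
  from bij_betw_Collect [OF bij_betw_homs_presented_group [OF this],
      where P = "\<lambda>\<theta>. \<theta> (sol_el d V I A b GenJ) = J" and Q = "\<lambda>f. f GenJ = J"]
  have 1: "bij_betw ?\<Phi> {\<theta> \<in> homs (sol_group d V I A b) G. \<theta> (sol_el d V I A b GenJ) = J}
      {f \<in> ?F. f GenJ = J}"
    by (simp add: sol_group_def sol_el_def sol_gens_def)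
  have F_iff: "f \<in> ?F \<longleftrightarrow> (\<lambda>v\<in>V. f (Gen v)) \<in> Sol d V I A b G J"
    if f: "f \<in> ?S \<rightarrow>\<^sub>E carrier G" and J: "f GenJ = J" for f
  proof -
    have closed: "f (Gen v) \<in> carrier G" if "v \<in> V" for v
      using f that by (auto simp: sol_gens_def)
    have row: "word_value G f (concat (map (\<lambda>v. power_word (Gen v) (A i v)) vs))
        = foldr (\<lambda>v p. (\<lambda>v\<in>V. f (Gen v)) v [^] A i v \<otimes> p) vs \<one>"
      if "set vs = row_support V A i" for i vs
    proof -
      have "set vs \<subseteq> V" using that by (auto simp: row_support_def)
      then have "foldr (\<lambda>v p. (\<lambda>v\<in>V. f (Gen v)) v [^] A i v \<otimes> p) vs \<one>
          = foldr (\<lambda>v p. f (Gen v) [^] A i v \<otimes> p) vs \<one>"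
        by (intro foldr_cong) auto
      then show ?thesis
        using closed \<open>set vs \<subseteq> V\<close> by (subst word_value_concat_power_words) auto
    qed
    have supp: "v \<in> V" if "v \<in> row_support V A i" for v i
      using that by (simp add: row_support_def)
    have "f \<in> ?F \<longleftrightarrow>
        (\<forall>v\<in>V. f (Gen v) [^] d = \<one>) \<and>
        (\<forall>i\<in>I. \<forall>v\<in>row_support V A i. \<forall>w\<in>row_support V A i.
           f (Gen v) \<otimes> f (Gen w) = f (Gen w) \<otimes> f (Gen v)) \<and>
        (\<forall>i\<in>I. \<forall>vs. distinct vs \<and> set vs = row_support V A i \<longrightarrow>
           word_value G f (concat (map (\<lambda>v. power_word (Gen v) (A i v)) vs)) = J [^] b i)"
      (is "_ \<longleftrightarrow> ?pow \<and> ?comm \<and> ?row")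
    proof -
      have "f \<in> ?F \<longleftrightarrow> (\<forall>(l, r)\<in>?R. word_value G f l = word_value G f r)"
        using f by simp
      also have "\<dots> \<longleftrightarrow>
        (((\<forall>g\<in>?S. word_value G f (power_word g (int d)) = \<one>) \<and>
        (\<forall>v\<in>V. J \<otimes> f (Gen v) = f (Gen v) \<otimes> J)) \<and>
        ?comm) \<and>
        (\<forall>i\<in>I. \<forall>vs. distinct vs \<and> set vs = row_support V A i \<longrightarrow>
           word_value G f (concat (map (\<lambda>v. power_word (Gen v) (A i v)) vs))
             = word_value G f (power_word GenJ (b i)))"
        unfolding sol_rels_def ball_Un
        by (intro arg_cong2 [where f = "(\<and>)"]) (fastforce simp: J closed supp)+
      also have "\<dots> \<longleftrightarrow> ?pow \<and> ?comm \<and> ?row"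
        using J closed J_central
        by (simp add: word_value_power_word sol_gens_def int_pow_int J_pow_d)
      finally show ?thesis .
    qed
    also have "\<dots> \<longleftrightarrow> (\<lambda>v\<in>V. f (Gen v)) \<in> Sol d V I A b G J"
      unfolding Sol_def using closed supp row by (auto simp: cong: conj_cong)
    finally show ?thesis .
  qed
  have 2: "bij_betw (\<lambda>f. \<lambda>v\<in>V. f (Gen v)) {f \<in> ?F. f GenJ = J} (Sol d V I A b G J)"
  proof (rule bij_betw_byWitness)
    let ?extend = "\<lambda>T. \<lambda>g\<in>?S. case g of GenJ \<Rightarrow> J | Gen v \<Rightarrow> T v"
    show "\<forall>f\<in>{f \<in> ?F. f GenJ = J}. ?extend (\<lambda>v\<in>V. f (Gen v)) = f"
      by (auto simp: sol_gens_def fun_eq_iff PiE_def extensional_def split: sol_gen.split)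
    show restrict_extend: "\<forall>T\<in>Sol d V I A b G J. (\<lambda>v\<in>V. ?extend T (Gen v)) = T"
      by (auto simp: Sol_def sol_gens_def fun_eq_iff PiE_def extensional_def)
    show "(\<lambda>f. \<lambda>v\<in>V. f (Gen v)) ` {f \<in> ?F. f GenJ = J} \<subseteq> Sol d V I A b G J"
      using F_iff by auto
    show "?extend ` Sol d V I A b G J \<subseteq> {f \<in> ?F. f GenJ = J}"
    proof (rule image_subsetI)
      fix T assume T: "T \<in> Sol d V I A b G J"
      then have "?extend T \<in> ?S \<rightarrow>\<^sub>E carrier G" "?extend T GenJ = J"
        by (auto simp: Sol_def sol_gens_def)
      then show "?extend T \<in> {f \<in> ?F. f GenJ = J}"
        using F_iff [of "?extend T"] T restrict_extend by simp
    qed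
  qed
  show ?thesis
    using bij_betw_trans [OF 1 2]
    by (rule bij_betw_cong [THEN iffD1, rotated]) (auto simp: fun_eq_iff sol_el_def sol_gens_def)
qed

end

lemma distinct_set_eq_doubleton_iff:
  assumes "a \<noteq> b"
  shows "distinct vs \<and> set vs = {a, b} \<longleftrightarrow> vs = [a, b] \<or> vs = [b, a]"
proof
  assume vs: "distinct vs \<and> set vs = {a, b}"
  then have "length vs = 2" using assms distinct_card [of vs] by simp
  then obtain p q where "vs = [p, q]" by (auto simp: numeral_2_eq_2 length_Suc_conv)
  then show "vs = [a, b] \<or> vs = [b, a]" using vs assms by (auto simp: doubleton_eq_iff)
qed (use assms in auto)

lemma distinct_set_eq_singleton_iff: "distinct vs \<and> set vs = {a} \<longleftrightarrow> vs = [a]"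
proof
  assume vs: "distinct vs \<and> set vs = {a}"
  then have "length vs = 1" using distinct_card [of vs] by simp
  then obtain b where "vs = [b]" by (auto simp: length_Suc_conv)
  then show "vs = [a]" using vs by simp
qed auto

lemma distinct_set_eq_tripleton_iff:
  assumes "a \<noteq> b" "a \<noteq> c" "b \<noteq> c"
  shows "distinct vs \<and> set vs = {a, b, c} \<longleftrightarrow>
    vs \<in> {[a, b, c], [a, c, b], [b, a, c], [b, c, a], [c, a, b], [c, b, a]}"
proof
  assume vs: "distinct vs \<and> set vs = {a, b, c}"
  then have "length vs = 3" using assms distinct_card [of vs] by simp
  then obtain p q r where pqr: "vs = [p, q, r]" by (auto simp: numeral_3_eq_3 length_Suc_conv)
  then have "p \<in> {a, b, c}" "q \<in> {a, b, c}" "r \<in> {a, b, c}" "p \<noteq> q" "p \<noteq> r" "q \<noteq> r"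
    using vs by auto
  then show "vs \<in> {[a, b, c], [a, c, b], [b, a, c], [b, c, a], [c, a, b], [c, b, a]}"
    unfolding pqr by (elim insertE emptyE) simp_all
qed (use assms in auto)

context central_cyclic begin

lemma int_pow_mod_d:
  assumes "g \<in> carrier G" "g [^] d = \<one>"
  shows "g [^] (k mod int d) = g [^] (k :: int)"
proof -
  have "int (ord g) dvd int d" using assms by (simp add: pow_eq_id)
  also have "int d dvd k - k mod int d" by (simp add: minus_mod_eq_mult_div)
  finally show ?thesis using assms(1) by (simp add: int_pow_eq)
qed

lemma mult_commute_inv:
  assumes "x \<otimes> y = y \<otimes> x" "x \<in> carrier G" "y \<in> carrier G"
  shows "inv x \<otimes> y = y \<otimes> inv x"
  using assms by (metis inv_closed inv_solve_left inv_solve_right m_assoc m_closed)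

lemma left_commute_if_commute:
  assumes "x \<otimes> y = y \<otimes> x" "x \<in> carrier G" "y \<in> carrier G" "z \<in> carrier G"
  shows "x \<otimes> (y \<otimes> z) = y \<otimes> (x \<otimes> z)"
  using assms by (metis m_assoc)

text \<open>If two faces coincide, then their contributions to the row may cancel or merge, so that the row
  no longer mentions them all.  In each such case the row forces one of the values to be central,
  so the three values still commute.\<close>

lemma triangle_row_iff:
  assumes T: "\<forall>x\<in>{x0, x1, x2}. T x \<in> carrier G \<and> T x [^] d = \<one>"
    and A: "\<And>x. A x = ((if x = x0 then 1 else 0) - (if x = x1 then 1 else 0) +
        (if x = x2 then 1 else 0)) mod int d"
    and supp: "supp = {x \<in> {x0, x1, x2}. A x \<noteq> 0}"
  shows "(\<forall>v\<in>supp. \<forall>w\<in>supp. T v \<otimes> T w = T w \<otimes> T v) \<and>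
      (\<forall>vs. distinct vs \<and> set vs = supp \<longrightarrow> foldr (\<lambda>v p. T v [^] A v \<otimes> p) vs \<one> = J [^] (k :: int))
    \<longleftrightarrow> (\<forall>v\<in>{x0, x1, x2}. \<forall>w\<in>{x0, x1, x2}. T v \<otimes> T w = T w \<otimes> T v) \<and>
      T x2 \<otimes> T x0 = J [^] k \<otimes> T x1"
proof -
  have closed [simp]: "T x0 \<in> carrier G" "T x1 \<in> carrier G" "T x2 \<in> carrier G"
    using T by auto
  have pow [simp]: "T x0 [^] (l mod int d) = T x0 [^] l" "T x1 [^] (l mod int d) = T x1 [^] l"
      "T x2 [^] (l mod int d) = T x2 [^] l" for l :: int
    using T by (auto simp: int_pow_mod_d)
  have neg: "(- 1) mod int d \<noteq> 0" and one: "1 mod int d = 1"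
    using d_gt_1 by (auto simp: zmod_minus1)
  have pow_m1 [simp]: "T x1 [^] (- 1 :: int) = inv T x1"
    by (simp add: int_pow_neg)
  consider (distinct) "x0 \<noteq> x1" "x0 \<noteq> x2" "x1 \<noteq> x2" | (eq01) "x0 = x1" "x2 \<noteq> x1"
    | (eq12) "x1 = x2" "x0 \<noteq> x1" | (eq02) "x0 = x2" "x0 \<noteq> x1" | (all_eq) "x0 = x1" "x2 = x1"
    by metis
  then show ?thesis
  proof cases
    case distinct
    then have supp: "supp = {x0, x1, x2}" and Ax: "A x0 = 1" "A x1 = (- 1) mod int d" "A x2 = 1"
      using neg one by (auto simp: supp A)
    let ?comm = "\<forall>v\<in>{x0, x1, x2}. \<forall>w\<in>{x0, x1, x2}. T v \<otimes> T w = T w \<otimes> T v"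
    have "foldr (\<lambda>v p. T v [^] A v \<otimes> p) vs \<one> = T x2 \<otimes> T x0 \<otimes> inv T x1"
      if ?comm and vs: "distinct vs \<and> set vs = {x0, x1, x2}" for vs
    proof -
      have comm: "T x0 \<otimes> T x2 = T x2 \<otimes> T x0" "inv T x1 \<otimes> T x0 = T x0 \<otimes> inv T x1"
        "inv T x1 \<otimes> T x2 = T x2 \<otimes> inv T x1"
        using \<open>?comm\<close> by (blast intro: mult_commute_inv closed)+
      have left_comm: "T x0 \<otimes> (T x2 \<otimes> z) = T x2 \<otimes> (T x0 \<otimes> z)"
        "inv T x1 \<otimes> (T x0 \<otimes> z) = T x0 \<otimes> (inv T x1 \<otimes> z)"
        "inv T x1 \<otimes> (T x2 \<otimes> z) = T x2 \<otimes> (inv T x1 \<otimes> z)" if "z \<in> carrier G" for z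
        by (intro left_commute_if_commute comm closed inv_closed that)+
      have "vs \<in> {[x0, x1, x2], [x0, x2, x1], [x1, x0, x2], [x1, x2, x0], [x2, x0, x1], [x2, x1, x0]}"
        using vs distinct_set_eq_tripleton_iff distinct by metis
      then show ?thesis
        by (elim insertE emptyE) (simp_all add: Ax comm left_comm m_assoc)
    qed
    moreover have "T x2 \<otimes> T x0 \<otimes> inv T x1 = J [^] k \<longleftrightarrow> T x2 \<otimes> T x0 = J [^] k \<otimes> T x1"
      by (intro inv_solve_right') auto
    moreover have "\<exists>vs. distinct vs \<and> set vs = {x0, x1, x2}"
      using finite_distinct_list [of "{x0, x1, x2}"] by blast
    ultimately have "(\<forall>vs. distinct vs \<and> set vs = {x0, x1, x2} \<longrightarrow>
          foldr (\<lambda>v p. T v [^] A v \<otimes> p) vs \<one> = J [^] k) \<longleftrightarrow> T x2 \<otimes> T x0 = J [^] k \<otimes> T x1"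
      if ?comm
      using that by (smt (verit, best))
    then show ?thesis unfolding supp by blast
  next
    case eq01
    then have supp: "supp = {x2}" and Ax: "A x2 = 1"
      using neg one by (auto simp: supp A)
    have "T x2 \<otimes> T x1 = J [^] k \<otimes> T x1 \<longleftrightarrow> T x2 = J [^] k" by simp
    then show ?thesis
      unfolding supp distinct_set_eq_singleton_iff using eq01 Ax
      by (auto simp: J_pow_commute)
  next
    case eq12
    then have supp: "supp = {x0}" and Ax: "A x0 = 1"
      using neg one by (auto simp: supp A)
    have "T x0 \<otimes> T x2 = J [^] k \<otimes> T x2 \<longleftrightarrow> T x0 = J [^] k" by simp
    then show ?thesis
      unfolding supp distinct_set_eq_singleton_iff using eq12 Ax
      by (auto simp: J_pow_commute)
  next
    case all_eq
    then have supp: "supp = {x0}" and Ax: "A x0 = 1"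
      using neg one by (auto simp: supp A)
    show ?thesis
      unfolding supp distinct_set_eq_singleton_iff using all_eq Ax by auto
  next
    case eq02
    then have Ax: "A x0 = 2 mod int d" "A x1 = (- 1) mod int d"
      by (auto simp: A)
    have sq: "T x0 [^] (2 :: int) = T x0 \<otimes> T x0"
      using int_pow_mult [of "T x0" 1 1] by simp
    show ?thesis
    proof (cases "d = 2")
      case True
      then have supp: "supp = {x1}"
        using neg eq02 by (auto simp: supp A)
      (* The coefficient 1 + 1 of the coinciding faces vanishes, and their label squares to 1. *)
      have "T x0 \<otimes> T x0 = \<one>"
        using T True sq int_pow_int [where G = G and x = "T x0" and n = 2] by simp
      then have "T x0 \<otimes> T x0 = J [^] k \<otimes> T x1 \<longleftrightarrow> inv T x1 = J [^] k"
        using inv_solve_right' [of "J [^] k" \<one> "T x1"] by simp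
      moreover have "T x0 \<otimes> T x1 = T x1 \<otimes> T x0" if "inv T x1 = J [^] k"
      proof -
        have "T x1 = J [^] (- k)"
          using that by (metis J_closed closed(2) int_pow_neg inv_inv)
        then show ?thesis by (simp add: J_pow_commute)
      qed
      moreover have "(\<forall>v\<in>{x0, x1, x2}. \<forall>w\<in>{x0, x1, x2}. T v \<otimes> T w = T w \<otimes> T v)
          \<longleftrightarrow> T x0 \<otimes> T x1 = T x1 \<otimes> T x0"
        using eq02(1) by (metis insert_iff empty_iff)
      moreover have "(\<forall>v\<in>supp. \<forall>w\<in>supp. T v \<otimes> T w = T w \<otimes> T v) \<and>
          (\<forall>vs. distinct vs \<and> set vs = supp \<longrightarrow> foldr (\<lambda>v p. T v [^] A v \<otimes> p) vs \<one> = J [^] k)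
        \<longleftrightarrow> inv T x1 = J [^] k"
        unfolding supp distinct_set_eq_singleton_iff by (simp add: Ax)
      ultimately show ?thesis
        unfolding eq02(1) [symmetric] by argo
    next
      case False
      then have "2 mod int d = 2" using d_gt_1 by simp
      then have supp: "supp = {x0, x1}"
        using neg eq02 by (auto simp: supp A)
      have "T x0 \<otimes> T x0 \<otimes> inv T x1 = J [^] k \<longleftrightarrow> T x0 \<otimes> T x0 = J [^] k \<otimes> T x1"
        by (intro inv_solve_right') auto
      moreover have "inv T x1 \<otimes> (T x0 \<otimes> T x0) = T x0 \<otimes> T x0 \<otimes> inv T x1"
        if "T x0 \<otimes> T x1 = T x1 \<otimes> T x0"
      proof (rule mult_commute_inv)
        show "T x1 \<otimes> (T x0 \<otimes> T x0) = T x0 \<otimes> T x0 \<otimes> T x1"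
          using that by (metis closed m_assoc)
      qed auto
      moreover have "(\<forall>v\<in>{x0, x1, x2}. \<forall>w\<in>{x0, x1, x2}. T v \<otimes> T w = T w \<otimes> T v)
          \<longleftrightarrow> T x0 \<otimes> T x1 = T x1 \<otimes> T x0"
        "(\<forall>v\<in>supp. \<forall>w\<in>supp. T v \<otimes> T w = T w \<otimes> T v) \<longleftrightarrow> T x0 \<otimes> T x1 = T x1 \<otimes> T x0"
        unfolding supp using eq02(1) by (metis insert_iff empty_iff)+
      moreover have "(\<forall>vs. distinct vs \<and> set vs = supp \<longrightarrow> foldr (\<lambda>v p. T v [^] A v \<otimes> p) vs \<one> = J [^] k)
        \<longleftrightarrow> T x0 \<otimes> T x0 \<otimes> inv T x1 = J [^] k \<and> inv T x1 \<otimes> (T x0 \<otimes> T x0) = J [^] k"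
        unfolding supp distinct_set_eq_doubleton_iff [OF eq02(2)]
        by (simp add: imp_disjL all_conj_distrib Ax sq m_assoc)
      ultimately show ?thesis
        unfolding eq02(1) [symmetric] by argo
    qed
  qed
qed

text \<open>The form of the system that is used from here on: ordered products over supports are gone, and
  all three faces of a triangle appear, whether or not they coincide.\<close>

lemma Sol_X_iff:
  assumes face: "\<And>\<sigma> i. \<sigma> \<in> cells X 2 \<Longrightarrow> i \<le> 2 \<Longrightarrow> face X 2 i \<sigma> \<in> cells X 1"
  shows "T \<in> Sol_X d X \<gamma> G J \<longleftrightarrow>
    T \<in> cells X 1 \<rightarrow>\<^sub>E carrier G \<and> (\<forall>x\<in>cells X 1. T x [^] d = \<one>) \<and>
    (\<forall>\<sigma>\<in>cells X 2.
      (\<forall>i\<le>2. \<forall>j\<le>2. T (face X 2 i \<sigma>) \<otimes> T (face X 2 j \<sigma>) = T (face X 2 j \<sigma>) \<otimes> T (face X 2 i \<sigma>)) \<and>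
      T (face X 2 2 \<sigma>) \<otimes> T (face X 2 0 \<sigma>) = J [^] (- \<gamma> \<sigma>) \<otimes> T (face X 2 1 \<sigma>))"
proof -
  have A: "A_mat d X \<sigma> x = ((if x = face X 2 0 \<sigma> then 1 else 0) - (if x = face X 2 1 \<sigma> then 1 else 0) +
        (if x = face X 2 2 \<sigma> then 1 else 0)) mod int d" for \<sigma> x
  proof -
    have "(\<Sum>i | i \<le> 2 \<and> face X 2 i \<sigma> = x. (- 1) ^ i :: int)
      = (\<Sum>i\<le>2. if face X 2 i \<sigma> = x then (- 1) ^ i else 0)"
      by (subst sum.inter_filter [symmetric]) (auto intro: sum.cong)
    then show ?thesis
      unfolding A_mat_def by (simp add: numeral_2_eq_2 eq_commute [of x])
  qed
  have le2: "(\<forall>i\<le>2. P i) \<longleftrightarrow> P 0 \<and> P 1 \<and> P 2" for P :: "nat \<Rightarrow> bool"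
    by (auto simp: numeral_2_eq_2 le_Suc_eq)
  have row: "(\<forall>v\<in>row_support (cells X 1) (A_mat d X) \<sigma>. \<forall>w\<in>row_support (cells X 1) (A_mat d X) \<sigma>.
         T v \<otimes> T w = T w \<otimes> T v) \<and>
      (\<forall>vs. distinct vs \<and> set vs = row_support (cells X 1) (A_mat d X) \<sigma> \<longrightarrow>
         foldr (\<lambda>v p. T v [^] A_mat d X \<sigma> v \<otimes> p) vs \<one> = J [^] b_vec d \<gamma> \<sigma>) \<longleftrightarrow>
      (\<forall>i\<le>2. \<forall>j\<le>2. T (face X 2 i \<sigma>) \<otimes> T (face X 2 j \<sigma>) = T (face X 2 j \<sigma>) \<otimes> T (face X 2 i \<sigma>)) \<and>
      T (face X 2 2 \<sigma>) \<otimes> T (face X 2 0 \<sigma>) = J [^] (- \<gamma> \<sigma>) \<otimes> T (face X 2 1 \<sigma>)"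
    if \<sigma>: "\<sigma> \<in> cells X 2" and T: "T \<in> cells X 1 \<rightarrow> carrier G" "\<forall>x\<in>cells X 1. T x [^] d = \<one>" for \<sigma>
  proof -
    have "face X 2 0 \<sigma> \<in> cells X 1" "face X 2 1 \<sigma> \<in> cells X 1" "face X 2 2 \<sigma> \<in> cells X 1"
      using face \<sigma> by auto
    then have "\<forall>x\<in>{face X 2 0 \<sigma>, face X 2 1 \<sigma>, face X 2 2 \<sigma>}. T x \<in> carrier G \<and> T x [^] d = \<one>"
      and "row_support (cells X 1) (A_mat d X) \<sigma> =
        {x \<in> {face X 2 0 \<sigma>, face X 2 1 \<sigma>, face X 2 2 \<sigma>}. A_mat d X \<sigma> x \<noteq> 0}"
      using T by (auto simp: row_support_def A)
    from triangle_row_iff [where T = T and k = "- \<gamma> \<sigma>", OF this(1) A this(2)] show ?thesis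
      unfolding b_vec_def J_pow_mod le2 ball_simps simp_thms by argo
  qed
  show ?thesis
    unfolding Sol_X_def Sol_def mem_Collect_eq ball_conj_distrib [symmetric]
    by (intro conj_cong ball_cong refl row) auto
qed

end

section \<open>Faces and degeneracies in low degrees, front faces\<close>

context simplicial_set begin

lemma face_cells:
  shows "x \<in> cells X 1 \<Longrightarrow> i \<le> 1 \<Longrightarrow> face X 1 i x \<in> cells X 0"
    and "\<sigma> \<in> cells X 2 \<Longrightarrow> j \<le> 2 \<Longrightarrow> face X 2 j \<sigma> \<in> cells X 1"
  using face_closed [of x 0 i] face_closed [of \<sigma> 1 j] by (auto simp: numeral_2_eq_2)

lemma degen_cells:
  shows "v \<in> cells X 0 \<Longrightarrow> degen X 0 0 v \<in> cells X 1"
    and "x \<in> cells X 1 \<Longrightarrow> j \<le> 1 \<Longrightarrow> degen X 1 j x \<in> cells X 2"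
  using degen_closed [of v 0 0] degen_closed [of x 1 j] by (auto simp: numeral_2_eq_2)

lemma face_degen_vertex:
  assumes "v \<in> cells X 0"
  shows "face X 1 0 (degen X 0 0 v) = v" "face X 1 1 (degen X 0 0 v) = v"
  using face_degen_id [OF assms, of 0] by auto

lemma face_degen_edge:
  assumes "x \<in> cells X 1"
  shows "face X 2 0 (degen X 1 0 x) = x" "face X 2 1 (degen X 1 0 x) = x"
    "face X 2 2 (degen X 1 0 x) = degen X 0 0 (face X 1 1 x)"
    "face X 2 0 (degen X 1 1 x) = degen X 0 0 (face X 1 0 x)"
    "face X 2 1 (degen X 1 1 x) = x" "face X 2 2 (degen X 1 1 x) = x"
  using face_degen_id [OF assms, of 0 0] face_degen_id [OF assms, of 0 1]
    face_degen_id [OF assms, of 1 1] face_degen_id [OF assms, of 1 2]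
    face_degen_greater [OF assms, of 0 2] face_degen_less [OF assms, of 0 1]
  by (auto simp: numeral_2_eq_2)

lemma connected_vertex_property:
  assumes "sset_connected X" "v \<in> cells X 0" "w \<in> cells X 0" "P v"
    and edge: "\<And>x. x \<in> cells X 1 \<Longrightarrow> P (face X 1 1 x) \<longleftrightarrow> P (face X 1 0 x)"
  shows "P w"
proof -
  have "(v, w) \<in> (edge_rel X \<union> (edge_rel X)\<inverse>)\<^sup>*"
    using assms by (simp add: sset_connected_def)
  then show ?thesis
    using \<open>P v\<close> edge by (induction rule: rtrancl_induct) (auto simp: edge_rel_def)
qed

end

text \<open>Deleting the last vertex \<open>k\<close> times, from dimension \<open>m + k\<close>, leaves the face on the vertices
  \<open>0, \<dots>, m\<close>.\<close>

primrec front :: "'a sset \<Rightarrow> nat \<Rightarrow> nat \<Rightarrow> 'a \<Rightarrow> 'a" where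
  "front X m 0 x = x"
| "front X m (Suc k) x = front X m k (face X (Suc (m + k)) (Suc (m + k)) x)"

context simplicial_set begin

lemma face_face':
  "x \<in> cells X (Suc (Suc n)) \<Longrightarrow> i < j \<Longrightarrow> j \<le> Suc (Suc n) \<Longrightarrow>
    face X (Suc n) i (face X (Suc (Suc n)) j x) = face X (Suc n) (j - 1) (face X (Suc (Suc n)) i x)"
  using face_face [of x n i j] by simp

lemma front_closed: "x \<in> cells X (m + k) \<Longrightarrow> front X m k x \<in> cells X m"
  by (induction k arbitrary: x) (auto simp: face_closed)

lemma front_face_outside:
  "x \<in> cells X (Suc (m + k)) \<Longrightarrow> m < i \<Longrightarrow> i \<le> Suc (m + k) \<Longrightarrow>
    front X m k (face X (Suc (m + k)) i x) = front X m (Suc k) x"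
proof (induction k arbitrary: x)
  case 0
  then have "i = Suc m" by simp
  then show ?case by simp
next
  case (Suc k)
  show ?case
  proof (cases "i = Suc (m + Suc k)")
    case False
    let ?y = "face X (Suc (Suc (m + k))) (Suc (Suc (m + k))) x"
    have "?y \<in> cells X (Suc (m + k))" using Suc.prems(1) by (simp add: face_closed)
    moreover have "face X (Suc (m + k)) (Suc (m + k)) (face X (Suc (Suc (m + k))) i x)
        = face X (Suc (m + k)) i ?y"
      using face_face' [of x "m + k" i "Suc (Suc (m + k))"] Suc.prems False by simp
    ultimately show ?thesis using Suc.IH [of ?y] Suc.prems False by simp
  qed simp
qed

lemma front_face_inside:
  "x \<in> cells X (Suc (m + k)) \<Longrightarrow> i \<le> m \<Longrightarrow>
    front X m k (face X (Suc (m + k)) i x) = face X (Suc m) i (front X (Suc m) k x)"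
proof (induction k arbitrary: x)
  case (Suc k)
  let ?y = "face X (Suc (Suc (m + k))) (Suc (Suc (m + k))) x"
  have "?y \<in> cells X (Suc (m + k))" using Suc.prems(1) by (simp add: face_closed)
  moreover have "face X (Suc (m + k)) (Suc (m + k)) (face X (Suc (Suc (m + k))) i x)
      = face X (Suc (m + k)) i ?y"
    using face_face' [of x "m + k" i "Suc (Suc (m + k))"] Suc.prems by simp
  ultimately show ?case using Suc.IH [of ?y] Suc.prems by simp
qed simp

lemma front_Suc: "front X m (Suc k) x = face X (Suc m) (Suc m) (front X (Suc m) k x)"
  by (induction k arbitrary: x) simp_all

lemma front_degen:
  "x \<in> cells X (m + k) \<Longrightarrow> j \<le> m \<Longrightarrow>
    front X (Suc m) k (degen X (m + k) j x) = degen X m j (front X m k x)"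
proof (induction k arbitrary: x)
  case (Suc k)
  have "face X (Suc (Suc (m + k))) (Suc (Suc (m + k))) (degen X (Suc (m + k)) j x)
      = degen X (m + k) j (face X (Suc (m + k)) (Suc (m + k)) x)"
    using face_degen_greater [of x "Suc (m + k)" j "Suc (Suc (m + k))"] Suc.prems by simp
  moreover have "face X (Suc (m + k)) (Suc (m + k)) x \<in> cells X (m + k)"
    using Suc.prems by (simp add: face_closed)
  ultimately show ?case using Suc by simp
qed simp

end

(* Degrees and face indices are written as numerals throughout; this keeps 1 from becoming Suc 0. *)
declare One_nat_def [simp del]

lemma cells_nerve: "cells (nerve G) n = {gs. length gs = n \<and> set gs \<subseteq> carrier G}"
  and face_nerve: "face (nerve G) = nerve_face G"
  and degen_nerve: "degen (nerve G) = nerve_degen G"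
  by (simp_all add: nerve_def)

lemma cells_nerve_1: "cells (nerve G) 1 = {[g] | g. g \<in> carrier G}"
  by (auto simp: cells_nerve length_Suc_conv One_nat_def)

lemma cells_nerve_2: "cells (nerve G) 2 = {[g, h] | g h. g \<in> carrier G \<and> h \<in> carrier G}"
  by (auto simp: cells_nerve length_Suc_conv numeral_2_eq_2)

lemma nerve_face_2 [simp]:
  "nerve_face G 2 0 [g, h] = [h]" "nerve_face G 2 1 [g, h] = [g \<otimes>\<^bsub>G\<^esub> h]"
  "nerve_face G 2 2 [g, h] = [g]"
  by (simp_all add: nerve_face_def)

section \<open>The group of the twisted product\<close>

lemma cells_twisted_product:
    "cells (twisted_product d X \<gamma>) n = cells (nerve (Zmod d)) n \<times> cells X n"
  by (simp add: twisted_product_def)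

lemma face_on_triangle: "face_on X 2 {0, 1, 2} \<sigma> = \<sigma>"
  by (simp add: face_on_def upt_rec)

lemma face_twisted_product_2:
  "face (twisted_product d X \<gamma>) 2 0 ([a, b], \<sigma>) = ([(\<gamma> \<sigma> + b) mod int d], face X 2 0 \<sigma>)"
  "face (twisted_product d X \<gamma>) 2 1 ([a, b], \<sigma>) = ([(a + b) mod int d], face X 2 1 \<sigma>)"
  "face (twisted_product d X \<gamma>) 2 2 ([a, b], \<sigma>) = ([a], face X 2 2 \<sigma>)"
  by (simp_all add: twisted_product_def face_nerve twist_def upt_rec face_on_triangle)

lemma nat_le_2_iff: "i \<le> 2 \<longleftrightarrow> i = 0 \<or> i = 1 \<or> i = (2 :: nat)"
  by auto

context central_cyclic begin

lemma carrier_Zmod: "carrier (Zmod d) = {0..<int d}"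
  using d_gt_1 by (simp add: carrier_integer_mod_group)

lemma J_pow_mult_mult:
  assumes "g \<in> carrier G" "h \<in> carrier G"
  shows "(J [^] (k :: int) \<otimes> g) \<otimes> (J [^] (l :: int) \<otimes> h) = J [^] (k + l) \<otimes> (g \<otimes> h)"
proof -
  have "(J [^] k \<otimes> g) \<otimes> (J [^] l \<otimes> h) = J [^] k \<otimes> (g \<otimes> (J [^] l \<otimes> h))"
    using assms by (simp add: m_assoc)
  also have "\<dots> = J [^] (k + l) \<otimes> (g \<otimes> h)"
    using assms by (simp only: J_pow_left_commute J_pow_add m_closed)
  finally show ?thesis .
qed

lemma J_pow_left_cancel:
  assumes "g \<in> carrier G" "h \<in> carrier G"
  shows "J [^] (k :: int) \<otimes> g = h \<longleftrightarrow> g = J [^] (- k) \<otimes> h"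
proof -
  have "J [^] k \<otimes> (J [^] (- k) \<otimes> h) = h" "J [^] (- k) \<otimes> (J [^] k \<otimes> g) = g"
    using assms by (simp_all add: J_pow_add)
  then show ?thesis by metis
qed

lemma pairwise_commute_le_2_iff:
  "(\<forall>i\<le>2. \<forall>j\<le>2. g i \<otimes> g j = g j \<otimes> g i) \<longleftrightarrow>
    g 0 \<otimes> g 1 = g 1 \<otimes> g 0 \<and> g 0 \<otimes> g 2 = g 2 \<otimes> g 0 \<and> g 1 \<otimes> g 2 = g 2 \<otimes> g (1 :: nat)"
  unfolding nat_le_2_iff by metis

lemma Sol_X_triangle:
  assumes face: "\<And>\<sigma> i. \<sigma> \<in> cells X 2 \<Longrightarrow> i \<le> 2 \<Longrightarrow> face X 2 i \<sigma> \<in> cells X 1"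
    and "T \<in> Sol_X d X \<gamma> G J" "\<sigma> \<in> cells X 2"
  shows "i \<le> 2 \<Longrightarrow> j \<le> 2 \<Longrightarrow>
      T (face X 2 i \<sigma>) \<otimes> T (face X 2 j \<sigma>) = T (face X 2 j \<sigma>) \<otimes> T (face X 2 i \<sigma>)"
    and "T (face X 2 2 \<sigma>) \<otimes> T (face X 2 0 \<sigma>) = J [^] (- \<gamma> \<sigma>) \<otimes> T (face X 2 1 \<sigma>)"
  using assms(2,3) by (subst (asm) Sol_X_iff; blast intro: face)+

lemma Sol_X_degenerate:
  assumes "simplicial_set X" "normalized X \<gamma>" "T \<in> Sol_X d X \<gamma> G J" "v \<in> cells X 0"
  shows "T (degen X 0 0 v) = \<one>"
proof -
  interpret simplicial_set X by fact
  let ?x = "degen X 0 0 v"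
  have x: "?x \<in> cells X 1" using assms degen_cells by blast
  then have "degen X 1 0 ?x \<in> cells X 2" "\<gamma> (degen X 1 0 ?x) = 0"
    using degen_cells assms by (auto simp: normalized_def)
  moreover have "T ?x \<in> carrier G"
    using assms(3) x by (auto simp: Sol_X_iff face_cells)
  ultimately show ?thesis
    using assms(3,4) x by (auto simp: Sol_X_iff face_cells face_degen_edge face_degen_vertex dest!: bspec)
qed

text \<open>A triangle of the twisted product is a triangle \<open>\<sigma>\<close> of \<open>X\<close> with two coordinates \<open>a\<close>, \<open>b\<close>.  The
  twist enters only through the shift of \<open>b\<close> by \<open>\<gamma>(\<sigma>)\<close> in the \<open>0\<close>-th face.\<close>

lemma pi1_relations_iff:
  assumes X: "simplicial_set X" and f: "f \<in> cells (twisted_product d X \<gamma>) 1 \<rightarrow>\<^sub>E carrier G"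
  shows "(\<forall>(l, r)\<in>pi1_rels d (twisted_product d X \<gamma>). word_value G f l = word_value G f r) \<longleftrightarrow>
    (\<forall>a\<in>{0..<int d}. \<forall>x\<in>cells X 1. f ([a], x) [^] d = \<one>) \<and>
    (\<forall>a\<in>{0..<int d}. \<forall>b\<in>{0..<int d}. \<forall>\<sigma>\<in>cells X 2.
      (let g2 = f ([a], face X 2 2 \<sigma>); g1 = f ([(a + b) mod int d], face X 2 1 \<sigma>);
         g0 = f ([(\<gamma> \<sigma> + b) mod int d], face X 2 0 \<sigma>)
       in g0 \<otimes> g1 = g1 \<otimes> g0 \<and> g0 \<otimes> g2 = g2 \<otimes> g0 \<and> g1 \<otimes> g2 = g2 \<otimes> g1 \<and> g2 \<otimes> g0 = g1))"
    (is "_ \<longleftrightarrow> ?pow \<and> ?tri")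
proof -
  interpret simplicial_set X by fact
  let ?Y = "twisted_product d X \<gamma>"
  have closed: "f ([a], x) \<in> carrier G" if "a \<in> {0..<int d}" "x \<in> cells X 1" for a x
    using f that by (auto simp: cells_twisted_product cells_nerve_1 carrier_Zmod)
  have mod: "k mod int d \<in> {0..<int d}" for k
    using d_gt_1 by simp
  have face_closed: "f (face ?Y 2 i \<sigma>) \<in> carrier G" if "\<sigma> \<in> cells ?Y 2" "i \<le> 2" for \<sigma> i
    using that closed mod face_cells
    by (auto simp: cells_twisted_product cells_nerve_2 carrier_Zmod nat_le_2_iff face_twisted_product_2)
  have "(\<forall>(l, r)\<in>pi1_rels d ?Y. word_value G f l = word_value G f r) \<longleftrightarrow>
    ((\<forall>y\<in>cells ?Y 1. word_value G f (power_word y (int d)) = \<one>) \<and>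
    (\<forall>\<sigma>\<in>cells ?Y 2. \<forall>i\<le>2. \<forall>j\<le>2.
      f (face ?Y 2 i \<sigma>) \<otimes> f (face ?Y 2 j \<sigma>) = f (face ?Y 2 j \<sigma>) \<otimes> f (face ?Y 2 i \<sigma>))) \<and>
    (\<forall>\<sigma>\<in>cells ?Y 2. f (face ?Y 2 2 \<sigma>) \<otimes> f (face ?Y 2 0 \<sigma>) = f (face ?Y 2 1 \<sigma>))"
    unfolding pi1_rels_def ball_Un
    by (intro arg_cong2 [where f = "(\<and>)"]) (fastforce simp: face_closed)+
  also have "\<dots> \<longleftrightarrow> ?pow \<and> ?tri"
  proof -
    have 1: "(\<forall>y\<in>cells ?Y 1. word_value G f (power_word y (int d)) = \<one>) \<longleftrightarrow> ?pow"
    proof -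
      have "word_value G f (power_word y (int d)) = f y [^] d" if "y \<in> cells ?Y 1" for y
        by (simp add: word_value_power_word PiE_mem [OF f that] int_pow_int)
      then have "(\<forall>y\<in>cells ?Y 1. word_value G f (power_word y (int d)) = \<one>) \<longleftrightarrow>
          (\<forall>y\<in>cells ?Y 1. f y [^] d = \<one>)"
        by simp
      then show ?thesis
        by (auto simp: cells_twisted_product cells_nerve_1 carrier_Zmod)
    qed
    have 2: "(\<forall>\<sigma>\<in>cells ?Y 2. P \<sigma>) \<longleftrightarrow> (\<forall>a\<in>{0..<int d}. \<forall>b\<in>{0..<int d}. \<forall>\<sigma>\<in>cells X 2. P ([a, b], \<sigma>))" for P
      by (auto simp: cells_twisted_product cells_nerve_2 carrier_Zmod)
    have "(\<forall>\<sigma>\<in>cells ?Y 2. \<forall>i\<le>2. \<forall>j\<le>2.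
        f (face ?Y 2 i \<sigma>) \<otimes> f (face ?Y 2 j \<sigma>) = f (face ?Y 2 j \<sigma>) \<otimes> f (face ?Y 2 i \<sigma>)) \<and>
      (\<forall>\<sigma>\<in>cells ?Y 2. f (face ?Y 2 2 \<sigma>) \<otimes> f (face ?Y 2 0 \<sigma>) = f (face ?Y 2 1 \<sigma>)) \<longleftrightarrow> ?tri"
      unfolding ball_conj_distrib [symmetric] 2 pairwise_commute_le_2_iff face_twisted_product_2 Let_def
      by (simp only: conj_assoc)
    with 1 show ?thesis by argo
  qed
  finally show ?thesis .
qed

text \<open>Normalized cocycles vanish on the degenerate triangles of an edge \<open>x : v \<rightarrow> w\<close>, so the
  twist disappears there.  The triangle \<open>s\<^sub>0 x\<close> says that multiplication by \<open>e\<^bsub>a,s\<^sub>0v\<^esub>\<close> shifts the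
  coordinate of \<open>e\<^bsub>b,x\<^esub>\<close> by \<open>a\<close>, and \<open>s\<^sub>1 x\<close> says the same of \<open>e\<^bsub>a,s\<^sub>0w\<^esub>\<close>.  Hence \<open>e\<^bsub>1,s\<^sub>0v\<^esub>\<close> and
  \<open>e\<^bsub>1,s\<^sub>0w\<^esub>\<close> have the same image; by connectedness it is \<open>J\<close> at every vertex.\<close>

lemma pi1_value_eq:
  assumes X: "simplicial_set X" "sset_connected X" "normalized X \<gamma>"
    and f: "f \<in> cells (twisted_product d X \<gamma>) 1 \<rightarrow>\<^sub>E carrier G"
    and rel: "\<forall>(l, r)\<in>pi1_rels d (twisted_product d X \<gamma>). word_value G f l = word_value G f r"
    and v0: "v0 \<in> cells X 0" "f ([1], degen X 0 0 v0) = J"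
    and a: "a \<in> {0..<int d}" and x: "x \<in> cells X 1"
  shows "f ([a], x) = J [^] a \<otimes> f ([0], x)"
proof -
  interpret simplicial_set X by fact
  have closed: "f ([a], x) \<in> carrier G" if "a \<in> {0..<int d}" "x \<in> cells X 1" for a x
    using f that by (auto simp: cells_twisted_product cells_nerve_1 carrier_Zmod)
  have tri: "f ([a], face X 2 2 \<sigma>) \<otimes> f ([(\<gamma> \<sigma> + b) mod int d], face X 2 0 \<sigma>)
      = f ([(a + b) mod int d], face X 2 1 \<sigma>)"
    "f ([a], face X 2 2 \<sigma>) \<otimes> f ([(\<gamma> \<sigma> + b) mod int d], face X 2 0 \<sigma>)
      = f ([(\<gamma> \<sigma> + b) mod int d], face X 2 0 \<sigma>) \<otimes> f ([a], face X 2 2 \<sigma>)"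
    if "\<sigma> \<in> cells X 2" "a \<in> {0..<int d}" "b \<in> {0..<int d}" for \<sigma> a b
    using rel [unfolded pi1_relations_iff [OF X(1) f]] that by (auto simp: Let_def)
  have s0: "f ([a], degen X 0 0 (face X 1 1 x)) \<otimes> f ([b], x) = f ([(a + b) mod int d], x)"
    "f ([a], degen X 0 0 (face X 1 1 x)) \<otimes> f ([b], x) = f ([b], x) \<otimes> f ([a], degen X 0 0 (face X 1 1 x))"
    if "x \<in> cells X 1" "a \<in> {0..<int d}" "b \<in> {0..<int d}" for x a b
    using tri [of "degen X 1 0 x" a b] that X(3) degen_cells
    by (auto simp: face_degen_edge normalized_def)
  have s1: "f ([a], x) \<otimes> f ([b], degen X 0 0 (face X 1 0 x)) = f ([(a + b) mod int d], x)"
    if "x \<in> cells X 1" "a \<in> {0..<int d}" "b \<in> {0..<int d}" for x a b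
    using tri [of "degen X 1 1 x" a b] that X(3) degen_cells
    by (auto simp: face_degen_edge normalized_def)
  have J: "f ([1], degen X 0 0 v) = J" if "v \<in> cells X 0" for v
  proof (rule connected_vertex_property [OF X(2) v0(1) that, where P = "\<lambda>v. f ([1], degen X 0 0 v) = J"])
    fix x assume x: "x \<in> cells X 1"
    have "f ([0], x) \<otimes> f ([1], degen X 0 0 (face X 1 1 x)) = f ([0], x) \<otimes> f ([1], degen X 0 0 (face X 1 0 x))"
      using s0 [OF x, of 1 0] s1 [OF x, of 0 1] d_gt_1 by simp
    then have "f ([1], degen X 0 0 (face X 1 1 x)) = f ([1], degen X 0 0 (face X 1 0 x))"
      using closed x d_gt_1 face_cells degen_cells by simp
    then show "f ([1], degen X 0 0 (face X 1 1 x)) = J \<longleftrightarrow> f ([1], degen X 0 0 (face X 1 0 x)) = J"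
      by simp
  qed (fact v0(2))
  have "f ([int n], x) = J [^] int n \<otimes> f ([0], x)" if "n < d" for n
    using that
  proof (induction n)
    case (Suc n)
    have "f ([int (Suc n)], x) = J \<otimes> f ([int n], x)"
      using s0(1) [OF x, of 1 "int n"] J [of "face X 1 1 x"] x face_cells Suc.prems by simp
    then show ?case
      using Suc closed [of 0 x] x d_gt_1 J_pow_add [of "f ([0], x)" 1 "int n"] by simp
  qed (use closed x d_gt_1 in simp)
  from this [of "nat a"] show ?thesis using a by (simp add: nat_less_iff)
qed

lemma bij_betw_pi1_homs:
  assumes X: "simplicial_set X" "sset_connected X"
    and \<gamma>: "\<gamma> \<in> cocycles d X 2" "normalized X \<gamma>"
  shows "bij_betw (\<lambda>\<theta>. \<lambda>x\<in>cells X 1. \<theta> (pi1_el d (twisted_product d X \<gamma>) ([0], x)))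
     (Hom_pi1 d X \<gamma> G J) (Sol_X d X \<gamma> G J)"
proof -
  interpret simplicial_set X by fact
  let ?Y = "twisted_product d X \<gamma>"
  let ?S = "cells ?Y 1" and ?R = "pi1_rels d ?Y"
  let ?\<Phi> = "\<lambda>\<theta>. \<lambda>y\<in>?S. \<theta> (pres_class ?S ?R [(y, False)])"
  let ?F = "{f \<in> ?S \<rightarrow>\<^sub>E carrier G. \<forall>(l, r)\<in>?R. word_value G f l = word_value G f r}"
  define v0 where "v0 = (SOME v. v \<in> cells X 0)"
  have v0: "v0 \<in> cells X 0"
    using X(2) unfolding v0_def sset_connected_def by (metis ex_in_conv someI_ex)
  let ?e1 = "([1], degen X 0 0 v0)"
  have S: "([a], x) \<in> ?S \<longleftrightarrow> a \<in> {0..<int d} \<and> x \<in> cells X 1" for a x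
    by (simp add: cells_twisted_product cells_nerve_1 carrier_Zmod)
  have e1: "?e1 \<in> ?S"
    using v0 degen_cells d_gt_1 by (simp add: S)
  have "face ?Y 2 i \<sigma> \<in> ?S" if "\<sigma> \<in> cells ?Y 2" "i \<le> 2" for i \<sigma>
    using that face_cells d_gt_1
    by (auto simp: cells_twisted_product cells_nerve_1 cells_nerve_2 carrier_Zmod nat_le_2_iff
        face_twisted_product_2)
  then have "?R \<subseteq> words ?S \<times> words ?S"
    unfolding pi1_rels_def by auto
  from bij_betw_Collect [OF bij_betw_homs_presented_group [OF this],
      where P = "\<lambda>\<theta>. \<theta> (e_one d X \<gamma>) = J" and Q = "\<lambda>f. f ?e1 = J"]
  have 1: "bij_betw ?\<Phi> (Hom_pi1 d X \<gamma> G J) {f \<in> ?F. f ?e1 = J}"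
    using e1 by (simp add: Hom_pi1_def pi1_def e_one_def pi1_el_def v0_def)
  have 2: "bij_betw (\<lambda>f. \<lambda>x\<in>cells X 1. f ([0], x)) {f \<in> ?F. f ?e1 = J} (Sol_X d X \<gamma> G J)"
  proof (rule bij_betw_byWitness)
    (* Edges of the twisted product carry a list of length one, whose head is the coordinate a. *)
    let ?extend = "\<lambda>T. \<lambda>(\<alpha>, x)\<in>?S. J [^] hd \<alpha> \<otimes> T x"
    have ext: "f ([a], x) = J [^] a \<otimes> f ([0], x)"
      if "f \<in> {f \<in> ?F. f ?e1 = J}" "a \<in> {0..<int d}" "x \<in> cells X 1" for f a x
      using that by (intro pi1_value_eq [OF X \<gamma>(2) _ _ v0]) auto
    show "\<forall>f\<in>{f \<in> ?F. f ?e1 = J}. ?extend (\<lambda>x\<in>cells X 1. f ([0], x)) = f"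
    proof
      fix f assume f: "f \<in> {f \<in> ?F. f ?e1 = J}"
      then have "f \<in> extensional ?S" by (auto simp: PiE_def)
      then show "?extend (\<lambda>x\<in>cells X 1. f ([0], x)) = f"
      proof (rule extensionalityI [OF restrict_extensional])
        fix y assume y: "y \<in> ?S"
        then obtain a x where "y = ([a], x)" "a \<in> {0..<int d}" "x \<in> cells X 1"
          by (auto simp: cells_twisted_product cells_nerve_1 carrier_Zmod)
        then show "?extend (\<lambda>x\<in>cells X 1. f ([0], x)) y = f y"
          using ext [OF f, of a x] y by simp
      qed
    qed
    have T_closed: "T x \<in> carrier G" if "T \<in> Sol_X d X \<gamma> G J" "x \<in> cells X 1" for T x
      using that by (auto simp: Sol_X_iff face_cells)
    show "\<forall>T\<in>Sol_X d X \<gamma> G J. (\<lambda>x\<in>cells X 1. ?extend T ([0], x)) = T"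
    proof
      fix T assume T: "T \<in> Sol_X d X \<gamma> G J"
      then have "T \<in> extensional (cells X 1)" by (auto simp: Sol_X_iff face_cells PiE_def)
      then show "(\<lambda>x\<in>cells X 1. ?extend T ([0], x)) = T"
        using T_closed [OF T] d_gt_1
        by (intro extensionalityI [OF restrict_extensional]) (auto simp: S)
    qed
    show "(\<lambda>f. \<lambda>x\<in>cells X 1. f ([0], x)) ` {f \<in> ?F. f ?e1 = J} \<subseteq> Sol_X d X \<gamma> G J"
    proof (rule image_subsetI)
      fix f assume f: "f \<in> {f \<in> ?F. f ?e1 = J}"
      then have fE: "f \<in> ?S \<rightarrow>\<^sub>E carrier G" by simp
      have closed: "f ([0], x) \<in> carrier G" if "x \<in> cells X 1" for x
        using fE that d_gt_1 by (auto simp: S)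
      have pow: "f ([0], x) [^] d = \<one>" if "x \<in> cells X 1" for x
        using f that d_gt_1 pi1_relations_iff [OF X(1) fE] by simp
      define T where "T = (\<lambda>x\<in>cells X 1. f ([0], x))"
      have "(\<forall>i\<le>2. \<forall>j\<le>2. T (face X 2 i \<sigma>) \<otimes> T (face X 2 j \<sigma>)
            = T (face X 2 j \<sigma>) \<otimes> T (face X 2 i \<sigma>)) \<and>
          T (face X 2 2 \<sigma>) \<otimes> T (face X 2 0 \<sigma>) = J [^] (- \<gamma> \<sigma>) \<otimes> T (face X 2 1 \<sigma>)"
        if \<sigma>: "\<sigma> \<in> cells X 2" for \<sigma>
      proof -
        define g0 g1 g2 where "g0 = f ([0], face X 2 0 \<sigma>)" and "g1 = f ([0], face X 2 1 \<sigma>)"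
          and "g2 = f ([0], face X 2 2 \<sigma>)"
        have g: "g0 \<in> carrier G" "g1 \<in> carrier G" "g2 \<in> carrier G"
          using closed \<sigma> face_cells by (auto simp: g0_def g1_def g2_def)
        have "f ([\<gamma> \<sigma> mod int d], face X 2 0 \<sigma>) = J [^] (\<gamma> \<sigma> mod int d) \<otimes> g0"
          unfolding g0_def using \<sigma> face_cells d_gt_1 by (intro ext [OF f]) auto
        then have g0': "f ([\<gamma> \<sigma> mod int d], face X 2 0 \<sigma>) = J [^] \<gamma> \<sigma> \<otimes> g0" by simp
        have comm: "(J [^] \<gamma> \<sigma> \<otimes> g0) \<otimes> g1 = g1 \<otimes> (J [^] \<gamma> \<sigma> \<otimes> g0)"
          "(J [^] \<gamma> \<sigma> \<otimes> g0) \<otimes> g2 = g2 \<otimes> (J [^] \<gamma> \<sigma> \<otimes> g0)" "g1 \<otimes> g2 = g2 \<otimes> g1"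
          "g2 \<otimes> (J [^] \<gamma> \<sigma> \<otimes> g0) = g1"
          using f \<sigma> d_gt_1 pi1_relations_iff [OF X(1) fE, THEN iffD1, THEN conjunct2, rule_format, of 0 0 \<sigma>]
          by (simp_all add: Let_def g0' flip: g1_def g2_def)
        then have "g0 \<otimes> g1 = g1 \<otimes> g0" "g0 \<otimes> g2 = g2 \<otimes> g0"
          using g J_pow_mult_commute_iff by blast+
        moreover have "g2 \<otimes> g0 = J [^] (- \<gamma> \<sigma>) \<otimes> g1"
          using comm(4) g J_pow_left_cancel [of "g2 \<otimes> g0" g1 "\<gamma> \<sigma>"] J_pow_left_commute [of g2 g0 "\<gamma> \<sigma>"] by simp
        moreover have "T (face X 2 0 \<sigma>) = g0" "T (face X 2 1 \<sigma>) = g1" "T (face X 2 2 \<sigma>) = g2"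
          using \<sigma> face_cells by (auto simp: T_def g0_def g1_def g2_def)
        ultimately show ?thesis
          using comm(3) unfolding nat_le_2_iff by auto
      qed
      moreover have "T \<in> cells X 1 \<rightarrow>\<^sub>E carrier G" "\<forall>x\<in>cells X 1. T x [^] d = \<one>"
        using closed pow by (auto simp: T_def)
      ultimately show "(\<lambda>x\<in>cells X 1. f ([0], x)) \<in> Sol_X d X \<gamma> G J"
        unfolding T_def [symmetric] by (subst Sol_X_iff) (blast intro: face_cells)+
    qed
    show "?extend ` Sol_X d X \<gamma> G J \<subseteq> {f \<in> ?F. f ?e1 = J}"
    proof (rule image_subsetI)
      fix T assume T: "T \<in> Sol_X d X \<gamma> G J"
      note closed = T_closed [OF T]
      have fE: "?extend T \<in> ?S \<rightarrow>\<^sub>E carrier G"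
        using closed by (auto simp: cells_twisted_product)
      have val: "?extend T ([k mod int d], x) = J [^] k \<otimes> T x" if "x \<in> cells X 1" for k x
        using that d_gt_1 S [of "k mod int d" x] by simp
      have val': "?extend T ([a], x) = J [^] a \<otimes> T x" if "x \<in> cells X 1" "a \<in> {0..<int d}" for a x
        using that by (simp add: S)
      have "?extend T ?e1 = J"
        using v0 d_gt_1 degen_cells Sol_X_degenerate [OF X(1) \<gamma>(2) T] val' [of "degen X 0 0 v0" 1] by simp
      moreover have "\<forall>(l, r)\<in>?R. word_value G (?extend T) l = word_value G (?extend T) r"
        unfolding pi1_relations_iff [OF X(1) fE]
      proof (intro conjI ballI)
        fix a x assume ax: "a \<in> {0..<int d}" "x \<in> cells X 1"
        then show "?extend T ([a], x) [^] d = \<one>"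
          using T closed by (simp only: val' J_pow_mult_pow_d) (simp add: Sol_X_iff face_cells)
      next
        fix a b \<sigma> assume ab: "a \<in> {0..<int d}" "b \<in> {0..<int d}" and \<sigma>: "\<sigma> \<in> cells X 2"
        define g0 g1 g2 where "g0 = T (face X 2 0 \<sigma>)" and "g1 = T (face X 2 1 \<sigma>)"
          and "g2 = T (face X 2 2 \<sigma>)"
        have g: "g0 \<in> carrier G" "g1 \<in> carrier G" "g2 \<in> carrier G"
          using closed \<sigma> face_cells by (auto simp: g0_def g1_def g2_def)
        have comm: "g0 \<otimes> g1 = g1 \<otimes> g0" "g0 \<otimes> g2 = g2 \<otimes> g0" "g1 \<otimes> g2 = g2 \<otimes> g1"
          and eq: "g2 \<otimes> g0 = J [^] (- \<gamma> \<sigma>) \<otimes> g1"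
          using Sol_X_triangle [OF face_cells(2) T \<sigma>] unfolding g0_def g1_def g2_def by simp_all
        have faces: "?extend T ([a], face X 2 2 \<sigma>) = J [^] a \<otimes> g2"
          "?extend T ([(a + b) mod int d], face X 2 1 \<sigma>) = J [^] (a + b) \<otimes> g1"
          "?extend T ([(\<gamma> \<sigma> + b) mod int d], face X 2 0 \<sigma>) = J [^] (\<gamma> \<sigma> + b) \<otimes> g0"
          unfolding g0_def g1_def g2_def using \<sigma> face_cells ab by (simp_all only: val val')
        show "let g2 = ?extend T ([a], face X 2 2 \<sigma>); g1 = ?extend T ([(a + b) mod int d], face X 2 1 \<sigma>);
           g0 = ?extend T ([(\<gamma> \<sigma> + b) mod int d], face X 2 0 \<sigma>)
         in g0 \<otimes> g1 = g1 \<otimes> g0 \<and> g0 \<otimes> g2 = g2 \<otimes> g0 \<and> g1 \<otimes> g2 = g2 \<otimes> g1 \<and> g2 \<otimes> g0 = g1"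
          unfolding Let_def faces using g comm eq
          by (simp only: J_pow_mult_mult J_pow_add int_pow_closed J_closed m_closed) (simp add: algebra_simps)
      qed
      ultimately show "?extend T \<in> {f \<in> ?F. f ?e1 = J}" using fE by blast
    qed
  qed
  show ?thesis
    using bij_betw_trans [OF 1 2]
    by (rule bij_betw_cong [THEN iffD1, rotated]) (use d_gt_1 in \<open>auto simp: fun_eq_iff pi1_el_def S\<close>)
qed

end

section \<open>Cohomology classes\<close>

lemma coboundary_1:
  "coboundary d X 1 h =
    (\<lambda>\<sigma>\<in>cells X 2. (h (face X 2 0 \<sigma>) - h (face X 2 1 \<sigma>) + h (face X 2 2 \<sigma>)) mod int d)"
  by (simp add: coboundary_def numeral_2_eq_2 One_nat_def)

lemma carrier_cochain_group:
  "d > 0 \<Longrightarrow> carrier (cochain_group d X n) = cells X n \<rightarrow>\<^sub>E {0..<int d}"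
  by (simp add: cochain_group_def carrier_integer_mod_group)

lemma mult_cochain_group:
  "c \<otimes>\<^bsub>cochain_group d X n\<^esub> c' = (\<lambda>x\<in>cells X n. (c x + c' x) mod int d)"
  by (simp add: cochain_group_def)

lemma group_cochain_group: "group (cochain_group d X n)"
  by (simp add: cochain_group_def)

text \<open>Classes of 2-cochains and solutions of the system involve edges and triangles only, and
  they are needed both on \<open>X\<close> and on \<open>\<bar>N\<close>; the locale isolates what the two have in common.\<close>

locale triangles_closed =
  fixes X :: "'b sset" and d :: nat
  assumes face_triangle: "\<sigma> \<in> cells X 2 \<Longrightarrow> i \<le> 2 \<Longrightarrow> face X 2 i \<sigma> \<in> cells X 1"
    and modulus_pos: "d > 0"
begin

lemma subgroup_coboundaries:
  "subgroup (coboundary d X 1 ` carrier (cochain_group d X 1)) (cochain_group d X 2)"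
proof -
  have "coboundary d X 1 \<in> hom (cochain_group d X 1) (cochain_group d X 2)"
  proof (rule homI)
    fix h k
    show "coboundary d X 1 (h \<otimes>\<^bsub>cochain_group d X 1\<^esub> k)
        = coboundary d X 1 h \<otimes>\<^bsub>cochain_group d X 2\<^esub> coboundary d X 1 k"
      unfolding coboundary_1 mult_cochain_group
    proof (rule restrict_ext)
      fix \<sigma> assume "\<sigma> \<in> cells X 2"
      moreover have "(a mod int d - b mod int d + c mod int d) mod int d = (a - b + c) mod int d" for a b c
        by (subst mod_add_left_eq [symmetric], subst mod_diff_eq) (simp add: mod_simps)
      ultimately show "((\<lambda>x\<in>cells X 1. (h x + k x) mod int d) (face X 2 0 \<sigma>) -
          (\<lambda>x\<in>cells X 1. (h x + k x) mod int d) (face X 2 1 \<sigma>) +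
          (\<lambda>x\<in>cells X 1. (h x + k x) mod int d) (face X 2 2 \<sigma>)) mod int d =
        ((\<lambda>\<sigma>\<in>cells X 2. (h (face X 2 0 \<sigma>) - h (face X 2 1 \<sigma>) + h (face X 2 2 \<sigma>)) mod int d) \<sigma> +
          (\<lambda>\<sigma>\<in>cells X 2. (k (face X 2 0 \<sigma>) - k (face X 2 1 \<sigma>) + k (face X 2 2 \<sigma>)) mod int d) \<sigma>) mod int d"
        by (simp add: face_triangle mod_add_eq) (simp add: algebra_simps)
    qed
  qed (simp add: coboundary_1 carrier_cochain_group modulus_pos)
  then have "group_hom (cochain_group d X 1) (cochain_group d X 2) (coboundary d X 1)"
    by (simp add: group_hom_def group_hom_axioms_def group_cochain_group)
  then show ?thesis by (rule group_hom.img_is_subgroup)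
qed

lemma H2_class_iff:
  assumes "c \<in> carrier (cochain_group d X 2)"
  shows "c \<in> H2_class d X c' \<longleftrightarrow> (\<exists>h\<in>carrier (cochain_group d X 1). \<forall>\<sigma>\<in>cells X 2.
    c \<sigma> = (h (face X 2 0 \<sigma>) - h (face X 2 1 \<sigma>) + h (face X 2 2 \<sigma>) + c' \<sigma>) mod int d)"
proof -
  have "c = coboundary d X 1 h \<otimes>\<^bsub>cochain_group d X 2\<^esub> c' \<longleftrightarrow> (\<forall>\<sigma>\<in>cells X 2.
    c \<sigma> = (h (face X 2 0 \<sigma>) - h (face X 2 1 \<sigma>) + h (face X 2 2 \<sigma>) + c' \<sigma>) mod int d)" for h
    using assms unfolding carrier_cochain_group [OF modulus_pos] mult_cochain_group coboundary_1
    by (auto simp: fun_eq_iff mod_simps PiE_iff extensional_def)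
  then show ?thesis
    unfolding H2_class_def r_coset_def by blast
qed

lemma H2_class_self: "c \<in> carrier (cochain_group d X 2) \<Longrightarrow> c \<in> H2_class d X c"
  unfolding H2_class_def by (intro group.rcos_self group_cochain_group subgroup_coboundaries)

lemma H2_class_carrier:
  assumes "c \<in> H2_class d X c'" "c' \<in> carrier (cochain_group d X 2)"
  shows "c \<in> carrier (cochain_group d X 2)"
  using assms subgroup.elemrcos_carrier [OF subgroup_coboundaries group_cochain_group]
  unfolding H2_class_def by blast

lemma H2_class_eq_iff:
  assumes "c \<in> carrier (cochain_group d X 2)" "c' \<in> carrier (cochain_group d X 2)"
  shows "H2_class d X c = H2_class d X c' \<longleftrightarrow> c \<in> H2_class d X c'"
  using assms group.repr_independence [OF group_cochain_group _ _ subgroup_coboundaries]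
    H2_class_self unfolding H2_class_def by metis

end

section \<open>The quotient of commuting tuples by the central subgroup\<close>

lemma N_comm_simps:
  "cells (N_comm d G) n = {gs. length gs = n \<and> set gs \<subseteq> carrier G \<and>
     (\<forall>g\<in>set gs. \<forall>h\<in>set gs. g \<otimes>\<^bsub>G\<^esub> h = h \<otimes>\<^bsub>G\<^esub> g) \<and> (\<forall>g\<in>set gs. g [^]\<^bsub>G\<^esub> d = \<one>\<^bsub>G\<^esub>)}"
  "face (N_comm d G) = nerve_face G" "degen (N_comm d G) = nerve_degen G"
  by (auto simp: N_comm_def nerve_def)

lemma N_bar_simps:
  "cells (N_bar d G J) n = map (J_coset G J) ` cells (N_comm d G) n"
  "face (N_bar d G J) = nerve_face (G Mod generate G {J})"
  "degen (N_bar d G J) = nerve_degen (G Mod generate G {J})"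
  by (auto simp: N_bar_def nerve_def)

lemma length_nerve_face:
  "length gs = Suc n \<Longrightarrow> i \<le> Suc n \<Longrightarrow> length (nerve_face G (Suc n) i gs) = n"
  by (auto simp: nerve_face_def)

lemma set_nerve_face:
  assumes "length gs = n" "i \<le> n"
  shows "set (nerve_face G n i gs) \<subseteq> set gs \<union> {g \<otimes>\<^bsub>G\<^esub> h | g h. g \<in> set gs \<and> h \<in> set gs}"
proof (cases "i = 0 \<or> i = n")
  case True
  then show ?thesis
    using assms by (auto simp: nerve_face_def dest: list.set_sel(2) in_set_butlastD)
next
  case False
  then have "gs ! (i - 1) \<in> set gs" "gs ! i \<in> set gs" using assms by auto
  then show ?thesis
    using False by (auto simp: nerve_face_def dest: in_set_takeD in_set_dropD)
qed

lemma map_nerve_face: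
  assumes "\<And>g h. g \<in> set gs \<Longrightarrow> h \<in> set gs \<Longrightarrow> q (g \<otimes>\<^bsub>G\<^esub> h) = q g \<otimes>\<^bsub>K\<^esub> q h" "length gs = n" "i \<le> n"
  shows "map q (nerve_face G n i gs) = nerve_face K n i (map q gs)"
proof (cases "i = 0 \<or> i = n")
  case False
  then have "gs ! (i - 1) \<in> set gs" "gs ! i \<in> set gs" using assms by auto
  then show ?thesis
    using False assms by (auto simp: nerve_face_def take_map drop_map)
qed (auto simp: nerve_face_def map_tl map_butlast)

lemma map_nerve_degen:
  "q \<one>\<^bsub>G\<^esub> = \<one>\<^bsub>K\<^esub> \<Longrightarrow> map q (nerve_degen G n j gs) = nerve_degen K n j (map q gs)"
  by (simp add: nerve_degen_def take_map drop_map)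

context central_cyclic begin

abbreviation "J_sub \<equiv> generate G {J}"
abbreviation "Gbar \<equiv> G Mod J_sub"
abbreviation "Nbar \<equiv> N_bar d G J"
abbreviation "q \<equiv> J_coset G J"

lemma J_sub_eq: "J_sub = range (\<lambda>k :: int. J [^] k)"
  using generate_pow [OF J_closed] by auto

lemma normal_J_sub: "J_sub \<lhd> G"
  unfolding normal_inv_iff
proof (intro conjI ballI)
  show "subgroup J_sub G" by (simp add: generate_is_subgroup)
  fix x h assume "x \<in> carrier G" "h \<in> J_sub"
  then show "x \<otimes> h \<otimes> inv x \<in> J_sub"
    unfolding J_sub_eq by (auto simp: J_pow_commute m_assoc)
qed

lemma group_Gbar: "group Gbar"
  using normal_J_sub by (rule normal.factorgroup_is_group)

lemma q_mult: "g \<in> carrier G \<Longrightarrow> h \<in> carrier G \<Longrightarrow> q (g \<otimes> h) = q g \<otimes>\<^bsub>Gbar\<^esub> q h"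
  using normal.rcos_sum [OF normal_J_sub] by (simp add: J_coset_def)

lemma q_one: "q \<one> = \<one>\<^bsub>Gbar\<^esub>"
  using subgroup.subset [OF normal_imp_subgroup [OF normal_J_sub]] by (simp add: J_coset_def)

lemma carrier_Gbar: "carrier Gbar = q ` carrier G"
  by (auto simp: carrier_FactGroup J_coset_def)

lemma q_eq_iff:
  assumes "g \<in> carrier G" "h \<in> carrier G"
  shows "q g = q h \<longleftrightarrow> (\<exists>k :: int. h = J [^] k \<otimes> g)"
proof -
  have sub: "subgroup J_sub G" using normal_J_sub normal_imp_subgroup by blast
  have "q g = q h \<longleftrightarrow> h \<in> J_sub #> g"
    unfolding J_coset_def using assms sub repr_independence rcos_self by metis
  then show ?thesis by (auto simp: J_sub_eq r_coset_def)
qed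

lemma q_eqE:
  assumes "q g = q h" "g \<in> carrier G" "h \<in> carrier G"
  obtains k where "k \<in> {0..<int d}" "h = J [^] k \<otimes> g"
proof -
  obtain k :: int where "h = J [^] k \<otimes> g" using assms q_eq_iff by blast
  then have "h = J [^] (k mod int d) \<otimes> g" by simp
  then show ?thesis using that [of "k mod int d"] d_gt_1 by simp
qed

lemma q_J_pow_mult [simp]: "g \<in> carrier G \<Longrightarrow> q (J [^] (k :: int) \<otimes> g) = q g"
  using q_eq_iff [of g "J [^] k \<otimes> g"] by auto

text \<open>Whether a tuple consists of pairwise commuting \<open>d\<close>-torsion elements depends only on its image
  in the quotient, because multiplication by powers of \<open>J\<close> affects neither property.\<close>

lemma N_comm_if_q_eq:
  assumes gs: "gs \<in> cells (N_comm d G) n" and hs: "set hs \<subseteq> carrier G" "map q hs = map q gs"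
  shows "hs \<in> cells (N_comm d G) n"
proof -
  have lift: "\<exists>g\<in>set gs. \<exists>k :: int. h = J [^] k \<otimes> g" if "h \<in> set hs" for h
  proof -
    have "q h \<in> q ` set gs" using that hs(2) by (metis image_eqI list.set_map)
    then obtain g where "g \<in> set gs" "q g = q h" by auto
    moreover have "g \<in> carrier G" "h \<in> carrier G"
      using gs hs(1) that \<open>g \<in> set gs\<close> by (auto simp: N_comm_simps)
    ultimately show ?thesis using q_eq_iff by blast
  qed
  have "h \<otimes> h' = h' \<otimes> h" if hh: "h \<in> set hs" "h' \<in> set hs" for h h'
  proof -
    obtain g g' and k k' :: int where "g \<in> set gs" "g' \<in> set gs"
      "h = J [^] k \<otimes> g" "h' = J [^] k' \<otimes> g'"
      using lift hh by meson
    moreover from this have "g \<in> carrier G" "g' \<in> carrier G" "g \<otimes> g' = g' \<otimes> g"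
      using gs by (auto simp: N_comm_simps)
    ultimately show ?thesis by (simp add: J_pow_mult_mult add.commute)
  qed
  moreover have "h [^] d = \<one>" if "h \<in> set hs" for h
  proof -
    obtain g and k :: int where "g \<in> set gs" "h = J [^] k \<otimes> g"
      using lift \<open>h \<in> set hs\<close> by meson
    then show ?thesis using gs by (auto simp: N_comm_simps J_pow_mult_pow_d)
  qed
  moreover have "length hs = length gs" using hs(2) by (metis length_map)
  ultimately show ?thesis using gs hs(1) by (auto simp: N_comm_simps)
qed

lemma N_comm_subset_carrier: "gs \<in> cells (N_comm d G) n \<Longrightarrow> set gs \<subseteq> carrier G"
  by (simp add: N_comm_simps)

lemma N_comm_face:
  assumes "gs \<in> cells (N_comm d G) (Suc n)" "i \<le> Suc n"
  shows "nerve_face G (Suc n) i gs \<in> cells (N_comm d G) n"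
proof -
  let ?P = "set gs \<union> {g \<otimes> h | g h. g \<in> set gs \<and> h \<in> set gs}"
  have gs: "length gs = Suc n" "set gs \<subseteq> carrier G"
    and comm: "\<And>g h. g \<in> set gs \<Longrightarrow> h \<in> set gs \<Longrightarrow> g \<otimes> h = h \<otimes> g"
    and pow: "\<And>g. g \<in> set gs \<Longrightarrow> g [^] d = \<one>"
    using assms(1) by (auto simp: N_comm_simps)
  have closed: "g \<in> carrier G" if "g \<in> ?P" for g
    using that gs by auto
  have comm1: "g \<otimes> h = h \<otimes> g" if g: "g \<in> set gs" and h: "h \<in> ?P" for g h
  proof (cases "h \<in> set gs")
    case False
    then obtain a b where ab: "a \<in> set gs" "b \<in> set gs" "h = a \<otimes> b" using h by auto
    have "g \<otimes> (a \<otimes> b) = a \<otimes> (g \<otimes> b)"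
      using ab g gs comm by (intro left_commute_if_commute) auto
    also have "\<dots> = a \<otimes> (b \<otimes> g)" using comm ab g by metis
    finally show ?thesis using ab g gs by (simp add: m_assoc subset_iff)
  qed (use comm g in blast)
  have comm2: "g \<otimes> h = h \<otimes> g" if g: "g \<in> ?P" and h: "h \<in> ?P" for g h
  proof (cases "g \<in> set gs")
    case False
    then obtain a b where ab: "a \<in> set gs" "b \<in> set gs" "g = a \<otimes> b" using g by auto
    have c: "a \<in> carrier G" "b \<in> carrier G" "h \<in> carrier G"
      using ab closed h by auto
    have "h \<otimes> (a \<otimes> b) = a \<otimes> (h \<otimes> b)"
      using c comm1 [OF ab(1) h] by (intro left_commute_if_commute) auto
    also have "\<dots> = a \<otimes> (b \<otimes> h)" using comm1 [OF ab(2) h] by simp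
    finally show ?thesis using ab c by (simp add: m_assoc)
  qed (use comm1 h in blast)
  have "g [^] d = \<one>" if g: "g \<in> ?P" for g
  proof (cases "g \<in> set gs")
    case False
    then obtain a b where ab: "a \<in> set gs" "b \<in> set gs" "g = a \<otimes> b" using g by auto
    then have "a \<in> carrier G" "b \<in> carrier G" "a [^] d = \<one>" "b [^] d = \<one>"
      using gs pow by auto
    then show ?thesis
      using pow_mult_distrib [OF comm [OF ab(1,2)]] ab(3) by simp
  qed (use pow in blast)
  note pow2 = this
  have sub: "g \<in> ?P" if "g \<in> set (nerve_face G (Suc n) i gs)" for g
    using set_nerve_face [OF gs(1) assms(2), of G] that by (rule subsetD)
  show ?thesis
    unfolding N_comm_simps mem_Collect_eq
  proof (intro conjI ballI subsetI)
    show "length (nerve_face G (Suc n) i gs) = n"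
      using length_nerve_face gs(1) assms(2) .
  qed (simp_all only: closed [OF sub] pow2 [OF sub] comm2 [OF sub sub])
qed

lemma N_comm_degen:
  assumes "gs \<in> cells (N_comm d G) n" "j \<le> n"
  shows "nerve_degen G n j gs \<in> cells (N_comm d G) (Suc n)"
proof -
  have "set (nerve_degen G n j gs) = insert \<one> (set gs)"
    using set_append [of "take j gs" "drop j gs"] by (auto simp: nerve_degen_def)
  moreover have "length (nerve_degen G n j gs) = Suc n"
    using assms by (simp add: nerve_degen_def N_comm_simps)
  ultimately show ?thesis using assms by (auto simp: N_comm_simps)
qed

lemma map_q_face:
  "set gs \<subseteq> carrier G \<Longrightarrow> length gs = n \<Longrightarrow> i \<le> n \<Longrightarrow>
    map q (nerve_face G n i gs) = nerve_face Gbar n i (map q gs)"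
  by (rule map_nerve_face) (auto simp: q_mult subset_iff simp del: mult_FactGroup)

lemma map_q_degen: "map q (nerve_degen G n j gs) = nerve_degen Gbar n j (map q gs)"
  by (rule map_nerve_degen) (rule q_one)

lemma Nbar_face:
  assumes "ys \<in> cells Nbar (Suc n)" "i \<le> Suc n"
  shows "nerve_face Gbar (Suc n) i ys \<in> cells Nbar n"
proof -
  obtain gs where gs: "gs \<in> cells (N_comm d G) (Suc n)" "ys = map q gs"
    using assms(1) by (auto simp: N_bar_simps)
  then have "nerve_face Gbar (Suc n) i ys = map q (nerve_face G (Suc n) i gs)"
    using map_q_face [of gs "Suc n" i] assms(2) by (auto simp: N_comm_simps)
  then show ?thesis using N_comm_face [OF gs(1) assms(2)] by (simp add: N_bar_simps)
qed

lemma Nbar_degen: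
  assumes "ys \<in> cells Nbar n" "j \<le> n"
  shows "nerve_degen Gbar n j ys \<in> cells Nbar (Suc n)"
  using assms N_comm_degen by (auto simp: N_bar_simps simp flip: map_q_degen)

lemma Nbar_subset_carrier: "ys \<in> cells Nbar n \<Longrightarrow> set ys \<subseteq> carrier Gbar"
  by (fastforce simp: N_bar_simps N_comm_simps carrier_Gbar)

lemma Nbar_length: "ys \<in> cells Nbar n \<Longrightarrow> length ys = n"
  by (auto simp: N_bar_simps N_comm_simps)

sublocale Nbar: triangles_closed Nbar d
proof
  show "face Nbar 2 i \<sigma> \<in> cells Nbar 1" if "\<sigma> \<in> cells Nbar 2" "i \<le> 2" for \<sigma> i
    using Nbar_face [of \<sigma> 1 i] that by (simp add: N_bar_simps)
qed (use d_gt_1 in simp)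

section \<open>Twisting solutions by cochains\<close>

text \<open>Multiplying a solution by powers of \<open>J\<close> changes the cocycle by a coboundary.  This one
  computation gives both the action of 1-cocycles on solutions and the comparison of cocycles whose
  solutions have the same image in the quotient.\<close>

lemma Sol_X_twist_iff:
  assumes "triangles_closed X d" and T: "T \<in> Sol_X d X \<gamma> G J"
  shows "(\<lambda>x\<in>cells X 1. J [^] (h x :: int) \<otimes> T x) \<in> Sol_X d X \<gamma>' G J \<longleftrightarrow>
    (\<forall>\<sigma>\<in>cells X 2. (h (face X 2 0 \<sigma>) - h (face X 2 1 \<sigma>) + h (face X 2 2 \<sigma>) + \<gamma>' \<sigma>) mod int d
      = \<gamma> \<sigma> mod int d)"
proof -
  interpret X: triangles_closed X d by fact
  let ?T' = "\<lambda>x\<in>cells X 1. J [^] h x \<otimes> T x"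
  have closed: "T x \<in> carrier G" and pow: "T x [^] d = \<one>" if "x \<in> cells X 1" for x
    using T that by (auto simp: Sol_X_iff X.face_triangle)
  have row: "?T' (face X 2 2 \<sigma>) \<otimes> ?T' (face X 2 0 \<sigma>) = J [^] (- \<gamma>' \<sigma>) \<otimes> ?T' (face X 2 1 \<sigma>) \<longleftrightarrow>
      (h (face X 2 0 \<sigma>) - h (face X 2 1 \<sigma>) + h (face X 2 2 \<sigma>) + \<gamma>' \<sigma>) mod int d = \<gamma> \<sigma> mod int d"
    (is "?L = ?R \<longleftrightarrow> _")
    and comm: "?T' (face X 2 i \<sigma>) \<otimes> ?T' (face X 2 j \<sigma>) = ?T' (face X 2 j \<sigma>) \<otimes> ?T' (face X 2 i \<sigma>)"
    if \<sigma>: "\<sigma> \<in> cells X 2" "i \<le> 2" "j \<le> 2" for \<sigma> i j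
  proof -
    note faces = X.face_triangle [OF \<sigma>(1)]
    note tri = Sol_X_triangle [OF X.face_triangle T \<sigma>(1)]
    show "?T' (face X 2 i \<sigma>) \<otimes> ?T' (face X 2 j \<sigma>) = ?T' (face X 2 j \<sigma>) \<otimes> ?T' (face X 2 i \<sigma>)"
      using tri(1) [of i j] faces \<sigma> by (simp add: J_pow_mult_mult closed add.commute)
    define k0 k1 k2 where "k0 = h (face X 2 0 \<sigma>)" and "k1 = h (face X 2 1 \<sigma>)"
      and "k2 = h (face X 2 2 \<sigma>)"
    have g1: "T (face X 2 1 \<sigma>) \<in> carrier G" using faces closed by simp
    have "?L = J [^] (k2 + k0) \<otimes> (T (face X 2 2 \<sigma>) \<otimes> T (face X 2 0 \<sigma>))"
      using faces by (simp add: J_pow_mult_mult closed k0_def k2_def)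
    also have "\<dots> = J [^] (k2 + k0 - \<gamma> \<sigma>) \<otimes> T (face X 2 1 \<sigma>)"
      using g1 by (simp add: tri(2) J_pow_add)
    finally have "?L = J [^] (k2 + k0 - \<gamma> \<sigma>) \<otimes> T (face X 2 1 \<sigma>)" .
    moreover have "?R = J [^] (- \<gamma>' \<sigma> + k1) \<otimes> T (face X 2 1 \<sigma>)"
      using faces g1 by (simp add: J_pow_add k1_def)
    ultimately have "?L = ?R \<longleftrightarrow> (k2 + k0 - \<gamma> \<sigma>) mod int d = (- \<gamma>' \<sigma> + k1) mod int d"
      using g1 by (simp add: J_pow_eq_iff)
    also have "\<dots> \<longleftrightarrow> (k0 - k1 + k2 + \<gamma>' \<sigma>) mod int d = \<gamma> \<sigma> mod int d"
      unfolding mod_eq_dvd_iff by (simp add: algebra_simps)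
    finally show "?L = ?R \<longleftrightarrow> (h (face X 2 0 \<sigma>) - h (face X 2 1 \<sigma>) + h (face X 2 2 \<sigma>) + \<gamma>' \<sigma>) mod int d
        = \<gamma> \<sigma> mod int d"
      by (simp add: k0_def k1_def k2_def)
  qed
  have "?T' \<in> cells X 1 \<rightarrow>\<^sub>E carrier G" "\<forall>x\<in>cells X 1. ?T' x [^] d = \<one>"
    using closed pow by (auto simp: J_pow_mult_pow_d)
  then show ?thesis
    using row [of _ 0 0] comm by (subst Sol_X_iff; blast intro: X.face_triangle)
qed

lemma Sol_X_same_image:
  assumes X: "triangles_closed X d"
    and T: "T \<in> Sol_X d X \<gamma> G J" and T': "T' \<in> Sol_X d X \<gamma>' G J"
    and "\<And>x. x \<in> cells X 1 \<Longrightarrow> q (T x) = q (T' x)"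
  obtains h where "h \<in> carrier (cochain_group d X 1)" "T' = (\<lambda>x\<in>cells X 1. J [^] h x \<otimes> T x)"
proof -
  interpret X: triangles_closed X d by fact
  have "\<forall>x\<in>cells X 1. \<exists>k\<in>{0..<int d}. T' x = J [^] k \<otimes> T x"
  proof
    fix x assume x: "x \<in> cells X 1"
    then have "T x \<in> carrier G" "T' x \<in> carrier G"
      using T T' by (auto simp: Sol_X_iff X.face_triangle)
    then show "\<exists>k\<in>{0..<int d}. T' x = J [^] k \<otimes> T x"
      using q_eqE [of "T x" "T' x"] assms(4) [OF x] by metis
  qed
  then obtain h where h: "\<forall>x\<in>cells X 1. h x \<in> {0..<int d} \<and> T' x = J [^] h x \<otimes> T x"
    by metis
  have "T' \<in> extensional (cells X 1)"
    using T' by (auto simp: Sol_X_iff X.face_triangle PiE_def)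
  then have "T' = (\<lambda>x\<in>cells X 1. J [^] (\<lambda>x\<in>cells X 1. h x) x \<otimes> T x)"
    using h by (intro extensionalityI [where A = "cells X 1"]) auto
  moreover have "(\<lambda>x\<in>cells X 1. h x) \<in> carrier (cochain_group d X 1)"
    using h d_gt_1 by (simp add: carrier_cochain_group)
  ultimately show ?thesis using that by blast
qed

lemma H2_class_eq_if_same_image:
  assumes X: "triangles_closed X d"
    and T: "T \<in> Sol_X d X \<gamma> G J" and T': "T' \<in> Sol_X d X \<gamma>' G J"
    and "\<And>x. x \<in> cells X 1 \<Longrightarrow> q (T x) = q (T' x)"
    and \<gamma>: "\<gamma> \<in> carrier (cochain_group d X 2)" and \<gamma>': "\<gamma>' \<in> carrier (cochain_group d X 2)"
  shows "H2_class d X \<gamma> = H2_class d X \<gamma>'"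
proof -
  interpret X: triangles_closed X d by fact
  obtain h where h: "h \<in> carrier (cochain_group d X 1)" "T' = (\<lambda>x\<in>cells X 1. J [^] h x \<otimes> T x)"
    using Sol_X_same_image [OF assms(1-4)] .
  have "\<gamma> \<sigma> mod int d = \<gamma> \<sigma>" if "\<sigma> \<in> cells X 2" for \<sigma>
    using PiE_mem [OF \<gamma> [unfolded carrier_cochain_group [OF X.modulus_pos]] that] by simp
  moreover have "\<forall>\<sigma>\<in>cells X 2. (h (face X 2 0 \<sigma>) - h (face X 2 1 \<sigma>) + h (face X 2 2 \<sigma>) + \<gamma>' \<sigma>) mod int d
      = \<gamma> \<sigma> mod int d"
    using T' unfolding h(2) Sol_X_twist_iff [OF X T] .
  ultimately have "\<gamma> \<in> H2_class d X \<gamma>'"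
    unfolding X.H2_class_iff [OF \<gamma>] using h(1) by (intro bexI [of _ h]) simp_all
  then show ?thesis using X.H2_class_eq_iff \<gamma> \<gamma>' by blast
qed

section \<open>The universal solution\<close>

lemma N_comm_1: "cells (N_comm d G) 1 = {[g] | g. g \<in> carrier G \<and> g [^] d = \<one>}"
  by (auto simp: N_comm_simps length_Suc_conv One_nat_def)

lemma N_comm_2E:
  assumes "gs \<in> cells (N_comm d G) 2"
  obtains g h where "gs = [g, h]" "g \<in> carrier G" "h \<in> carrier G" "g \<otimes> h = h \<otimes> g"
proof -
  obtain g h where "gs = [g, h]"
    using assms by (auto simp: N_comm_simps length_Suc_conv numeral_2_eq_2)
  then have "gs = [g, h]" "g \<in> set gs" "h \<in> set gs" by simp_all
  then show ?thesis using that assms unfolding N_comm_simps by blast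
qed

lemma simplicial_map_face:
  assumes "simplicial_map X Y f" "x \<in> cells X (Suc n)" "i \<le> Suc n"
  shows "f n (face X (Suc n) i x) = face Y (Suc n) i (f (Suc n) x)"
  using assms by (simp add: simplicial_map_def)

lemma simplicial_map_cells:
  "simplicial_map X Y f \<Longrightarrow> x \<in> cells X n \<Longrightarrow> f n x \<in> cells Y n"
  unfolding simplicial_map_def by blast

lemma simplicial_map_triangle:
  assumes "simplicial_map X Y f" "\<sigma> \<in> cells X 2" "i \<le> 2"
  shows "f 1 (face X 2 i \<sigma>) = face Y 2 i (f 2 \<sigma>)"
  using simplicial_map_face [OF assms(1), of \<sigma> 1 i] assms(2,3) by simp

text \<open>A trivialisation \<open>\<phi>\<close> of the bundle over \<open>\<bar>N\<close> as a twisted product has the section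
  \<open>y \<mapsto> \<phi>(0, y)\<close> in degree 1.  The twisted face of \<open>\<phi>((0, 0), \<sigma>)\<close> shows that this section solves the
  linear system of \<open>\<bar>N\<close> itself.\<close>

lemma bundle_iso_solution:
  assumes \<phi>: "bundle_iso d (twisted_product d Nbar c) (twisted_action d) snd
      (N_comm d G) (J_action G J) (map q) \<phi>"
  obtains S where "S \<in> Sol_X d Nbar c G J" "\<And>y. y \<in> cells Nbar 1 \<Longrightarrow> [q (S y)] = y"
proof
  let ?E = "twisted_product d Nbar c"
  define S where "S = (\<lambda>y\<in>cells Nbar 1. hd (\<phi> 1 ([0], y)))"
  have cells1: "([a], y) \<in> cells ?E 1" if "a \<in> {0..<int d}" "y \<in> cells Nbar 1" for a y
    using that by (simp add: cells_twisted_product cells_nerve_1 carrier_Zmod)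
  have \<phi>0: "\<phi> 1 ([0], y) = [S y]" "S y \<in> carrier G" "S y [^] d = \<one>" "[q (S y)] = y"
    if y: "y \<in> cells Nbar 1" for y
  proof -
    have e: "([0], y) \<in> cells ?E 1" using cells1 y d_gt_1 by simp
    then have "\<phi> 1 ([0], y) \<in> cells (N_comm d G) 1"
      using \<phi> unfolding bundle_iso_def simplicial_map_def by blast
    then obtain g where g: "\<phi> 1 ([0], y) = [g]" "g \<in> carrier G" "g [^] d = \<one>"
      unfolding N_comm_1 by auto
    moreover have "map q (\<phi> 1 ([0], y)) = y"
      using \<phi> e unfolding bundle_iso_def by (metis snd_conv)
    ultimately show "\<phi> 1 ([0], y) = [S y]" "S y \<in> carrier G" "S y [^] d = \<one>" "[q (S y)] = y"
      using y by (simp_all add: S_def)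
  qed
  have \<phi>1: "\<phi> 1 ([a], y) = [J [^] a \<otimes> S y]" if a: "a \<in> {0..<int d}" and y: "y \<in> cells Nbar 1" for a y
  proof -
    have "([0], y) \<in> cells ?E 1" "[a] \<in> cells (nerve (Zmod d)) 1"
      using cells1 y a by (auto simp: cells_nerve_1 carrier_Zmod)
    then have "\<phi> 1 (twisted_action d [a] ([0], y)) = J_action G J [a] (\<phi> 1 ([0], y))"
      using \<phi> unfolding bundle_iso_def by blast
    then show ?thesis
      using \<phi>0 [OF y] a by (simp add: twisted_action_def J_action_def)
  qed
  show "S \<in> Sol_X d Nbar c G J"
  proof (subst Sol_X_iff)
    have "(\<forall>i\<le>2. \<forall>j\<le>2. S (face Nbar 2 i \<sigma>) \<otimes> S (face Nbar 2 j \<sigma>) = S (face Nbar 2 j \<sigma>) \<otimes> S (face Nbar 2 i \<sigma>)) \<and>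
      S (face Nbar 2 2 \<sigma>) \<otimes> S (face Nbar 2 0 \<sigma>) = J [^] (- c \<sigma>) \<otimes> S (face Nbar 2 1 \<sigma>)"
      if \<sigma>: "\<sigma> \<in> cells Nbar 2" for \<sigma>
    proof -
      have e: "([0, 0], \<sigma>) \<in> cells ?E 2"
        using \<sigma> d_gt_1 by (simp add: cells_twisted_product cells_nerve_2 carrier_Zmod)
      then have "\<phi> 2 ([0, 0], \<sigma>) \<in> cells (N_comm d G) 2"
        using \<phi> unfolding bundle_iso_def simplicial_map_def by blast
      then obtain g h where gh: "\<phi> 2 ([0, 0], \<sigma>) = [g, h]" "g \<in> carrier G" "h \<in> carrier G" "g \<otimes> h = h \<otimes> g"
        by (rule N_comm_2E)
      have face: "\<phi> 1 (face ?E 2 i ([0, 0], \<sigma>)) = nerve_face G 2 i [g, h]" if "i \<le> 2" for i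
        using simplicial_map_triangle [OF _ e that, of "N_comm d G" \<phi>] \<phi> gh(1)
        by (simp add: bundle_iso_def N_comm_simps)
      note faces = Nbar.face_triangle [OF \<sigma>]
      define s0 s1 s2 where "s0 = S (face Nbar 2 0 \<sigma>)" and "s1 = S (face Nbar 2 1 \<sigma>)"
        and "s2 = S (face Nbar 2 2 \<sigma>)"
      have s0: "s0 \<in> carrier G" using \<phi>0(2) faces by (simp add: s0_def)
      have "g = s2"
        using face [of 2] \<phi>0(1) faces by (simp add: face_twisted_product_2 s2_def)
      moreover have "g \<otimes> h = s1"
        using face [of 1] \<phi>0(1) faces by (simp add: face_twisted_product_2 s1_def)
      moreover have "h = J [^] c \<sigma> \<otimes> s0"
        using face [of 0] \<phi>1 [of "c \<sigma> mod int d" "face Nbar 2 0 \<sigma>"] faces d_gt_1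
        by (simp add: face_twisted_product_2 s0_def)
      ultimately have s: "s1 = J [^] c \<sigma> \<otimes> (s2 \<otimes> s0)" "s2 \<otimes> s0 = s0 \<otimes> s2" "s2 \<in> carrier G"
        using gh s0 J_pow_mult_commute_iff [of s0 s2 "c \<sigma>"] by (auto simp: J_pow_left_commute)
      have "s2 \<otimes> (s2 \<otimes> s0) = (s2 \<otimes> s0) \<otimes> s2" "s0 \<otimes> (s2 \<otimes> s0) = (s2 \<otimes> s0) \<otimes> s0"
        using s s0 by (metis m_assoc)+
      then have "s1 \<otimes> s2 = s2 \<otimes> s1" "s1 \<otimes> s0 = s0 \<otimes> s1"
        using s s0 J_pow_mult_commute_iff [of "s2 \<otimes> s0" _ "c \<sigma>"] by simp_all
      moreover have "s2 \<otimes> s0 = J [^] (- c \<sigma>) \<otimes> s1"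
        using s s0 by (simp add: J_pow_add)
      ultimately show ?thesis
        using s(2) unfolding pairwise_commute_le_2_iff s0_def s1_def s2_def by argo
    qed
    moreover have "S \<in> cells Nbar 1 \<rightarrow>\<^sub>E carrier G"
      using \<phi>0(2) by (auto simp: S_def)
    ultimately show "S \<in> cells Nbar 1 \<rightarrow>\<^sub>E carrier G \<and> (\<forall>x\<in>cells Nbar 1. S x [^] d = \<one>) \<and>
      (\<forall>\<sigma>\<in>cells Nbar 2.
        (\<forall>i\<le>2. \<forall>j\<le>2. S (face Nbar 2 i \<sigma>) \<otimes> S (face Nbar 2 j \<sigma>) = S (face Nbar 2 j \<sigma>) \<otimes> S (face Nbar 2 i \<sigma>)) \<and>
        S (face Nbar 2 2 \<sigma>) \<otimes> S (face Nbar 2 0 \<sigma>) = J [^] (- c \<sigma>) \<otimes> S (face Nbar 2 1 \<sigma>))"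
      using \<phi>0(3) by blast
  qed (rule Nbar.face_triangle)
  show "[q (S y)] = y" if "y \<in> cells Nbar 1" for y
    using \<phi>0 that by simp
qed

lemma cocycles_subset_cochains: "c \<in> cocycles d X n \<Longrightarrow> c \<in> carrier (cochain_group d X n)"
  by (simp add: cocycles_def kernel_def)

lemma carrier_H2: "carrier (H2 d X) = H2_class d X ` cocycles d X 2"
  by (auto simp: H2_def H2_class_def FactGroup_def RCOSETS_def r_coset_def)

text \<open>Two trivialisations give two universal solutions with the same image in the quotient, hence
  cohomologous cocycles; so the class of the bundle is well defined.\<close>

lemma gamma_class_eq:
  assumes c: "c \<in> cocycles d Nbar 2" "normalized Nbar c"
    and \<phi>: "bundle_iso d (twisted_product d Nbar c) (twisted_action d) snd
      (N_comm d G) (J_action G J) (map q) \<phi>"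
  shows "gamma_class d G J = H2_class d Nbar c"
  unfolding gamma_class_def
proof (rule the_equality)
  note c' = cocycles_subset_cochains [OF c(1)]
  then have "c \<in> H2_class d Nbar c" by (rule Nbar.H2_class_self)
  moreover have "H2_class d Nbar c \<in> carrier (H2 d Nbar)"
    using c(1) carrier_H2 by blast
  ultimately show "H2_class d Nbar c \<in> carrier (H2 d Nbar) \<and>
      (\<exists>c'\<in>H2_class d Nbar c. normalized Nbar c' \<and>
        (\<exists>\<phi>. bundle_iso d (twisted_product d Nbar c') (twisted_action d) snd
          (N_comm d G) (J_action G J) (map q) \<phi>))"
    using c(2) \<phi> by blast
  fix C assume "C \<in> carrier (H2 d Nbar) \<and> (\<exists>c\<in>C. normalized Nbar c \<and>
        (\<exists>\<phi>. bundle_iso d (twisted_product d Nbar c) (twisted_action d) snd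
          (N_comm d G) (J_action G J) (map q) \<phi>))"
  then obtain b e \<psi> where b: "b \<in> cocycles d Nbar 2" "C = H2_class d Nbar b" and "e \<in> C"
    and \<psi>: "bundle_iso d (twisted_product d Nbar e) (twisted_action d) snd
          (N_comm d G) (J_action G J) (map q) \<psi>"
    unfolding carrier_H2 by blast
  note b' = cocycles_subset_cochains [OF b(1)]
  have e: "e \<in> carrier (cochain_group d Nbar 2)" "H2_class d Nbar e = C"
    using Nbar.H2_class_carrier [OF _ b'] Nbar.H2_class_eq_iff [OF _ b'] \<open>e \<in> C\<close> b(2) by blast+
  obtain S where S: "S \<in> Sol_X d Nbar c G J" "\<And>y. y \<in> cells Nbar 1 \<Longrightarrow> [q (S y)] = y"
    using bundle_iso_solution [OF \<phi>] by blast
  obtain S' where S': "S' \<in> Sol_X d Nbar e G J" "\<And>y. y \<in> cells Nbar 1 \<Longrightarrow> [q (S' y)] = y"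
    using bundle_iso_solution [OF \<psi>] by blast
  have "q (S' y) = q (S y)" if "y \<in> cells Nbar 1" for y
    using S(2) [OF that] S'(2) [OF that] by (metis list.inject)
  then show "C = H2_class d Nbar c"
    using H2_class_eq_if_same_image [OF Nbar.triangles_closed_axioms S'(1) S(1)] e c' by simp
qed

lemma pullback_cochain:
  assumes "simplicial_map X Y f" "c \<in> carrier (cochain_group d Y n)"
  shows "(\<lambda>x\<in>cells X n. c (f n x)) \<in> carrier (cochain_group d X n)"
  using assms d_gt_1 simplicial_map_cells [OF assms(1)]
  by (auto simp: carrier_cochain_group PiE_iff)

lemma H2_pullback_class:
  assumes X: "triangles_closed X d" and Y: "triangles_closed Y d" and f: "simplicial_map X Y f"
    and c: "c \<in> carrier (cochain_group d Y 2)"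
  shows "H2_pullback d X f (H2_class d Y c) = H2_class d X (\<lambda>\<sigma>\<in>cells X 2. c (f 2 \<sigma>))"
proof -
  interpret X: triangles_closed X d by fact
  interpret Y: triangles_closed Y d by fact
  let ?f = "\<lambda>c. \<lambda>\<sigma>\<in>cells X 2. c (f 2 \<sigma>)"
  have "H2_class d X (?f b) = H2_class d X (?f c)" if b: "b \<in> H2_class d Y c" for b
  proof -
    have b': "b \<in> carrier (cochain_group d Y 2)" using Y.H2_class_carrier b c by blast
    then obtain h where h: "h \<in> carrier (cochain_group d Y 1)"
      "\<forall>\<sigma>\<in>cells Y 2. b \<sigma> = (h (face Y 2 0 \<sigma>) - h (face Y 2 1 \<sigma>) + h (face Y 2 2 \<sigma>) + c \<sigma>) mod int d"
      using b Y.H2_class_iff by blast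
    have "?f b \<in> H2_class d X (?f c)"
      unfolding X.H2_class_iff [OF pullback_cochain [OF f b']]
      using h(2) simplicial_map_cells [OF f] X.face_triangle
      by (intro bexI [OF _ pullback_cochain [OF f h(1)]]) (simp add: simplicial_map_triangle [OF f])
    then show ?thesis
      using X.H2_class_eq_iff pullback_cochain f b' c by blast
  qed
  moreover have "c \<in> H2_class d Y c" using c by (rule Y.H2_class_self)
  ultimately show ?thesis unfolding H2_pullback_def by blast
qed

lemma Sol_X_pullback:
  assumes X: "triangles_closed X d" and Y: "triangles_closed Y d" and f: "simplicial_map X Y f"
    and S: "S \<in> Sol_X d Y c G J"
  shows "(\<lambda>x\<in>cells X 1. S (f 1 x)) \<in> Sol_X d X (\<lambda>\<sigma>\<in>cells X 2. c (f 2 \<sigma>)) G J"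
proof -
  interpret X: triangles_closed X d by fact
  interpret Y: triangles_closed Y d by fact
  let ?T = "\<lambda>x\<in>cells X 1. S (f 1 x)"
  have "?T (face X 2 i \<sigma>) = S (face Y 2 i (f 2 \<sigma>))" if "\<sigma> \<in> cells X 2" "i \<le> 2" for \<sigma> i
    using that X.face_triangle by (simp add: simplicial_map_triangle [OF f])
  moreover have "S y \<in> carrier G" "S y [^] d = \<one>" if "y \<in> cells Y 1" for y
    using S that by (auto simp: Sol_X_iff Y.face_triangle)
  ultimately show ?thesis
    using Sol_X_triangle [OF Y.face_triangle S] simplicial_map_cells [OF f]
    by (subst Sol_X_iff) (simp_all add: X.face_triangle)
qed

end

section \<open>Faces in a nerve\<close>

definition list_prod :: "('g, 'm) monoid_scheme \<Rightarrow> 'g list \<Rightarrow> 'g" where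
  "list_prod K ws = foldr (mult K) ws \<one>\<^bsub>K\<^esub>"

lemma list_prod_simps [simp]:
  "list_prod K [] = \<one>\<^bsub>K\<^esub>" "list_prod K (w # ws) = w \<otimes>\<^bsub>K\<^esub> list_prod K ws"
  by (simp_all add: list_prod_def)

context monoid begin

lemma list_prod_closed [simp]: "set ws \<subseteq> carrier G \<Longrightarrow> list_prod G ws \<in> carrier G"
  by (induction ws) auto

lemma list_prod_snoc_mult:
  assumes "set vs \<subseteq> carrier G" "v \<in> carrier G" "w \<in> carrier G"
  shows "list_prod G (vs @ [v \<otimes> w]) = list_prod G (vs @ [v, w])"
  using assms by (induction vs) (auto simp: m_assoc)

end

lemma nerve_face_Cons:
  "nerve_face K (Suc n) 0 (g # gs) = gs"
  "nerve_face K (Suc 0) (Suc 0) [g] = []"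
  "nerve_face K (Suc (Suc n)) (Suc 0) (g # h # gs) = (g \<otimes>\<^bsub>K\<^esub> h) # gs"
  by (simp_all add: nerve_face_def)

lemma nerve_face_Cons_Suc:
  "length gs = n \<Longrightarrow> 0 < i \<Longrightarrow> i \<le> n \<Longrightarrow>
    nerve_face K (Suc n) (Suc i) (g # gs) = g # nerve_face K n i gs"
  by (cases i) (auto simp: nerve_face_def)

lemma nerve_degen_Cons:
  "nerve_degen K n 0 gs = \<one>\<^bsub>K\<^esub> # gs"
  "nerve_degen K n (Suc j) (g # gs) = g # nerve_degen K m j gs"
  by (simp_all add: nerve_degen_def)

lemma nerve_face_last: "nerve_face K (Suc n) (Suc n) gs = butlast gs"
  by (simp add: nerve_face_def)

lemma nerve_face_middle:
  "n = Suc (Suc (length us + length zs)) \<Longrightarrow>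
    nerve_face K n (Suc (length us)) (us @ v # w # zs) = us @ (v \<otimes>\<^bsub>K\<^esub> w) # zs"
  by (simp add: nerve_face_def nth_append)

lemma fold_faces_above:
  assumes "face X = nerve_face K"
  shows "fold (\<lambda>m (k, y). (k - 1, face X k m y))
      (rev [Suc (length us)..<Suc (length (us @ rest))]) (length (us @ rest), us @ rest) = (length us, us)"
proof (induction rest rule: rev_induct)
  case (snoc r rest)
  have "[Suc (length us)..<Suc (length (us @ rest @ [r]))]
      = [Suc (length us)..<Suc (length (us @ rest))] @ [Suc (length (us @ rest))]"
    by simp
  then show ?case
    using snoc.IH nerve_face_last [of K "length (us @ rest)" "us @ rest @ [r]"] assms
    by (simp add: butlast_append)
qed simp

lemma (in monoid) fold_faces_between:
  assumes "face X = nerve_face G"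
  shows "length ws = Suc l \<Longrightarrow> set ws \<subseteq> carrier G \<Longrightarrow>
    fold (\<lambda>m (k, y). (k - 1, face X k m y))
      (rev [Suc (length us)..<length us + Suc l]) (length (us @ ws @ zs), us @ ws @ zs)
    = (length (us @ zs) + 1, us @ list_prod G ws # zs)"
proof (induction l arbitrary: ws)
  case 0
  then obtain w where "ws = [w]" by (auto simp: length_Suc_conv)
  then show ?case using 0 by simp
next
  case (Suc l)
  obtain vs v w where ws: "ws = vs @ [v, w]" "length vs = l"
    using Suc.prems(1) by (metis append.assoc append_Cons append_Nil length_append_singleton
        length_Suc_conv_rev nat.inject)
  then have closed: "set vs \<subseteq> carrier G" "v \<in> carrier G" "w \<in> carrier G"
    using Suc.prems(2) by auto
  have "nerve_face G (length (us @ ws @ zs)) (length us + Suc l) (us @ ws @ zs)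
      = us @ (vs @ [v \<otimes> w]) @ zs"
    using nerve_face_middle [of "length (us @ ws @ zs)" "us @ vs" zs G v w] ws by simp
  moreover have "[Suc (length us)..<length us + Suc (Suc l)]
      = [Suc (length us)..<length us + Suc l] @ [length us + Suc l]"
    by simp
  ultimately have "fold (\<lambda>m (k, y). (k - 1, face X k m y))
      (rev [Suc (length us)..<length us + Suc (Suc l)]) (length (us @ ws @ zs), us @ ws @ zs)
    = fold (\<lambda>m (k, y). (k - 1, face X k m y))
      (rev [Suc (length us)..<length us + Suc l])
        (length (us @ (vs @ [v \<otimes> w]) @ zs), us @ (vs @ [v \<otimes> w]) @ zs)"
    using ws assms by simp
  also have "\<dots> = (length (us @ zs) + 1, us @ list_prod G (vs @ [v \<otimes> w]) # zs)"
    using ws closed by (intro Suc.IH) auto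
  finally show ?case
    using list_prod_snoc_mult closed ws by simp
qed

text \<open>Deleting vertices of a simplex of a nerve multiplies the entries between the surviving ones.
  The triangles here are those that occur in the twisting function: their first
  vertex is \<open>0\<close> or \<open>1\<close>, and their last two vertices are adjacent.\<close>

lemma (in monoid) face_on_nerve:
  assumes X: "face X = nerve_face G" and us: "length us \<le> 1" and ws: "ws \<noteq> []" "set ws \<subseteq> carrier G"
    and i: "i = length us + length ws" and n: "n = Suc (i + length rest)"
  shows "face_on X n {length us, i, i + 1} (us @ ws @ z # rest) = [list_prod G ws, z]"
proof -
  let ?a = "length us"
  let ?step = "\<lambda>m (k, y). (k - 1, face X k m y)"
  obtain l where l: "length ws = Suc l" using ws(1) by (cases ws) auto
  have "[0..<Suc n] = [0..<?a] @ [?a] @ [Suc ?a..<i] @ [i, Suc i] @ [Suc (Suc i)..<Suc n]"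
  proof -
    have "[0..<Suc n] = [0..<?a] @ [?a..<i] @ [i..<Suc n]"
      using upt_add_eq_append [of 0 ?a "length ws"] upt_add_eq_append [of 0 i "Suc n - i"] i n by simp
    moreover have "[?a..<i] = ?a # [Suc ?a..<i]" using i l by (simp add: upt_conv_Cons)
    moreover have "[i..<Suc n] = i # Suc i # [Suc (Suc i)..<Suc n]" 
      using upt_conv_Cons [of i "Suc n"] upt_conv_Cons [of "Suc i" "Suc n"] n by (simp del: upt_Suc)
    ultimately show ?thesis by simp
  qed
  moreover have "filter (\<lambda>m. m \<notin> {?a, i, i + 1}) [0..<?a] = [0..<?a]"
    "filter (\<lambda>m. m \<notin> {?a, i, i + 1}) [Suc ?a..<i] = [Suc ?a..<i]"
    "filter (\<lambda>m. m \<notin> {?a, i, i + 1}) [Suc (Suc i)..<Suc n] = [Suc (Suc i)..<Suc n]"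
    using i l by (auto simp: filter_id_conv)
  ultimately have filter: "filter (\<lambda>m. m \<notin> {?a, i, i + 1}) [0..<Suc n]
      = [0..<?a] @ [Suc ?a..<i] @ [Suc (Suc i)..<Suc n]"
    by simp
  have "fold ?step (rev [Suc (Suc i)..<Suc n]) (n, us @ ws @ z # rest) = (Suc i, us @ ws @ [z])"
    using fold_faces_above [OF X, of "us @ ws @ [z]" rest] i n by (simp add: add.assoc del: upt_Suc)
  moreover have "fold ?step (rev [Suc ?a..<i]) (Suc i, us @ ws @ [z]) = (?a + 2, us @ [list_prod G ws, z])"
    using fold_faces_between [OF X l ws(2), of us "[z]"] i l by simp
  moreover have "snd (fold ?step (rev [0..<?a]) (?a + 2, us @ [list_prod G ws, z])) = [list_prod G ws, z]"
    using us X by (cases us) (auto simp: nerve_face_def One_nat_def)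
  ultimately show ?thesis
    unfolding face_on_def filter by simp
qed

declare mult_FactGroup [simp del] one_FactGroup [simp del]

section \<open>The bundle is a twisted product\<close>

context central_cyclic begin

sublocale Gbar: group Gbar
  by (rule group_Gbar)

text \<open>Choosing the unit as representative of its coset makes the cocycle below normalized.\<close>

definition sect :: "'a set \<Rightarrow> 'a" where
  "sect y = (if y = \<one>\<^bsub>Gbar\<^esub> then \<one> else SOME g. g \<in> carrier G \<and> q g = y)"

lemma sect:
  assumes "y \<in> carrier Gbar"
  shows sect_closed: "sect y \<in> carrier G" and q_sect: "q (sect y) = y"
proof -
  have "\<exists>g. g \<in> carrier G \<and> q g = y" using assms by (auto simp: carrier_Gbar)
  then have "(SOME g. g \<in> carrier G \<and> q g = y) \<in> carrier G \<and> q (SOME g. g \<in> carrier G \<and> q g = y) = y"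
    by (rule someI_ex)
  then show "sect y \<in> carrier G" "q (sect y) = y"
    by (auto simp: sect_def q_one)
qed

lemma sect_one: "sect \<one>\<^bsub>Gbar\<^esub> = \<one>"
  by (simp add: sect_def)

text \<open>Up to sign, the factor set of the central extension of \<open>G / \<langle>J\<rangle>\<close> by \<open>\<langle>J\<rangle>\<close> that belongs to the chosen
  representatives.\<close>

definition defect :: "'a set \<Rightarrow> 'a set \<Rightarrow> int" where
  "defect p y = (SOME k. k \<in> {0..<int d} \<and> sect (p \<otimes>\<^bsub>Gbar\<^esub> y) = J [^] k \<otimes> (sect p \<otimes> sect y))"

lemma defect:
  assumes "p \<in> carrier Gbar" "y \<in> carrier Gbar"
  shows defect_range: "defect p y \<in> {0..<int d}"
    and sect_mult: "sect (p \<otimes>\<^bsub>Gbar\<^esub> y) = J [^] defect p y \<otimes> (sect p \<otimes> sect y)"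
proof -
  have "q (sect p \<otimes> sect y) = q (sect (p \<otimes>\<^bsub>Gbar\<^esub> y))"
    using assms by (simp add: q_mult sect)
  then obtain k where "k \<in> {0..<int d}" "sect (p \<otimes>\<^bsub>Gbar\<^esub> y) = J [^] k \<otimes> (sect p \<otimes> sect y)"
    using q_eqE [of "sect p \<otimes> sect y"] assms by (metis Gbar.m_closed m_closed sect_closed)
  then have "\<exists>k. k \<in> {0..<int d} \<and> sect (p \<otimes>\<^bsub>Gbar\<^esub> y) = J [^] k \<otimes> (sect p \<otimes> sect y)" by blast
  from someI_ex [OF this] show "defect p y \<in> {0..<int d}"
    "sect (p \<otimes>\<^bsub>Gbar\<^esub> y) = J [^] defect p y \<otimes> (sect p \<otimes> sect y)"
    unfolding defect_def by auto
qed

lemma defect_unique: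
  assumes "p \<in> carrier Gbar" "y \<in> carrier Gbar" "sect (p \<otimes>\<^bsub>Gbar\<^esub> y) = J [^] k \<otimes> (sect p \<otimes> sect y)"
  shows "defect p y = k mod int d"
proof -
  have "J [^] defect p y = J [^] k"
    using assms sect_mult [OF assms(1,2)] by (simp add: sect_closed)
  then show ?thesis using defect_range [OF assms(1,2)] by (simp add: J_pow_eq_iff)
qed

lemma defect_one:
  assumes "y \<in> carrier Gbar"
  shows "defect \<one>\<^bsub>Gbar\<^esub> y = 0" "defect y \<one>\<^bsub>Gbar\<^esub> = 0"
  using defect_unique [of "\<one>\<^bsub>Gbar\<^esub>" y 0] defect_unique [of y "\<one>\<^bsub>Gbar\<^esub>" 0] assms
  by (simp_all add: sect_closed sect_one)

lemma defect_cocycle: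
  assumes "x \<in> carrier Gbar" "y \<in> carrier Gbar" "z \<in> carrier Gbar"
  shows "(defect y z - defect (x \<otimes>\<^bsub>Gbar\<^esub> y) z + defect x (y \<otimes>\<^bsub>Gbar\<^esub> z) - defect x y) mod int d = 0"
proof -
  let ?s = "sect x \<otimes> (sect y \<otimes> sect z)"
  have "sect (x \<otimes>\<^bsub>Gbar\<^esub> y \<otimes>\<^bsub>Gbar\<^esub> z) = J [^] (defect (x \<otimes>\<^bsub>Gbar\<^esub> y) z + defect x y) \<otimes> ?s"
    using assms by (simp add: sect_mult sect_closed m_assoc J_pow_add)
  moreover have "sect (x \<otimes>\<^bsub>Gbar\<^esub> (y \<otimes>\<^bsub>Gbar\<^esub> z)) = J [^] (defect x (y \<otimes>\<^bsub>Gbar\<^esub> z) + defect y z) \<otimes> ?s"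
    using assms by (simp add: sect_mult sect_closed J_pow_left_commute [of "sect x"] J_pow_add)
  ultimately have "J [^] (defect x (y \<otimes>\<^bsub>Gbar\<^esub> z) + defect y z) = J [^] (defect (x \<otimes>\<^bsub>Gbar\<^esub> y) z + defect x y)"
    using assms by (simp add: Gbar.m_assoc sect_closed)
  then have "int d dvd defect x (y \<otimes>\<^bsub>Gbar\<^esub> z) + defect y z - (defect (x \<otimes>\<^bsub>Gbar\<^esub> y) z + defect x y)"
    unfolding J_pow_eq_iff mod_eq_dvd_iff .
  then show ?thesis by (simp add: algebra_simps mod_eq_0_iff_dvd)
qed

definition bar_cocycle :: "'a set list \<Rightarrow> int" where
  "bar_cocycle = (\<lambda>\<omega>\<in>cells Nbar 2. defect (\<omega> ! 0) (\<omega> ! 1))"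

lemma normalized_bar_cocycle: "normalized Nbar bar_cocycle"
  unfolding normalized_def
proof
  fix ys assume ys: "ys \<in> cells Nbar 1"
  obtain y where "ys = [y]"
    using Nbar_length [OF ys] by (auto simp: length_Suc_conv One_nat_def)
  then have y: "ys = [y]" "y \<in> carrier Gbar"
    using Nbar_subset_carrier [OF ys] by auto
  have "nerve_degen Gbar 1 0 ys \<in> cells Nbar 2" "nerve_degen Gbar 1 1 ys \<in> cells Nbar 2"
    using Nbar_degen [OF ys, of 0] Nbar_degen [OF ys, of 1] by simp_all
  then show "bar_cocycle (degen Nbar 1 0 ys) = 0 \<and> bar_cocycle (degen Nbar 1 1 ys) = 0"
    using y by (simp add: bar_cocycle_def N_bar_simps) (simp add: nerve_degen_def defect_one)
qed

lemma bar_cocycle_in_cocycles: "bar_cocycle \<in> cocycles d Nbar 2"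
proof -
  have "bar_cocycle \<in> carrier (cochain_group d Nbar 2)"
  proof -
    have "defect (\<omega> ! 0) (\<omega> ! 1) \<in> {0..<int d}" if "\<omega> \<in> cells Nbar 2" for \<omega>
      using Nbar_length [OF that] Nbar_subset_carrier [OF that] by (intro defect_range) auto
    then show ?thesis
      using d_gt_1 by (auto simp: bar_cocycle_def carrier_cochain_group)
  qed
  moreover have "coboundary d Nbar 2 bar_cocycle = \<one>\<^bsub>cochain_group d Nbar (Suc 2)\<^esub>"
    unfolding coboundary_def cochain_group_def one_product_group one_integer_mod_group
  proof (rule restrict_ext)
    fix \<omega> assume \<omega>: "\<omega> \<in> cells Nbar (Suc 2)"
    then obtain x y z where xyz: "\<omega> = [x, y, z]" "x \<in> carrier Gbar" "y \<in> carrier Gbar" "z \<in> carrier Gbar"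
      using Nbar_length [OF \<omega>] Nbar_subset_carrier [OF \<omega>] by (auto simp: length_Suc_conv numeral_2_eq_2)
    have val: "bar_cocycle (face Nbar (Suc 2) i \<omega>)
        = defect (nerve_face Gbar 3 i \<omega> ! 0) (nerve_face Gbar 3 i \<omega> ! 1)" if "i \<le> 3" for i
      using Nbar_face [OF \<omega>, of i] that by (simp add: bar_cocycle_def N_bar_simps)
    have "(\<Sum>i\<le>Suc 2. (- 1) ^ i * bar_cocycle (face Nbar (Suc 2) i \<omega>)) =
      defect y z - defect (x \<otimes>\<^bsub>Gbar\<^esub> y) z + defect x (y \<otimes>\<^bsub>Gbar\<^esub> z) - defect x y"
    proof -
      have "(\<Sum>i\<le>Suc 2. g i) = g 0 + g 1 + g 2 + g 3" for g :: "nat \<Rightarrow> int"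
        by (simp add: eval_nat_numeral One_nat_def)
      then show ?thesis
        using val [of 0] val [of 1] val [of 2] val [of 3] by (simp add: xyz nerve_face_def)
    qed
    then show "(\<Sum>i\<le>Suc 2. (- 1) ^ i * bar_cocycle (face Nbar (Suc 2) i \<omega>)) mod int d = 0"
      using defect_cocycle xyz by simp
  qed
  ultimately show ?thesis by (simp add: cocycles_def kernel_def)
qed

text \<open>The lift of a simplex of \<open>\<bar>N\<close>, where \<open>p\<close> is the product of the edges that precede it: it uses the chosen
  representatives of the edges that leave the initial vertex, so that its faces away from that vertex
  agree with the lifts of the faces.\<close>

primrec star_lift :: "'a set \<Rightarrow> 'a set list \<Rightarrow> 'a list" where
  "star_lift p [] = []"
| "star_lift p (y # ys) = (inv (sect p) \<otimes> sect (p \<otimes>\<^bsub>Gbar\<^esub> y)) # star_lift (p \<otimes>\<^bsub>Gbar\<^esub> y) ys"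

lemma length_star_lift [simp]: "length (star_lift p ys) = length ys"
  by (induction ys arbitrary: p) auto

lemma star_lift_closed:
  "p \<in> carrier Gbar \<Longrightarrow> set ys \<subseteq> carrier Gbar \<Longrightarrow> set (star_lift p ys) \<subseteq> carrier G"
  by (induction ys arbitrary: p) (auto simp: sect_closed)

text \<open>This form of an entry of the lift shows its dependence on the initial vertex: it is a
  representative of \<open>y\<close> that is fixed once for all, corrected by a value of the cocycle.\<close>

lemma star_lift_head:
  assumes "p \<in> carrier Gbar" "y \<in> carrier Gbar"
  shows "inv (sect p) \<otimes> sect (p \<otimes>\<^bsub>Gbar\<^esub> y) = J [^] defect p y \<otimes> sect y"
proof -
  have "inv (sect p) \<otimes> sect (p \<otimes>\<^bsub>Gbar\<^esub> y) = J [^] defect p y \<otimes> (inv (sect p) \<otimes> (sect p \<otimes> sect y))"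
    using assms by (simp add: sect_mult sect_closed J_pow_left_commute [of "inv (sect p)"])
  then show ?thesis
    using assms by (simp add: sect_closed flip: m_assoc)
qed

lemma map_q_star_lift:
  "p \<in> carrier Gbar \<Longrightarrow> set ys \<subseteq> carrier Gbar \<Longrightarrow> map q (star_lift p ys) = ys"
  by (induction ys arbitrary: p) (simp_all add: star_lift_head sect)

lemma star_lift_nth:
  "p \<in> carrier Gbar \<Longrightarrow> set ys \<subseteq> carrier Gbar \<Longrightarrow> i < length ys \<Longrightarrow>
    star_lift p ys ! i
      = J [^] defect (p \<otimes>\<^bsub>Gbar\<^esub> list_prod Gbar (take i ys)) (ys ! i) \<otimes> sect (ys ! i)"
proof (induction ys arbitrary: p i)
  case (Cons y ys)
  show ?case
  proof (cases i)
    case 0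
    then show ?thesis using Cons.prems by (simp add: star_lift_head)
  next
    case (Suc j)
    have "set (take j ys) \<subseteq> carrier Gbar"
      using Cons.prems(2) set_take_subset [of j ys] by auto
    then show ?thesis
      using Cons.prems Cons.IH [of "p \<otimes>\<^bsub>Gbar\<^esub> y" j] Suc by (simp add: Gbar.m_assoc)
  qed
qed simp

lemma J_action_simps [simp]:
  "J_action G J [] gs = []" "J_action G J (a # as) (g # gs) = (J [^] a \<otimes> g) # J_action G J as gs"
  by (simp_all add: J_action_def)

lemma length_J_action: "length (J_action G J as gs) = min (length as) (length gs)"
  by (simp add: J_action_def)

lemma J_action_closed:
  "set gs \<subseteq> carrier G \<Longrightarrow> set (J_action G J as gs) \<subseteq> carrier G"
  by (auto simp: J_action_def dest!: set_zip_rightD)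

lemma map_q_J_action:
  "length as = length gs \<Longrightarrow> set gs \<subseteq> carrier G \<Longrightarrow> map q (J_action G J as gs) = map q gs"
  by (induction as gs rule: list_induct2) auto

lemma J_action_mult:
  "length bs = length as \<Longrightarrow> length as = length gs \<Longrightarrow> set gs \<subseteq> carrier G \<Longrightarrow>
    J_action G J (map2 (mult (Zmod d)) bs as) gs = J_action G J bs (J_action G J as gs)"
  by (induction bs as gs rule: list_induct3) (auto simp: J_pow_add)

lemma J_action_inject:
  "length as = length gs \<Longrightarrow> length bs = length gs \<Longrightarrow> set gs \<subseteq> carrier G \<Longrightarrow>
    set as \<subseteq> {0..<int d} \<Longrightarrow> set bs \<subseteq> {0..<int d} \<Longrightarrow>
    J_action G J as gs = J_action G J bs gs \<Longrightarrow> as = bs"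
proof (induction as gs arbitrary: bs rule: list_induct2)
  case (Cons a as g gs)
  obtain b bs' where bs: "bs = b # bs'" using Cons.prems(1) by (cases bs) simp_all
  have "J [^] a = J [^] b"
    using Cons.prems(2,5) bs by simp
  then have "a = b"
    using Cons.prems(3,4) bs by (simp add: J_pow_eq_iff)
  moreover have "as = bs'"
    using Cons.prems bs by (intro Cons.IH) simp_all
  ultimately show ?case using bs by simp
qed simp

lemma J_action_transitive:
  "length gs = length hs \<Longrightarrow> set gs \<subseteq> carrier G \<Longrightarrow> set hs \<subseteq> carrier G \<Longrightarrow> map q gs = map q hs \<Longrightarrow>
    \<exists>as. length as = length gs \<and> set as \<subseteq> {0..<int d} \<and> J_action G J as gs = hs"
proof (induction gs hs rule: list_induct2)
  case (Cons g gs h hs)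
  then obtain as where as: "length as = length gs" "set as \<subseteq> {0..<int d}" "J_action G J as gs = hs"
    by auto
  obtain k where "k \<in> {0..<int d}" "h = J [^] k \<otimes> g"
    using q_eqE [of g h] Cons.prems by auto
  then show ?case using as by (intro exI [of _ "k # as"]) auto
qed simp

text \<open>Two consecutive entries telescope, so merging them is the same as skipping the vertex between
  them.  This fails only for the initial vertex.\<close>

lemma star_lift_face:
  assumes "length \<alpha> = length ys" "length ys = n" "0 < i" "i \<le> n"
    and "set ys \<subseteq> carrier Gbar" "p \<in> carrier Gbar"
  shows "J_action G J (nerve_face (Zmod d) n i \<alpha>) (star_lift p (nerve_face Gbar n i ys))
    = nerve_face G n i (J_action G J \<alpha> (star_lift p ys))"
  using assms
proof (induction \<alpha> ys arbitrary: n i p rule: list_induct2)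
  case (Cons a \<alpha> y ys)
  obtain m where m: "n = Suc m" "length ys = m" using Cons.prems(1) by auto
  consider (last) "i = Suc 0" "ys = []" | (first) "i = Suc 0" "ys \<noteq> []" | (later) k where "i = Suc k" "0 < k"
    using Cons.prems(2) by (cases i) auto
  then show ?case
  proof cases
    case last
    then show ?thesis using m Cons.hyps by (simp add: nerve_face_Cons)
  next
    case first
    then obtain z zs b \<beta> where zs: "ys = z # zs" "\<alpha> = b # \<beta>"
      using Cons.hyps by (metis length_0_conv neq_Nil_conv)
    have c: "sect p \<in> carrier G" "sect (p \<otimes>\<^bsub>Gbar\<^esub> y) \<in> carrier G"
      "sect (p \<otimes>\<^bsub>Gbar\<^esub> y \<otimes>\<^bsub>Gbar\<^esub> z) \<in> carrier G"
      using Cons.prems zs by (auto intro!: sect_closed)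
    have "(inv (sect p) \<otimes> sect (p \<otimes>\<^bsub>Gbar\<^esub> y)) \<otimes> (inv (sect (p \<otimes>\<^bsub>Gbar\<^esub> y)) \<otimes> sect (p \<otimes>\<^bsub>Gbar\<^esub> y \<otimes>\<^bsub>Gbar\<^esub> z))
        = inv (sect p) \<otimes> sect (p \<otimes>\<^bsub>Gbar\<^esub> y \<otimes>\<^bsub>Gbar\<^esub> z)"
    proof -
      have "sect (p \<otimes>\<^bsub>Gbar\<^esub> y) \<otimes> (inv (sect (p \<otimes>\<^bsub>Gbar\<^esub> y)) \<otimes> sect (p \<otimes>\<^bsub>Gbar\<^esub> y \<otimes>\<^bsub>Gbar\<^esub> z))
          = sect (p \<otimes>\<^bsub>Gbar\<^esub> y \<otimes>\<^bsub>Gbar\<^esub> z)"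
        using c by (simp flip: m_assoc)
      then show ?thesis using c by (simp add: m_assoc)
    qed
    then show ?thesis
      using m zs first Cons.prems c
      by (auto simp: nerve_face_Cons J_pow_mult_mult Gbar.m_assoc)
  next
    case later
    then show ?thesis
      using m Cons by (simp add: nerve_face_Cons_Suc length_J_action)
  qed
qed simp

lemma star_lift_degen:
  assumes "length \<alpha> = length ys" "j \<le> length ys"
    and "set ys \<subseteq> carrier Gbar" "p \<in> carrier Gbar"
  shows "J_action G J (nerve_degen (Zmod d) n j \<alpha>) (star_lift p (nerve_degen Gbar n j ys))
    = nerve_degen G n j (J_action G J \<alpha> (star_lift p ys))"
  using assms
proof (induction \<alpha> ys arbitrary: n j p rule: list_induct2)
  case Nil
  then show ?case by (simp add: nerve_degen_Cons sect_closed)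
next
  case (Cons a \<alpha> y ys)
  show ?case
  proof (cases j)
    case 0
    then show ?thesis using Cons.prems by (simp add: nerve_degen_Cons sect_closed)
  next
    case (Suc k)
    then show ?thesis using Cons by (simp add: nerve_degen_Cons(2) [where m = n])
  qed
qed

lemma list_prod_pair_in_N_comm:
  assumes gs: "gs \<in> cells (N_comm d G) n" and ws: "set ws \<subseteq> set gs" and z: "z \<in> set gs"
  shows "[list_prod G ws, z] \<in> cells (N_comm d G) 2"
proof -
  have gs': "set gs \<subseteq> carrier G" and comm: "\<And>g h. g \<in> set gs \<Longrightarrow> h \<in> set gs \<Longrightarrow> g \<otimes> h = h \<otimes> g"
    and pow: "\<And>g. g \<in> set gs \<Longrightarrow> g [^] d = \<one>"
    using gs by (auto simp: N_comm_simps)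
  have "list_prod G ws \<in> carrier G \<and> list_prod G ws [^] d = \<one> \<and>
      (\<forall>g\<in>set gs. g \<otimes> list_prod G ws = list_prod G ws \<otimes> g)"
    using ws
  proof (induction ws)
    case Nil
    then show ?case using gs' by auto
  next
    case (Cons w ws)
    then have IH: "list_prod G ws \<in> carrier G" "list_prod G ws [^] d = \<one>"
      "\<And>g. g \<in> set gs \<Longrightarrow> g \<otimes> list_prod G ws = list_prod G ws \<otimes> g" and w: "w \<in> set gs"
      by auto
    have w': "w \<in> carrier G" using w gs' by auto
    have "(w \<otimes> list_prod G ws) [^] d = \<one>"
      using pow_mult_distrib [OF IH(3) [OF w] w' IH(1)] IH(2) pow [OF w] by simp
    moreover have "g \<otimes> (w \<otimes> list_prod G ws) = (w \<otimes> list_prod G ws) \<otimes> g" if "g \<in> set gs" for g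
    proof -
      have g: "g \<in> carrier G" using that gs' by auto
      have "g \<otimes> (w \<otimes> list_prod G ws) = w \<otimes> (g \<otimes> list_prod G ws)"
        using comm [OF that w] g w' IH(1) by (rule left_commute_if_commute)
      also have "\<dots> = w \<otimes> (list_prod G ws \<otimes> g)" using IH(3) [OF that] by simp
      finally show ?thesis using g w' IH(1) by (simp add: m_assoc)
    qed
    ultimately show ?case using IH(1) w' by simp
  qed
  moreover have "z \<in> carrier G" "z [^] d = \<one>" using z gs' pow by auto
  ultimately show ?thesis using z by (simp add: N_comm_simps)
qed

lemma map_q_list_prod:
  "set ws \<subseteq> carrier G \<Longrightarrow> q (list_prod G ws) = list_prod Gbar (map q ws)"
  by (induction ws) (auto simp: q_one q_mult)

lemma bar_cocycle_pair:
  assumes \<omega>: "\<omega> \<in> cells Nbar n" and "set ws \<subseteq> set \<omega>" "z \<in> set \<omega>"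
  shows "bar_cocycle [list_prod Gbar ws, z] = defect (list_prod Gbar ws) z"
proof -
  obtain gs where gs: "gs \<in> cells (N_comm d G) n" "\<omega> = map q gs"
    using \<omega> by (auto simp: N_bar_simps)
  obtain vs where vs: "ws = map q vs" "set vs \<subseteq> set gs"
  proof -
    have "\<forall>w\<in>set ws. \<exists>g\<in>set gs. w = q g" using assms(2) gs(2) by auto
    then obtain f where "\<forall>w\<in>set ws. f w \<in> set gs \<and> w = q (f w)" by metis
    then show ?thesis by (intro that [of "map f ws"]) (auto simp: map_idI)
  qed
  obtain g where g: "z = q g" "g \<in> set gs" using assms(3) gs(2) by auto
  have "map q [list_prod G vs, g] = [list_prod Gbar ws, z]"
    using vs g N_comm_subset_carrier [OF gs(1)] by (simp add: map_q_list_prod)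
  then have "[list_prod Gbar ws, z] \<in> cells Nbar 2"
    using list_prod_pair_in_N_comm [OF gs(1) vs(2) g(2)] unfolding N_bar_simps by (metis imageI)
  then show ?thesis by (simp add: bar_cocycle_def)
qed

text \<open>The \<open>j\<close>-th entry of the twisting function compares the values of the cocycle on the triangles that
  join the edge from \<open>j + 1\<close> to \<open>j + 2\<close> with the vertices \<open>0\<close> and \<open>1\<close>.  For \<open>j = 0\<close> the second triangle is degenerate,
  which accounts for the separate first entry in the definition of \<open>twist\<close>.\<close>

lemma twist_bar_cocycle:
  assumes \<omega>: "y # ys \<in> cells Nbar (Suc m)" and j: "j < m"
  shows "twist d Nbar bar_cocycle (Suc m) (y # ys) ! j =
    (defect (y \<otimes>\<^bsub>Gbar\<^esub> list_prod Gbar (take j ys)) (ys ! j)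
      - defect (list_prod Gbar (take j ys)) (ys ! j)) mod int d"
proof -
  have len: "length ys = m" using Nbar_length [OF \<omega>] by simp
  have closed: "y \<in> carrier Gbar" "set ys \<subseteq> carrier Gbar" using Nbar_subset_carrier [OF \<omega>] by auto
  have sub: "set (take j ys) \<subseteq> set ys" by (rule set_take_subset)
  have ys: "ys = take j ys @ ys ! j # drop (Suc j) ys"
    using j len by (simp add: id_take_nth_drop)
  have face0: "bar_cocycle (face_on Nbar (Suc m) {0, Suc j, Suc j + 1} (y # ys))
      = defect (y \<otimes>\<^bsub>Gbar\<^esub> list_prod Gbar (take j ys)) (ys ! j)"
  proof -
    have "face_on Nbar (Suc m) {length ([] :: 'a set list), Suc j, Suc j + 1} ([] @ (y # take j ys) @ ys ! j # drop (Suc j) ys)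
        = [list_prod Gbar (y # take j ys), ys ! j]"
      using closed sub j len by (intro Gbar.face_on_nerve) (auto simp: N_bar_simps)
    moreover have "bar_cocycle [list_prod Gbar (y # take j ys), ys ! j]
        = defect (list_prod Gbar (y # take j ys)) (ys ! j)"
      using j len sub by (intro bar_cocycle_pair [OF \<omega>]) auto
    ultimately show ?thesis using ys by simp
  qed
  have face1: "bar_cocycle (face_on Nbar (Suc m) {1, Suc j, Suc j + 1} (y # ys))
      = defect (list_prod Gbar (take j ys)) (ys ! j)" if "j \<noteq> 0"
  proof -
    have "face_on Nbar (Suc m) {length [y], Suc j, Suc j + 1} ([y] @ take j ys @ ys ! j # drop (Suc j) ys)
        = [list_prod Gbar (take j ys), ys ! j]"
      using closed sub j len that by (intro Gbar.face_on_nerve) (auto simp: N_bar_simps)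
    moreover have "bar_cocycle [list_prod Gbar (take j ys), ys ! j]
        = defect (list_prod Gbar (take j ys)) (ys ! j)"
      using j len sub by (intro bar_cocycle_pair [OF \<omega>]) auto
    ultimately show ?thesis using ys by (simp add: One_nat_def)
  qed
  have nth: "[1..<Suc m] ! j = Suc j" using j by (simp del: upt_Suc)
  show ?thesis
  proof (cases "j = 0")
    case True
    have "ys ! 0 \<in> carrier Gbar" using closed(2) j len True by auto
    then show ?thesis
      using face0 True j nth closed(1) defect_one(1) [of "ys ! 0"] defect_range [of y "ys ! 0"]
      by (simp add: twist_def numeral_2_eq_2 One_nat_def del: upt_Suc)
  next
    case False
    then show ?thesis
      using face0 face1 j nth by (simp add: twist_def One_nat_def del: upt_Suc)
  qed
qed

text \<open>Lifting the \<open>0\<close>-th face from the base point instead of from \<open>y\<close> changes every entry by the same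
  difference of cocycle values that the twisting function consists of.\<close>

lemma star_lift_twisted_face:
  assumes \<omega>: "y # ys \<in> cells Nbar (Suc m)" and \<alpha>: "length \<alpha> = m"
  shows "J_action G J (map2 (mult (Zmod d)) (twist d Nbar bar_cocycle (Suc m) (y # ys)) \<alpha>)
      (star_lift \<one>\<^bsub>Gbar\<^esub> ys) = J_action G J \<alpha> (star_lift y ys)"
proof (rule nth_equalityI)
  have len: "length ys = m" using Nbar_length [OF \<omega>] by simp
  have closed: "y \<in> carrier Gbar" "set ys \<subseteq> carrier Gbar" using Nbar_subset_carrier [OF \<omega>] by auto
  have len': "length (twist d Nbar bar_cocycle (Suc m) (y # ys)) = m"
    by (simp add: twist_def)
  show "length (J_action G J (map2 (mult (Zmod d)) (twist d Nbar bar_cocycle (Suc m) (y # ys)) \<alpha>)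
      (star_lift \<one>\<^bsub>Gbar\<^esub> ys)) = length (J_action G J \<alpha> (star_lift y ys))"
    using len len' \<alpha> by (simp add: length_J_action)
  fix j assume "j < length (J_action G J (map2 (mult (Zmod d)) (twist d Nbar bar_cocycle (Suc m) (y # ys)) \<alpha>)
      (star_lift \<one>\<^bsub>Gbar\<^esub> ys))"
  then have j: "j < m" using len len' \<alpha> by (simp add: length_J_action)
  let ?P = "list_prod Gbar (take j ys)"
  have P: "?P \<in> carrier Gbar" using closed set_take_subset [of j ys] by (intro Gbar.list_prod_closed) auto
  have yj: "ys ! j \<in> carrier Gbar" using closed j len by auto
  let ?A = "defect (y \<otimes>\<^bsub>Gbar\<^esub> ?P) (ys ! j)" and ?B = "defect ?P (ys ! j)"
  have "J_action G J (map2 (mult (Zmod d)) (twist d Nbar bar_cocycle (Suc m) (y # ys)) \<alpha>)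
      (star_lift \<one>\<^bsub>Gbar\<^esub> ys) ! j
    = J [^] (((?A - ?B) mod int d + \<alpha> ! j) mod int d) \<otimes> (J [^] ?B \<otimes> sect (ys ! j))"
    using j len len' \<alpha> closed P
    by (simp add: J_action_def twist_bar_cocycle [OF \<omega>] star_lift_nth del: J_pow_mod)
  also have "\<dots> = J [^] (\<alpha> ! j + ?A) \<otimes> sect (ys ! j)"
  proof -
    have "J [^] (((?A - ?B) mod int d + \<alpha> ! j) mod int d) = J [^] (?A - ?B + \<alpha> ! j)"
      by (simp add: J_pow_eq_iff mod_simps)
    then show ?thesis using yj by (simp add: J_pow_add sect_closed algebra_simps)
  qed
  also have "\<dots> = J_action G J \<alpha> (star_lift y ys) ! j"
    using j len \<alpha> closed P yj by (simp add: J_action_def star_lift_nth J_pow_add sect_closed)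
  finally show "J_action G J (map2 (mult (Zmod d)) (twist d Nbar bar_cocycle (Suc m) (y # ys)) \<alpha>)
      (star_lift \<one>\<^bsub>Gbar\<^esub> ys) ! j = J_action G J \<alpha> (star_lift y ys) ! j" .
qed

text \<open>Correcting the lift at the initial vertex by the coordinates in \<open>\<int>/d\<close> trivialises the bundle.\<close>

lemma bundle_iso_bar_cocycle:
  "\<exists>\<phi>. bundle_iso d (twisted_product d Nbar bar_cocycle) (twisted_action d) snd
      (N_comm d G) (J_action G J) (map q) \<phi>"
proof -
  let ?E = "twisted_product d Nbar bar_cocycle"
  let ?triv = "\<lambda>\<alpha> ys. J_action G J \<alpha> (star_lift \<one>\<^bsub>Gbar\<^esub> ys)"
  define \<phi> where "\<phi> n = (\<lambda>(\<alpha>, ys)\<in>cells ?E n. ?triv \<alpha> ys)" for n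
  have E_iff: "(\<alpha>, ys) \<in> cells ?E n \<longleftrightarrow> length \<alpha> = n \<and> set \<alpha> \<subseteq> {0..<int d} \<and> ys \<in> cells Nbar n" for \<alpha> ys n
    by (auto simp: cells_twisted_product cells_nerve carrier_Zmod)
  have \<phi>: "\<phi> n (\<alpha>, ys) = ?triv \<alpha> ys" if "(\<alpha>, ys) \<in> cells ?E n" for n \<alpha> ys
    using that by (simp add: \<phi>_def)
  have lift: "length ys = n" "set ys \<subseteq> carrier Gbar" "set (star_lift \<one>\<^bsub>Gbar\<^esub> ys) \<subseteq> carrier G"
      "map q (star_lift \<one>\<^bsub>Gbar\<^esub> ys) = ys" if "ys \<in> cells Nbar n" for n ys
    using that Nbar_length [OF that] Nbar_subset_carrier [OF that]
    by (auto intro!: star_lift_closed [THEN subsetD] map_q_star_lift)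
  have q_triv: "map q (?triv \<alpha> ys) = ys" and triv_closed: "?triv \<alpha> ys \<in> cells (N_comm d G) n"
    if e: "(\<alpha>, ys) \<in> cells ?E n" for n \<alpha> ys
  proof -
    have ys: "ys \<in> cells Nbar n" and len: "length \<alpha> = n" using e by (auto simp: E_iff)
    show q: "map q (?triv \<alpha> ys) = ys"
      using lift [OF ys] len by (simp add: map_q_J_action)
    obtain gs where gs: "gs \<in> cells (N_comm d G) n" "ys = map q gs"
      using ys by (auto simp: N_bar_simps)
    have "set (?triv \<alpha> ys) \<subseteq> carrier G" using lift [OF ys] by (intro J_action_closed)
    then show "?triv \<alpha> ys \<in> cells (N_comm d G) n"
      using q gs by (intro N_comm_if_q_eq [OF gs(1)]) auto
  qed
  have E_face: "face ?E (Suc n) i e \<in> cells ?E n" if "e \<in> cells ?E (Suc n)" "i \<le> Suc n" for n i e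
  proof -
    obtain \<alpha> ys where e: "e = (\<alpha>, ys)" by (cases e)
    have \<alpha>: "length \<alpha> = Suc n" "set \<alpha> \<subseteq> {0..<int d}" and ys: "ys \<in> cells Nbar (Suc n)"
      using that e by (auto simp: E_iff)
    have "face Nbar (Suc n) i ys \<in> cells Nbar n"
      using Nbar_face [OF ys that(2)] by (simp add: N_bar_simps)
    moreover have "length (nerve_face (Zmod d) (Suc n) i \<alpha>) = n"
      using length_nerve_face [OF \<alpha>(1) that(2)] .
    moreover have "set (nerve_face (Zmod d) (Suc n) i \<alpha>) \<subseteq> {0..<int d}"
      using set_nerve_face [OF \<alpha>(1) that(2), of "Zmod d"] \<alpha>(2) d_gt_1 by auto
    moreover have "length (twist d Nbar bar_cocycle (Suc n) ys) = n" by (simp add: twist_def del: upt_Suc)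
    ultimately show ?thesis
      using e d_gt_1 by (auto simp: twisted_product_def face_nerve E_iff [unfolded twisted_product_def, simplified] cells_nerve carrier_Zmod
          dest!: set_zip_leftD)
  qed
  have "simplicial_map ?E (N_comm d G) \<phi>"
    unfolding simplicial_map_def
  proof (intro conjI allI ballI impI)
    show "\<phi> n \<in> cells ?E n \<rightarrow>\<^sub>E cells (N_comm d G) n" for n
      using triv_closed by (auto simp: \<phi>_def)
  next
    fix n e i assume e: "e \<in> cells ?E (Suc n)" and i: "i \<le> Suc n"
    obtain \<alpha> ys where \<alpha>ys: "e = (\<alpha>, ys)" by (cases e)
    have \<alpha>: "length \<alpha> = Suc n" and ys: "ys \<in> cells Nbar (Suc n)"
      using e \<alpha>ys by (auto simp: E_iff)
    note lift = lift [OF ys]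
    have "\<phi> n (face ?E (Suc n) i e) = (case face ?E (Suc n) i e of (\<alpha>, ys) \<Rightarrow> ?triv \<alpha> ys)"
      using E_face [OF e i] by (simp add: \<phi>_def)
    also have "\<dots> = nerve_face G (Suc n) i (?triv \<alpha> ys)"
    proof (cases "i = 0")
      case True
      obtain y zs where y: "ys = y # zs" using lift(1) by (cases ys) auto
      obtain a \<beta> where a: "\<alpha> = a # \<beta>" using \<alpha> by (cases \<alpha>) auto
      have "y \<in> carrier Gbar" using lift(2) y by simp
      then show ?thesis
        using star_lift_twisted_face [OF ys [unfolded y], of \<beta>] True \<alpha> y a
        by (simp add: \<alpha>ys twisted_product_def face_nerve N_bar_simps nerve_face_Cons del: mult_integer_mod_group)
    next
      case False
      then show ?thesis
        using star_lift_face [of \<alpha> ys "Suc n" i "\<one>\<^bsub>Gbar\<^esub>"] lift \<alpha> i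
        by (simp add: \<alpha>ys twisted_product_def face_nerve N_bar_simps)
    qed
    also have "\<dots> = face (N_comm d G) (Suc n) i (\<phi> (Suc n) e)"
      using \<phi> e by (simp add: \<alpha>ys N_comm_simps)
    finally show "\<phi> n (face ?E (Suc n) i e) = face (N_comm d G) (Suc n) i (\<phi> (Suc n) e)" .
  next
    fix n e j assume e: "e \<in> cells ?E n" and j: "j \<le> n"
    obtain \<alpha> ys where \<alpha>ys: "e = (\<alpha>, ys)" by (cases e)
    have \<alpha>: "length \<alpha> = n" "set \<alpha> \<subseteq> {0..<int d}" and ys: "ys \<in> cells Nbar n"
      using e \<alpha>ys by (auto simp: E_iff)
    have "degen ?E n j e \<in> cells ?E (Suc n)"
    proof -
      have "set (nerve_degen (Zmod d) n j \<alpha>) \<subseteq> insert 0 (set \<alpha>)" "length (nerve_degen (Zmod d) n j \<alpha>) = Suc n"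
        using \<alpha>(1) j by (auto simp: nerve_degen_def dest: in_set_takeD in_set_dropD)
      then show ?thesis
        using Nbar_degen [OF ys j] \<alpha> d_gt_1 unfolding \<alpha>ys
        by (auto simp: cells_twisted_product cells_nerve carrier_Zmod) (auto simp: twisted_product_def degen_nerve N_bar_simps)
    qed
    then have "\<phi> (Suc n) (degen ?E n j e) = (case degen ?E n j e of (\<alpha>, ys) \<Rightarrow> ?triv \<alpha> ys)"
      by (simp add: \<phi>_def)
    also have "\<dots> = nerve_degen G n j (?triv \<alpha> ys)"
      using star_lift_degen [of \<alpha> ys j "\<one>\<^bsub>Gbar\<^esub>" n] lift [OF ys] \<alpha> j
      by (simp add: \<alpha>ys twisted_product_def degen_nerve N_bar_simps)
    also have "\<dots> = degen (N_comm d G) n j (\<phi> n e)"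
      using \<phi> e by (simp add: \<alpha>ys N_comm_simps)
    finally show "\<phi> (Suc n) (degen ?E n j e) = degen (N_comm d G) n j (\<phi> n e)" .
  qed
  moreover have "bij_betw (\<phi> n) (cells ?E n) (cells (N_comm d G) n)" for n
  proof (rule bij_betw_imageI)
    show "inj_on (\<phi> n) (cells ?E n)"
    proof (rule inj_onI)
      fix e e' assume e: "e \<in> cells ?E n" "e' \<in> cells ?E n" and eq: "\<phi> n e = \<phi> n e'"
      obtain \<alpha> ys \<alpha>' ys' where \<alpha>ys: "e = (\<alpha>, ys)" "e' = (\<alpha>', ys')" by (cases e, cases e')
      have triv: "?triv \<alpha> ys = ?triv \<alpha>' ys'" using eq e \<phi> by (simp add: \<alpha>ys)
      then have "ys = ys'" using q_triv e unfolding \<alpha>ys by metis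
      moreover have "\<alpha> = \<alpha>'"
        using triv e lift [of ys n] unfolding \<alpha>ys E_iff \<open>ys = ys'\<close>
        by (intro J_action_inject [of \<alpha> "star_lift \<one>\<^bsub>Gbar\<^esub> ys'" \<alpha>']) auto
      ultimately show "e = e'" by (simp add: \<alpha>ys)
    qed
    show "\<phi> n ` cells ?E n = cells (N_comm d G) n"
    proof (intro equalityI subsetI)
      fix hs assume "hs \<in> \<phi> n ` cells ?E n"
      then obtain e where "e \<in> cells ?E n" "hs = \<phi> n e" by blast
      then show "hs \<in> cells (N_comm d G) n"
        using triv_closed \<phi> by (cases e) simp
    next
      fix hs assume hs: "hs \<in> cells (N_comm d G) n"
      define ys where "ys = map q hs"
      have ys: "ys \<in> cells Nbar n" using hs by (simp add: ys_def N_bar_simps)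
      note lift = lift [OF ys]
      have "length hs = n" "set hs \<subseteq> carrier G" using hs by (auto simp: N_comm_simps)
      then obtain \<alpha> where "length \<alpha> = n" "set \<alpha> \<subseteq> {0..<int d}" "?triv \<alpha> ys = hs"
        using J_action_transitive [of "star_lift \<one>\<^bsub>Gbar\<^esub> ys" hs] lift by (auto simp: ys_def)
      then have "(\<alpha>, ys) \<in> cells ?E n" "\<phi> n (\<alpha>, ys) = hs"
        using ys \<phi> by (auto simp: E_iff)
      then show "hs \<in> \<phi> n ` cells ?E n" by (metis imageI)
    qed
  qed
  moreover have "map q (\<phi> n e) = snd e" if "e \<in> cells ?E n" for n e
    using q_triv \<phi> that by (cases e) simp
  moreover have "\<phi> n (twisted_action d \<beta> e) = J_action G J \<beta> (\<phi> n e)"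
    if e: "e \<in> cells ?E n" and \<beta>: "\<beta> \<in> cells (nerve (Zmod d)) n" for n e \<beta>
  proof -
    obtain \<alpha> ys where \<alpha>ys: "e = (\<alpha>, ys)" by (cases e)
    have \<alpha>: "length \<alpha> = n" "set \<alpha> \<subseteq> {0..<int d}" and ys: "ys \<in> cells Nbar n" and \<beta>': "length \<beta> = n"
      using e \<beta> \<alpha>ys by (auto simp: E_iff cells_nerve)
    have "(map2 (mult (Zmod d)) \<beta> \<alpha>, ys) \<in> cells ?E n"
      using \<alpha> ys \<beta>' d_gt_1 by (auto simp: E_iff)
    then show ?thesis
      using \<phi> e J_action_mult [of \<beta> \<alpha> "star_lift \<one>\<^bsub>Gbar\<^esub> ys"] \<alpha> \<beta>' lift [OF ys]
      by (simp add: \<alpha>ys twisted_action_def)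
  qed
  ultimately have "bundle_iso d ?E (twisted_action d) snd (N_comm d G) (J_action G J) (map q) \<phi>"
    unfolding bundle_iso_def by blast
  then show ?thesis by blast
qed

lemma universal_solution:
  obtains c S where "c \<in> carrier (cochain_group d Nbar 2)" "gamma_class d G J = H2_class d Nbar c"
    "S \<in> Sol_X d Nbar c G J" "\<And>y. y \<in> cells Nbar 1 \<Longrightarrow> [q (S y)] = y"
proof -
  obtain \<phi> where \<phi>: "bundle_iso d (twisted_product d Nbar bar_cocycle) (twisted_action d) snd
      (N_comm d G) (J_action G J) (map q) \<phi>"
    using bundle_iso_bar_cocycle by blast
  obtain S where "S \<in> Sol_X d Nbar bar_cocycle G J" "\<And>y. y \<in> cells Nbar 1 \<Longrightarrow> [q (S y)] = y"
    using bundle_iso_solution [OF \<phi>] by blast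
  then show ?thesis
    using that gamma_class_eq [OF bar_cocycle_in_cocycles normalized_bar_cocycle \<phi>]
      cocycles_subset_cochains [OF bar_cocycle_in_cocycles] by blast
qed

end

section \<open>Maps into the quotient\<close>

context simplicial_set begin

lemma triangles_closed: "d > 0 \<Longrightarrow> triangles_closed X d"
  using face_cells(2) by (simp add: triangles_closed_def)

end

(* Dimensions 1 + n and n + 1 arise from the front edge and from the simplicial identities. *)
declare plus_1_eq_Suc [simp] Suc_eq_plus1 [symmetric, simp]

primrec edge_labels :: "'a sset \<Rightarrow> ('a \<Rightarrow> 'g) \<Rightarrow> nat \<Rightarrow> 'a \<Rightarrow> 'g list" where
  "edge_labels X T 0 x = []"
| "edge_labels X T (Suc n) x = T (front X 1 n x) # edge_labels X T n (face X (Suc n) 0 x)"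

lemma length_edge_labels [simp]: "length (edge_labels X T n x) = n"
  by (induction n arbitrary: x) auto

context central_cyclic begin

context
  fixes X :: "'x sset" and \<gamma> :: "'x \<Rightarrow> int" and T :: "'x \<Rightarrow> 'a"
  assumes X: "simplicial_set X" and T: "T \<in> Sol_X d X \<gamma> G J"
begin

interpretation X: simplicial_set X by (rule X)

lemma T_closed: "x \<in> cells X 1 \<Longrightarrow> T x \<in> carrier G"
  and T_pow: "x \<in> cells X 1 \<Longrightarrow> T x [^] d = \<one>"
  using T by (auto simp: Sol_X_iff X.face_cells)

lemma edge_labels_closed: "x \<in> cells X n \<Longrightarrow>
    set (edge_labels X T n x) \<subseteq> {g \<in> carrier G. g [^] d = \<one>}"
proof (induction n arbitrary: x)
  case (Suc n)
  have "front X 1 n x \<in> cells X 1" using X.front_closed [of x 1 n] Suc.prems by simp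
  then show ?case
    using Suc T_closed T_pow X.face_closed [OF Suc.prems, of 0] by simp
qed simp

lemma front_triangle:
  assumes x: "x \<in> cells X (Suc (Suc n))"
  defines "t \<equiv> front X 2 n x"
  shows "t \<in> cells X 2" "front X 1 (Suc n) x = face X 2 2 t"
    "front X 1 n (face X (Suc (Suc n)) 0 x) = face X 2 0 t"
    "front X 1 n (face X (Suc (Suc n)) 1 x) = face X 2 1 t"
  using X.front_closed [of x 2 n] X.front_Suc [of 1 n x] X.front_face_inside [of x 1 n] x
  by (simp_all add: t_def)

text \<open>For non-consecutive edges this is not part of the system: the labels of \<open>02\<close> and \<open>12\<close> commute
  with the labels beyond vertex \<open>2\<close> by induction, and the triangle \<open>012\<close> expresses the label
  of \<open>01\<close> by these two.\<close>

lemma first_label_commutes: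
  "x \<in> cells X (Suc n) \<Longrightarrow> g \<in> set (edge_labels X T n (face X (Suc n) 0 x)) \<Longrightarrow>
    T (front X 1 n x) \<otimes> g = g \<otimes> T (front X 1 n x)"
proof (induction n arbitrary: x g)
  case (Suc n)
  define t where "t = front X 2 n x"
  note t = front_triangle [OF Suc.prems(1), folded t_def]
  let ?d0 = "face X (Suc (Suc n)) 0 x" and ?d1 = "face X (Suc (Suc n)) 1 x"
  have d: "?d0 \<in> cells X (Suc n)" "?d1 \<in> cells X (Suc n)"
    using X.face_closed Suc.prems(1) by auto
  have dd: "face X (Suc n) 0 ?d1 = face X (Suc n) 0 ?d0"
    using X.face_face' [OF Suc.prems(1), of 0 1] by simp
  note tri = Sol_X_triangle [OF X.face_cells(2) T t(1)]
  define s0 s1 s2 where "s0 = T (face X 2 0 t)" and "s1 = T (face X 2 1 t)" and "s2 = T (face X 2 2 t)"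
  have s: "s0 \<in> carrier G" "s1 \<in> carrier G" "s2 \<in> carrier G"
    using X.face_cells(2) [OF t(1)] T_closed by (auto simp: s0_def s1_def s2_def)
  have rel: "s2 \<otimes> s0 = J [^] (- \<gamma> t) \<otimes> s1" "s2 \<otimes> s0 = s0 \<otimes> s2"
    using tri(2) tri(1) [of 2 0] by (simp_all add: s0_def s1_def s2_def)
  have "g = s0 \<or> g \<in> set (edge_labels X T n (face X (Suc n) 0 ?d0))"
    using Suc.prems(2) t(3) by (simp add: s0_def)
  then have "s2 \<otimes> g = g \<otimes> s2"
  proof
    assume g: "g \<in> set (edge_labels X T n (face X (Suc n) 0 ?d0))"
    then have g': "g \<in> carrier G"
      using edge_labels_closed [OF X.face_closed [OF d(1), of 0]] by auto
    have c0: "s0 \<otimes> g = g \<otimes> s0"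
      using Suc.IH [OF d(1) g] t(3) by (simp add: s0_def)
    have c1: "s1 \<otimes> g = g \<otimes> s1"
      using Suc.IH [OF d(2), of g] g dd t(4) by (simp add: s1_def)
    have "(s2 \<otimes> g) \<otimes> s0 = (s2 \<otimes> s0) \<otimes> g"
      using s g' c0 by (simp add: m_assoc)
    also have "\<dots> = g \<otimes> (s2 \<otimes> s0)"
      using s g' c1 J_pow_mult_commute_iff [of s1 g "- \<gamma> t"] by (simp add: rel(1))
    also have "\<dots> = (g \<otimes> s2) \<otimes> s0" using s g' by (simp add: m_assoc)
    finally show ?thesis using s g' by simp
  qed (use rel in simp)
  then show ?case using t(2) by (simp add: s2_def)
qed simp

lemma edge_labels_in_N_comm: "x \<in> cells X n \<Longrightarrow> edge_labels X T n x \<in> cells (N_comm d G) n"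
proof (induction n arbitrary: x)
  case 0
  then show ?case by (simp add: N_comm_simps)
next
  case (Suc n)
  let ?d0 = "face X (Suc n) 0 x"
  have d0: "?d0 \<in> cells X n" using X.face_closed [OF Suc.prems, of 0] by simp
  then have IH: "\<And>g h. g \<in> set (edge_labels X T n ?d0) \<Longrightarrow> h \<in> set (edge_labels X T n ?d0) \<Longrightarrow> g \<otimes> h = h \<otimes> g"
    using Suc.IH by (auto simp: N_comm_simps)
  have "g \<otimes> h = h \<otimes> g" if "g \<in> set (edge_labels X T (Suc n) x)" "h \<in> set (edge_labels X T (Suc n) x)" for g h
    using that IH [of g h] first_label_commutes [OF Suc.prems] by auto
  then show ?case
    using edge_labels_closed [OF Suc.prems] unfolding N_comm_simps mem_Collect_eq
    by (intro conjI) auto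
qed

lemma q_edge_labels_face:
  "x \<in> cells X (Suc n) \<Longrightarrow> i \<le> Suc n \<Longrightarrow>
    map q (edge_labels X T n (face X (Suc n) i x)) = nerve_face Gbar (Suc n) i (map q (edge_labels X T (Suc n) x))"
proof (induction n arbitrary: x i)
  case 0
  then show ?case by (auto simp: le_Suc_eq nerve_face_Cons)
next
  case (Suc n)
  define t where "t = front X 2 n x"
  note t = front_triangle [OF Suc.prems(1), folded t_def]
  let ?d0 = "face X (Suc (Suc n)) 0 x"
  have d0: "?d0 \<in> cells X (Suc n)" using X.face_closed Suc.prems(1) by auto
  consider (zero) "i = 0" | (one) "i = Suc 0" | (later) j where "i = Suc j" "0 < j" "j \<le> Suc n"
    using Suc.prems(2) by (cases i) auto
  then show ?case
  proof cases
    case zero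
    then show ?thesis by (simp add: nerve_face_Cons)
  next
    case one
    have "face X (Suc n) 0 (face X (Suc (Suc n)) 1 x) = face X (Suc n) 0 ?d0"
      using X.face_face' [OF Suc.prems(1), of 0 1] by simp
    moreover have "q (T (face X 2 2 t)) \<otimes>\<^bsub>Gbar\<^esub> q (T (face X 2 0 t)) = q (T (face X 2 1 t))"
    proof -
      have c: "T (face X 2 i t) \<in> carrier G" if "i \<le> 2" for i
        using that X.face_cells(2) [OF t(1)] T_closed by auto
      then have "q (T (face X 2 2 t) \<otimes> T (face X 2 0 t)) = q (T (face X 2 1 t))"
        using Sol_X_triangle(2) [OF X.face_cells(2) T t(1)] by simp
      then show ?thesis using c by (simp add: q_mult)
    qed
    ultimately show ?thesis
      using t one by (simp add: nerve_face_Cons [folded One_nat_def] flip: One_nat_def)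
  next
    case later
    have "front X 1 n (face X (Suc (Suc n)) i x) = front X 1 (Suc n) x"
      using X.front_face_outside [of x 1 n i] Suc.prems later by simp
    moreover have "face X (Suc n) 0 (face X (Suc (Suc n)) i x) = face X (Suc n) j ?d0"
      using X.face_face' [OF Suc.prems(1), of 0 i] Suc.prems(2) later by simp
    moreover have "map q (edge_labels X T n (face X (Suc n) j ?d0))
        = nerve_face Gbar (Suc n) j (map q (edge_labels X T (Suc n) ?d0))"
      using Suc.IH [OF d0] later by blast
    ultimately show ?thesis
      using later nerve_face_Cons_Suc [of "map q (edge_labels X T (Suc n) ?d0)" "Suc n" j Gbar]
      by (simp del: edge_labels.simps(2) add: edge_labels.simps(2) [of X T "Suc n" x]
          edge_labels.simps(2) [of X T n "face X (Suc (Suc n)) (Suc j) x"])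
  qed
qed

lemma edge_labels_degen:
  assumes "normalized X \<gamma>"
  shows "x \<in> cells X n \<Longrightarrow> j \<le> n \<Longrightarrow>
    edge_labels X T (Suc n) (degen X n j x) = nerve_degen G n j (edge_labels X T n x)"
proof (induction n arbitrary: x j)
  case 0
  have "front X 1 0 (degen X 0 0 x) = degen X 0 0 x" by simp
  then show ?case
    using 0 Sol_X_degenerate [OF X assms T] by (simp add: nerve_degen_Cons)
next
  case (Suc n)
  show ?case
  proof (cases j)
    case 0
    have "front X 1 (Suc n) (degen X (Suc n) 0 x) = degen X 0 0 (front X 0 (Suc n) x)"
      using X.front_degen [of x 0 "Suc n" 0] Suc.prems by (simp add: One_nat_def del: front.simps)
    moreover have "face X (Suc (Suc n)) 0 (degen X (Suc n) 0 x) = x"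
      using X.face_degen_id [OF Suc.prems(1), of 0 0] by simp
    ultimately show ?thesis
      using 0 Sol_X_degenerate [OF X assms T X.front_closed [of x 0 "Suc n"]] Suc.prems
      by (simp add: nerve_degen_Cons edge_labels.simps(2) [of X T "Suc n"] del: edge_labels.simps(2) front.simps)
  next
    case (Suc k)
    let ?d0 = "face X (Suc n) 0 x"
    have d0: "?d0 \<in> cells X n" using X.face_closed [OF Suc.prems(1), of 0] by simp
    have s: "degen X (Suc n) j x \<in> cells X (Suc (Suc n))"
      using X.degen_closed Suc.prems by blast
    have "face X (Suc (Suc n)) (Suc j) (degen X (Suc n) j x) = x"
      using X.face_degen_id [OF Suc.prems(1), of j "Suc j"] Suc.prems(2) by simp
    then have "front X 1 (Suc n) (degen X (Suc n) j x) = front X 1 n x"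
      using X.front_face_outside [of "degen X (Suc n) j x" 1 n "Suc j"] s Suc.prems(2) \<open>j = Suc k\<close> by simp
    moreover have "face X (Suc (Suc n)) 0 (degen X (Suc n) j x) = degen X n k ?d0"
      using X.face_degen_less [OF Suc.prems(1), of 0 j] Suc.prems(2) \<open>j = Suc k\<close> by simp
    ultimately show ?thesis
      using Suc.IH [OF d0, of k] Suc.prems(2) \<open>j = Suc k\<close>
      by (simp add: nerve_degen_Cons(2) [where m = n] edge_labels.simps(2) [of X T "Suc n"] del: edge_labels.simps(2) front.simps)
        (simp add: nerve_degen_Cons(2) [where m = n])
  qed
qed

lemma simplicial_map_of_solution:
  assumes "normalized X \<gamma>"
  obtains f where "simplicial_map X Nbar f" "\<And>x. x \<in> cells X 1 \<Longrightarrow> f 1 x = [q (T x)]"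
proof
  let ?f = "\<lambda>n. \<lambda>x\<in>cells X n. map q (edge_labels X T n x)"
  show "simplicial_map X Nbar ?f"
    unfolding simplicial_map_def
  proof (intro conjI allI ballI impI)
    show "?f n \<in> cells X n \<rightarrow>\<^sub>E cells Nbar n" for n
      using edge_labels_in_N_comm by (auto simp: N_bar_simps)
    show "?f n (face X (Suc n) i x) = face Nbar (Suc n) i (?f (Suc n) x)"
      if "x \<in> cells X (Suc n)" "i \<le> Suc n" for n x i
      using that X.face_closed q_edge_labels_face by (simp add: N_bar_simps del: edge_labels.simps)
    show "?f (Suc n) (degen X n j x) = degen Nbar n j (?f n x)" if "x \<in> cells X n" "j \<le> n" for n x j
      using that X.degen_closed edge_labels_degen [OF assms that]
      by (simp add: N_bar_simps map_q_degen del: edge_labels.simps)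
  qed
  show "?f 1 x = [q (T x)]" if "x \<in> cells X 1" for x
    using that by (simp add: One_nat_def)
qed

end

text \<open>A simplex of a nerve is the sequence of its consecutive edges, so a simplicial map into
  \<open>\<bar>N\<close> is determined in degree 1.\<close>

lemma simplicial_map_Nbar_eqI:
  assumes X: "simplicial_set X" and f: "simplicial_map X Nbar f" and g: "simplicial_map X Nbar g"
    and eq: "\<And>x. x \<in> cells X 1 \<Longrightarrow> f 1 x = g 1 x"
  shows "f = g"
proof -
  interpret X: simplicial_set X by fact
  have front: "h 1 (front X 1 k x) = take 1 (h (Suc k) x)"
    if "simplicial_map X Nbar h" "x \<in> cells X (Suc k)" for h k x
    using that(2)
  proof (induction k arbitrary: x)
    case 0
    have "length (h 1 x) = 1"
      using simplicial_map_cells [OF that(1)] 0 Nbar_length by (simp add: One_nat_def)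
    then show ?case by (simp add: One_nat_def)
  next
    case (Suc k)
    let ?y = "face X (Suc (Suc k)) (Suc (Suc k)) x"
    have "h (Suc k) ?y = butlast (h (Suc (Suc k)) x)"
      using simplicial_map_face [OF that(1) Suc.prems, of "Suc (Suc k)"]
      by (simp add: N_bar_simps nerve_face_last)
    moreover have "length (h (Suc (Suc k)) x) = Suc (Suc k)"
      using simplicial_map_cells [OF that(1) Suc.prems] Nbar_length by blast
    ultimately show ?case
      using Suc.IH [of ?y] X.face_closed [OF Suc.prems, of "Suc (Suc k)"]
      by (simp add: take_butlast)
  qed
  have "f n x = g n x" if "x \<in> cells X n" for n x
    using that
  proof (induction n arbitrary: x)
    case 0
    then have "length (f 0 x) = 0" "length (g 0 x) = 0"
      using simplicial_map_cells [OF f] simplicial_map_cells [OF g] Nbar_length by blast+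
    then show ?case by simp
  next
    case (Suc n)
    have decomp: "h (Suc n) x = h 1 (front X 1 n x) @ h n (face X (Suc n) 0 x)"
      if h: "simplicial_map X Nbar h" for h
    proof -
      have "h n (face X (Suc n) 0 x) = tl (h (Suc n) x)"
        using simplicial_map_face [OF h Suc.prems, of 0] by (simp add: N_bar_simps nerve_face_def)
      moreover have "h (Suc n) x = take 1 (h (Suc n) x) @ tl (h (Suc n) x)"
        by (cases "h (Suc n) x") (auto simp: One_nat_def)
      ultimately show ?thesis using front [OF h Suc.prems] by simp
    qed
    show ?case
      using decomp [OF f] decomp [OF g] eq [OF X.front_closed [of x 1 n]]
        Suc.IH [OF X.face_closed [OF Suc.prems, of 0]] Suc.prems by simp
  qed
  moreover have "f n \<in> extensional (cells X n)" "g n \<in> extensional (cells X n)" for n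
    using f g by (auto simp: simplicial_map_def PiE_def)
  ultimately show ?thesis
    by (intro ext [of f g]) (blast intro: extensionalityI)
qed

section \<open>Solutions up to 1-cocycles\<close>

lemma cocycles_1_iff:
  assumes "triangles_closed X d"
  shows "c \<in> cocycles d X 1 \<longleftrightarrow> c \<in> carrier (cochain_group d X 1) \<and>
    (\<forall>\<sigma>\<in>cells X 2. (c (face X 2 0 \<sigma>) - c (face X 2 1 \<sigma>) + c (face X 2 2 \<sigma>)) mod int d = 0)"
  unfolding cocycles_def kernel_def coboundary_1
  by (auto simp: cochain_group_def fun_eq_iff)

text \<open>A cochain of powers of \<open>J\<close> that relates two solutions for the same \<open>\<gamma>\<close> has vanishing
  coboundary.\<close>

lemma gauge_class_eq_fibre:
  assumes X: "triangles_closed X d" and T: "T \<in> Sol_X d X \<gamma> G J"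
  shows "gauge_rel d X \<gamma> G J `` {T} = {T' \<in> Sol_X d X \<gamma> G J. \<forall>x\<in>cells X 1. q (T x) = q (T' x)}"
proof (intro equalityI subsetI)
  interpret X: triangles_closed X d by fact
  have closed: "T x \<in> carrier G" if "x \<in> cells X 1" for x
    using T that by (auto simp: Sol_X_iff X.face_triangle)
  fix T'
  {
    assume "T' \<in> gauge_rel d X \<gamma> G J `` {T}"
    then obtain c where "T' \<in> Sol_X d X \<gamma> G J" "\<forall>x\<in>cells X 1. T' x = J [^] (c x :: int) \<otimes> T x"
      by (auto simp: gauge_rel_def)
    then show "T' \<in> {T' \<in> Sol_X d X \<gamma> G J. \<forall>x\<in>cells X 1. q (T x) = q (T' x)}"
      using closed by simp
  next
    assume T': "T' \<in> {T' \<in> Sol_X d X \<gamma> G J. \<forall>x\<in>cells X 1. q (T x) = q (T' x)}"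
    then obtain h where h: "h \<in> carrier (cochain_group d X 1)" "T' = (\<lambda>x\<in>cells X 1. J [^] h x \<otimes> T x)"
      using Sol_X_same_image [OF X T, of T' \<gamma>] by blast
    have row: "\<forall>\<sigma>\<in>cells X 2. (h (face X 2 0 \<sigma>) - h (face X 2 1 \<sigma>) + h (face X 2 2 \<sigma>) + \<gamma> \<sigma>) mod int d
        = \<gamma> \<sigma> mod int d"
      using T' unfolding h(2) mem_Collect_eq Sol_X_twist_iff [OF X T] by blast
    have "h \<in> cocycles d X 1"
      unfolding cocycles_1_iff [OF X]
    proof (intro conjI ballI)
      fix \<sigma> assume "\<sigma> \<in> cells X 2"
      then show "(h (face X 2 0 \<sigma>) - h (face X 2 1 \<sigma>) + h (face X 2 2 \<sigma>)) mod int d = 0"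
        using row by (simp add: mod_eq_dvd_iff mod_eq_0_iff_dvd)
    qed (rule h(1))
    then show "T' \<in> gauge_rel d X \<gamma> G J `` {T}"
      using T T' h(2) by (auto simp: gauge_rel_def)
  }
qed

text \<open>The set attached to \<open>f\<close> is its fibre under the passage from solutions to maps.  Fibres are orbits
  of the 1-cocycles, and the fibre over \<open>f\<close> is inhabited precisely if \<open>f\<close> pulls the class of the bundle
  back to \<open>[\<gamma>]\<close>, because the universal solution pulls back along \<open>f\<close> to a solution for the pulled back
  cocycle.\<close>

theorem bij_betw_maps_gauge_classes:
  assumes X: "simplicial_set X" and \<gamma>: "\<gamma> \<in> cocycles d X 2" "normalized X \<gamma>"
  shows "bij_betw (\<lambda>f. {T \<in> Sol_X d X \<gamma> G J. \<forall>x\<in>cells X 1. f 1 x = [q (T x)]})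
    (Maps_bar d X \<gamma> G J) (Sol_X d X \<gamma> G J // gauge_rel d X \<gamma> G J)"
    (is "bij_betw ?\<Phi> _ _")
proof -
  interpret X: simplicial_set X by fact
  have Xt: "triangles_closed X d" using X.triangles_closed d_gt_1 by simp
  interpret Xt: triangles_closed X d by (rule Xt)
  note Nt = Nbar.triangles_closed_axioms
  note \<gamma>c = cocycles_subset_cochains [OF \<gamma>(1)]
  obtain c S where c: "c \<in> carrier (cochain_group d Nbar 2)" "gamma_class d G J = H2_class d Nbar c"
    and S: "S \<in> Sol_X d Nbar c G J" "\<And>y. y \<in> cells Nbar 1 \<Longrightarrow> [q (S y)] = y"
    using universal_solution by blast
  let ?pull = "\<lambda>f. \<lambda>\<sigma>\<in>cells X 2. c (f (2::nat) \<sigma>)"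
  have Maps_iff: "f \<in> Maps_bar d X \<gamma> G J \<longleftrightarrow> simplicial_map X Nbar f \<and> H2_class d X (?pull f) = H2_class d X \<gamma>" for f
    unfolding Maps_bar_def using H2_pullback_class [OF Xt Nt _ c(1)] c(2) by auto
  have pulled: "(\<lambda>x\<in>cells X 1. S (f 1 x)) \<in> Sol_X d X (?pull f) G J"
      "?pull f \<in> carrier (cochain_group d X 2)" "x \<in> cells X 1 \<Longrightarrow> f 1 x = [q (S (f 1 x))]"
    if "simplicial_map X Nbar f" for f x
    using Sol_X_pullback [OF Xt Nt that S(1)] pullback_cochain [OF that c(1)]
      S(2) simplicial_map_cells [OF that] by auto
  have nonempty_iff: "?\<Phi> f \<noteq> {} \<longleftrightarrow> f \<in> Maps_bar d X \<gamma> G J" if f: "simplicial_map X Nbar f" for f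
  proof
    assume "?\<Phi> f \<noteq> {}"
    then obtain T where T: "T \<in> Sol_X d X \<gamma> G J" "\<forall>x\<in>cells X 1. f 1 x = [q (T x)]" by blast
    have "q ((\<lambda>x\<in>cells X 1. S (f 1 x)) x) = q (T x)" if "x \<in> cells X 1" for x
      using pulled(3) [OF f that] T(2) that by simp
    then have "H2_class d X (?pull f) = H2_class d X \<gamma>"
      using H2_class_eq_if_same_image [OF Xt pulled(1) [OF f] T(1)] pulled(2) [OF f] \<gamma>c by blast
    then show "f \<in> Maps_bar d X \<gamma> G J" using Maps_iff f by blast
  next
    assume "f \<in> Maps_bar d X \<gamma> G J"
    then have "?pull f \<in> H2_class d X \<gamma>"
      using Maps_iff Xt.H2_class_eq_iff pulled(2) [OF f] \<gamma>c by blast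
    then obtain h where h: "\<forall>\<sigma>\<in>cells X 2.
        ?pull f \<sigma> = (h (face X 2 0 \<sigma>) - h (face X 2 1 \<sigma>) + h (face X 2 2 \<sigma>) + \<gamma> \<sigma>) mod int d"
      using Xt.H2_class_iff pulled(2) [OF f] by blast
    (* The cochain h bounds the difference of the two cocycles, so it turns the pulled back
       solution into one for gamma. *)
    let ?T = "\<lambda>x\<in>cells X 1. J [^] h x \<otimes> (\<lambda>x\<in>cells X 1. S (f 1 x)) x"
    have "?T \<in> Sol_X d X \<gamma> G J"
      using h unfolding Sol_X_twist_iff [OF Xt pulled(1) [OF f]] by (metis mod_mod_trivial)
    moreover have "f 1 x = [q (?T x)]" if x: "x \<in> cells X 1" for x
    proof -
      have "S (f 1 x) \<in> carrier G"
        using S(1) simplicial_map_cells [OF f x] by (auto simp: Sol_X_iff Nbar.face_triangle)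
      then show ?thesis using pulled(3) [OF f x] x by simp
    qed
    ultimately show "?\<Phi> f \<noteq> {}" by blast
  qed
  have fibre: "?\<Phi> f = gauge_rel d X \<gamma> G J `` {T}" if "T \<in> ?\<Phi> f" for f T
    using that gauge_class_eq_fibre [OF Xt, of T \<gamma>] by auto
  show ?thesis
  proof (rule bij_betw_imageI)
    show "inj_on ?\<Phi> (Maps_bar d X \<gamma> G J)"
    proof (rule inj_onI)
      fix f g assume f: "f \<in> Maps_bar d X \<gamma> G J" and g: "g \<in> Maps_bar d X \<gamma> G J" and eq: "?\<Phi> f = ?\<Phi> g"
      have maps: "simplicial_map X Nbar f" "simplicial_map X Nbar g"
        using f g Maps_iff by blast+
      obtain T where "T \<in> ?\<Phi> f" using nonempty_iff maps(1) f by blast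
      moreover from this have "T \<in> ?\<Phi> g" using eq by simp
      ultimately show "f = g"
        by (intro simplicial_map_Nbar_eqI [OF X maps]) simp
    qed
    show "?\<Phi> ` Maps_bar d X \<gamma> G J = Sol_X d X \<gamma> G J // gauge_rel d X \<gamma> G J"
    proof (intro equalityI subsetI)
      fix Q assume "Q \<in> ?\<Phi> ` Maps_bar d X \<gamma> G J"
      then obtain f where f: "f \<in> Maps_bar d X \<gamma> G J" "Q = ?\<Phi> f" by blast
      then obtain T where T: "T \<in> ?\<Phi> f" using nonempty_iff Maps_iff by blast
      then have "T \<in> Sol_X d X \<gamma> G J" by simp
      then show "Q \<in> Sol_X d X \<gamma> G J // gauge_rel d X \<gamma> G J"
        unfolding f(2) fibre [where f = f and T = T, OF T] by (rule quotientI)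
    next
      fix Q assume "Q \<in> Sol_X d X \<gamma> G J // gauge_rel d X \<gamma> G J"
      then obtain T where T: "T \<in> Sol_X d X \<gamma> G J" "Q = gauge_rel d X \<gamma> G J `` {T}"
        by (rule quotientE)
      obtain f where f: "simplicial_map X Nbar f" "\<And>x. x \<in> cells X 1 \<Longrightarrow> f 1 x = [q (T x)]"
        using simplicial_map_of_solution [OF X T(1) \<gamma>(2)] by blast
      then have "T \<in> ?\<Phi> f" using T(1) by blast
      then have "Q = ?\<Phi> f" "f \<in> Maps_bar d X \<gamma> G J"
        using fibre T(2) nonempty_iff f(1) by blast+
      then show "Q \<in> ?\<Phi> ` Maps_bar d X \<gamma> G J" by blast
    qed
  qed
qed

end

section \<open>The correspondence\<close>

theorem corollary3p14:
  fixes d :: nat and X :: "'a sset" and \<gamma> :: "'a \<Rightarrow> int"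
    and G :: "('g, 'm) monoid_scheme" and J :: 'g
  assumes "d > 1"
    and "simplicial_set X" and "sset_connected X"
    and "\<gamma> \<in> cocycles d X 2" and "normalized X \<gamma>"
    and "group G"
    and "J \<in> carrier G" and "\<forall>g\<in>carrier G. J \<otimes>\<^bsub>G\<^esub> g = g \<otimes>\<^bsub>G\<^esub> J" and "group.ord G J = d"
  shows "bij_betw (\<lambda>\<theta>. \<lambda>x\<in>cells X 1. \<theta> (sol_el_X d X \<gamma> (Gen x)))
           (Hom_sol d X \<gamma> G J) (Sol_X d X \<gamma> G J)
    \<and> bij_betw (\<lambda>\<theta>. \<lambda>x\<in>cells X 1. \<theta> (pi1_el d (twisted_product d X \<gamma>) ([0], x)))
           (Hom_pi1 d X \<gamma> G J) (Sol_X d X \<gamma> G J)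
    \<and> bij_betw (\<lambda>f. {T \<in> Sol_X d X \<gamma> G J. \<forall>x\<in>cells X 1. f 1 x = [J_coset G J (T x)]})
           (Maps_bar d X \<gamma> G J) (Sol_X d X \<gamma> G J // gauge_rel d X \<gamma> G J)"
proof -
  interpret central_cyclic G d J
    using assms by (simp add: central_cyclic_def central_cyclic_axioms_def)
  show ?thesis
    using bij_betw_sol_group_homs [of "cells X 1" "cells X 2" "A_mat d X" "b_vec d \<gamma>"]
      bij_betw_pi1_homs [of X \<gamma>] bij_betw_maps_gauge_classes [of X \<gamma>] assms(2-5)
    unfolding Hom_sol_def sol_group_X_def sol_el_X_def Sol_X_def [symmetric] by blast
qed

end
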